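(* Let $X$ be a holomorphic vector field defined in a neighborhood of the origin of $\mathbb{C}^3$, singular at the origin. Denote by $\lambda_1,\lambda_2,\lambda_3$ the eigenvalues of the linear part of $X$ at the origin. Assume that $\lambda_3=0$. Assume also that $\lambda_1,\lambda_2$ are non-vanishing eigenvalues not satisfying any resonance relation and belonging to the Poincaré domain. Then there is an analytic change of coordinates in which the vector field is given by $$X=[\lambda_1y_1+y_3\psi_1(y_1,y_2,y_3)]\frac{\partial}{\partial y_1}+[\lambda_2y_2+y_3\psi_2(y_1,y_2,y_3)]\frac{\partial}{\partial y_2}+y_3H(y_1,y_2,y_3)\frac{\partial}{\partial y_3},$$ with $\psi_1(0,0,0)=\psi_2(0,0,0)=H(0,0,0)=0$. In particular, $\{y_3=0\}$ is an invariant $2$-plane.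
   Context: The pair $(\lambda_1,\lambda_2)\in\mathbb{C}^2$ satisfies a resonance relation if, for some $i\in\{1,2\}$, there is $(i_1,i_2)\in\mathbb{N}_0^2$ with $i_1+i_2\geq 2$ and $\lambda_i=i_1\lambda_1+i_2\lambda_2$, where $\mathbb{N}_0=\{0,1,2,\dots\}$. The pair belongs to the Poincaré domain if the convex hull of $\{\lambda_1,\lambda_2\}$ in $\mathbb{C}$ does not contain $0$. An analytic change of coordinates is a local holomorphic diffeomorphism of $(\mathbb{C}^3,0)$ fixing the origin, with new coordinates $(y_1,y_2,y_3)$. The functions $\psi_1,\psi_2,H$ are holomorphic in a neighborhood of the origin.
   Formalization: When λ1 = λ2, the linear part of X at the origin is additionally assumed diagonalizable; without this the claim fails, e.g. for (y1+y2)∂/∂y1 + y2∂/∂y2, and the stated normal form always forces it. *)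

theory Defs
  imports "HOL-Analysis.Analysis"
begin

(* Holomorphy in several variables is real Frechet differentiability with a
   complex-linear derivative at every point of an open set. *)
definition mv_holomorphic_on :: "(complex^'n \<Rightarrow> complex) \<Rightarrow> (complex^'n) set \<Rightarrow> bool" where
  "mv_holomorphic_on f U \<longleftrightarrow>
     open U \<and> (\<forall>z\<in>U. \<exists>a::complex^'n. (f has_derivative (\<lambda>h. \<Sum>i\<in>UNIV. a $ i * h $ i)) (at z))"

definition holomorphic_map_on :: "(complex^'n \<Rightarrow> complex^'m) \<Rightarrow> (complex^'n) set \<Rightarrow> bool" where
  "holomorphic_map_on F U \<longleftrightarrow> (\<forall>i. mv_holomorphic_on (\<lambda>z. F z $ i) U)"

definition local_biholomorphism ::
    "(complex^'n \<Rightarrow> complex^'n) \<Rightarrow> (complex^'n) set \<Rightarrow> (complex^'n) set \<Rightarrow> bool" where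
  "local_biholomorphism \<Phi> V W \<longleftrightarrow>
     open V \<and> 0 \<in> V \<and> open W \<and> 0 \<in> W \<and> \<Phi> 0 = 0 \<and> bij_betw \<Phi> V W \<and>
     holomorphic_map_on \<Phi> V \<and> holomorphic_map_on (inv_into V \<Phi>) W"

(* Y is the expression of X in the coordinates y = \<Phi> x, i.e. the push-forward of X:
   Y (\<Phi> x) = D\<Phi>(x) X(x). *)
definition expressed_in_coordinates ::
    "(complex^'n \<Rightarrow> complex^'n) \<Rightarrow> (complex^'n \<Rightarrow> complex^'n) \<Rightarrow> (complex^'n) set \<Rightarrow>
     (complex^'n \<Rightarrow> complex^'n) \<Rightarrow> bool" where
  "expressed_in_coordinates X \<Phi> V Y \<longleftrightarrow>
     (\<forall>x\<in>V. Y (\<Phi> x) = frechet_derivative \<Phi> (at x) (X x))"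

(* The eigenvalues, listed with algebraic multiplicity. *)
definition eigenvalues3 :: "complex^3^3 \<Rightarrow> complex \<Rightarrow> complex \<Rightarrow> complex \<Rightarrow> bool" where
  "eigenvalues3 A l1 l2 l3 \<longleftrightarrow>
     (\<forall>t. det (mat t - A) = (t - l1) * (t - l2) * (t - l3))"

(* Assumed of the linear part only for l1 = l2, where it does not follow from the
   eigenvalue hypotheses: (y1 + y2) d/dy1 + y2 d/dy2 has a Jordan block and satisfies
   all of them, whereas the normal form has the diagonal linear part diag (l1, l2, 0). *)
definition diagonalizable :: "complex^'n^'n \<Rightarrow> bool" where
  "diagonalizable A \<longleftrightarrow>
     (\<exists>P D :: complex^'n^'n. invertible P \<and> (\<forall>i j. i \<noteq> j \<longrightarrow> D $ i $ j = 0) \<and> A ** P = P ** D)"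

definition satisfies_resonance :: "complex \<Rightarrow> complex \<Rightarrow> bool" where
  "satisfies_resonance l1 l2 \<longleftrightarrow>
     (\<exists>i1 i2 :: nat. i1 + i2 \<ge> 2 \<and>
        (l1 = of_nat i1 * l1 + of_nat i2 * l2 \<or> l2 = of_nat i1 * l1 + of_nat i2 * l2))"

definition in_poincare_domain :: "complex \<Rightarrow> complex \<Rightarrow> bool" where
  "in_poincare_domain l1 l2 \<longleftrightarrow> 0 \<notin> convex hull {l1, l2}"

definition normal_form ::
    "complex \<Rightarrow> complex \<Rightarrow> (complex^3 \<Rightarrow> complex) \<Rightarrow> (complex^3 \<Rightarrow> complex) \<Rightarrow>
     (complex^3 \<Rightarrow> complex) \<Rightarrow> complex^3 \<Rightarrow> complex^3" where
  "normal_form l1 l2 \<psi>1 \<psi>2 H y =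
     vector [l1 * y $ 1 + y $ 3 * \<psi>1 y, l2 * y $ 2 + y $ 3 * \<psi>2 y, y $ 3 * H y]"

(* Invariance of a linear subspace S means tangency of Y to S at the points of S;
   the tangent space of S at each of its points is S itself. *)
definition invariant_subspace_on ::
    "(complex^'n \<Rightarrow> complex^'n) \<Rightarrow> (complex^'n) set \<Rightarrow> (complex^'n) set \<Rightarrow> bool" where
  "invariant_subspace_on Y W S \<longleftrightarrow> (\<forall>y\<in>W \<inter> S. Y y \<in> S)"

end

theory Submission
  imports Defs "HOL-Complex_Analysis.Complex_Analysis" "HOL-Real_Asymp.Real_Asymp"
begin

no_notation fps_nth (infixl \<open>$\<close> 75)

text \<open>
  Let \<open>A = diag(l1, l2, 0)\<close> be the linear part, in suitable linear coordinates. The key step is a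
  parametrized surface \<open>G(u1, u2)\<close> in \<open>\<complex>\<^sup>3\<close> with \<open>DG(u)(l1 u1, l2 u2) = X(G(u))\<close>: it is at once an invariant
  surface and a linearization of \<open>X\<close> on it. Writing \<open>G = (\<rho> u1, \<rho> u2, 0) + g\<close> and \<open>X = A + F\<close>, the
  coefficients of \<open>g\<close> satisfy \<open>(i l1 + j l2 - l\<^sub>m) g\<^sub>m\<^sub>,\<^sub>i\<^sub>j = (F\<^sub>m(G))\<^sub>i\<^sub>j\<close>. In the Poincare domain
  and without resonances these divisors are bounded away from \<open>0\<close> for \<open>i + j \<ge> 2\<close>, so division by them is a
  bounded operator on the Banach algebra of absolutely summable power series in two variables, and for small
  \<open>\<rho>\<close> the equation for \<open>g\<close> is a contraction.

  The coordinates are the inverse of \<open>Q(y) = G(y1, y2) + y3 e3\<close>. In them \<open>X\<close> becomes \<open>(l1 y1, l2 y2, 0)\<close> on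
  \<open>y3 = 0\<close>, so the difference is divisible by \<open>y3\<close>; the quotients vanish at \<open>0\<close> because \<open>Q\<close> fixes the
  \<open>y3\<close>-axis pointwise and \<open>A e3 = 0\<close>.
\<close>

section \<open>The Banach algebra of absolutely summable power series\<close>

text \<open>The eigenvalue \<open>0\<close> puts a full linearization out of reach in general:
  adding multiples of it gives relations such as \<open>l1 = l1 + k * 0\<close> in every degree.
  Hence \<open>X\<close> is linearized only on a surface tangent to the eigendirections of
  \<open>l1\<close> and \<open>l2\<close>, and the terms divisible by \<open>y3\<close> are left
  alone. The surface is sought as a parametrization with prescribed linear dynamics rather than as a
  graph. For a graph, the derivative of the unknown would be multiplied by nonlinear terms that
  contain the unknown. Here the unknown is differentiated only along a fixed linear field, and this
  derivation is diagonal on monomials. Dividing by its eigenvalues acts coefficient by coefficient,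
  so a norm that sums absolute values of coefficients turns bounded reciprocals into a bounded
  operator, and no radius of convergence is lost in the iteration. Products and substitution are
  operations of the same Banach algebra; functions are recovered by evaluating the fixed point on
  the unit bidisc.\<close>

class cbanach_algebra = real_normed_algebra_1 + banach + comm_ring_1

instance complex :: cbanach_algebra ..

text \<open>The coefficients lie in an arbitrary commutative Banach algebra so that the construction
  applies to itself: \<open>complex ps ps\<close> is the algebra of absolutely summable series in
  two variables.\<close>

typedef (overloaded) 'a ps =
  "{f :: 'a::cbanach_algebra fps. summable (\<lambda>n. norm (fps_nth f n))}"
  morphisms fps_of Abs_ps
  by (rule exI[of _ 0]) simp

setup_lifting type_definition_ps

text \<open>The Cauchy product of the two norm series dominates the norms of the product termwise.
  The first part makes \<open>ps\<close> closed under products, the second makes its norm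
  submultiplicative.\<close>

lemma sum_norm_fps_mult:
  fixes f g :: "'a::cbanach_algebra fps"
  assumes f: "summable (\<lambda>n. norm (fps_nth f n))" and g: "summable (\<lambda>n. norm (fps_nth g n))"
  shows "summable (\<lambda>n. norm (fps_nth (f * g) n))"
    and "(\<Sum>n. norm (fps_nth (f * g) n)) \<le> (\<Sum>n. norm (fps_nth f n)) * (\<Sum>n. norm (fps_nth g n))"
proof -
  let ?p = "\<lambda>k. \<Sum>i\<le>k. norm (fps_nth f i) * norm (fps_nth g (k - i))"
  have s: "?p sums ((\<Sum>n. norm (fps_nth f n)) * (\<Sum>n. norm (fps_nth g n)))"
    using Cauchy_product_sums[of "\<lambda>n. norm (fps_nth f n)" "\<lambda>n. norm (fps_nth g n)"] f g by simp
  have le: "norm (fps_nth (f * g) n) \<le> ?p n" for n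
    unfolding fps_mult_nth atMost_atLeast0
    by (intro order.trans[OF norm_sum] sum_mono norm_mult_ineq)
  show 1: "summable (\<lambda>n. norm (fps_nth (f * g) n))"
    using le s by (intro summable_comparison_test[OF _ sums_summable[OF s]]) auto
  show "(\<Sum>n. norm (fps_nth (f * g) n)) \<le> (\<Sum>n. norm (fps_nth f n)) * (\<Sum>n. norm (fps_nth g n))"
    using suminf_le[OF le 1 sums_summable[OF s]] sums_unique[OF s] by simp
qed

instantiation ps :: (cbanach_algebra) comm_ring_1
begin
lift_definition zero_ps :: "'a ps" is 0 by simp
lift_definition one_ps :: "'a ps" is 1
  by (rule summable_finite[of "{0}"]) auto
lift_definition plus_ps :: "'a ps \<Rightarrow> 'a ps \<Rightarrow> 'a ps" is "(+)"
  using summable_norm_comparison_test[OF _ summable_add] by (fastforce intro: norm_triangle_ineq)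
lift_definition uminus_ps :: "'a ps \<Rightarrow> 'a ps" is "uminus" by simp
lift_definition minus_ps :: "'a ps \<Rightarrow> 'a ps \<Rightarrow> 'a ps" is "(-)"
  using summable_norm_comparison_test[OF _ summable_add] by (fastforce intro: norm_triangle_ineq4)
lift_definition times_ps :: "'a ps \<Rightarrow> 'a ps \<Rightarrow> 'a ps" is "(*)"
  by (rule sum_norm_fps_mult(1))
instance
  by standard (transfer; simp add: algebra_simps)+
end

instantiation ps :: (cbanach_algebra) real_vector
begin
lift_definition scaleR_ps :: "real \<Rightarrow> 'a ps \<Rightarrow> 'a ps" is "\<lambda>r f. Abs_fps (\<lambda>n. r *\<^sub>R fps_nth f n)"
  by (auto intro: summable_mult)
instance
  by standard (transfer; simp add: fps_eq_iff algebra_simps)+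
end

instantiation ps :: (cbanach_algebra) real_normed_algebra_1
begin
lift_definition norm_ps :: "'a ps \<Rightarrow> real" is "\<lambda>f. \<Sum>n. norm (fps_nth f n)" .
definition dist_ps :: "'a ps \<Rightarrow> 'a ps \<Rightarrow> real" where "dist_ps a b = norm (a - b)"
definition uniformity_ps :: "('a ps \<times> 'a ps) filter" where
  "uniformity_ps = (INF e\<in>{0<..}. principal {(x, y). dist (x::'a ps) y < e})"
definition open_ps :: "'a ps set \<Rightarrow> bool" where
  "open_ps U \<longleftrightarrow> (\<forall>x\<in>U. eventually (\<lambda>(x', y). x' = x \<longrightarrow> y \<in> U) uniformity)"
definition sgn_ps :: "'a ps \<Rightarrow> 'a ps" where "sgn_ps a = a /\<^sub>R norm a"
instance
proof
  fix a b c :: "'a ps" and r s :: real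
  show "r *\<^sub>R a * b = r *\<^sub>R (a * b)" "a * r *\<^sub>R b = r *\<^sub>R (a * b)"
    by (transfer; simp add: fps_eq_iff fps_mult_nth scaleR_sum_right)+
  show "dist a b = norm (a - b)" by (simp add: dist_ps_def)
  show "sgn a = a /\<^sub>R norm a" by (simp add: sgn_ps_def)
  show "(uniformity :: ('a ps \<times> 'a ps) filter) = (INF e\<in>{0<..}. principal {(x, y). dist x y < e})"
    by (simp add: uniformity_ps_def)
  show "open U \<longleftrightarrow> (\<forall>x\<in>U. \<forall>\<^sub>F (x', y) in uniformity. x' = x \<longrightarrow> y \<in> U)" for U :: "'a ps set"
    by (simp add: open_ps_def)
  show "norm a = 0 \<longleftrightarrow> a = 0"
    by transfer (auto simp: suminf_eq_zero_iff fps_eq_iff)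
  show "norm (a + b) \<le> norm a + norm b"
  proof transfer
    fix f g :: "'a fps"
    assume fg: "summable (\<lambda>n. norm (fps_nth f n))" "summable (\<lambda>n. norm (fps_nth g n))"
    have "(\<Sum>n. norm (fps_nth (f + g) n)) \<le> (\<Sum>n. norm (fps_nth f n) + norm (fps_nth g n))"
      using fg by (intro suminf_le summable_add summable_comparison_test[OF _ summable_add[OF fg]])
         (auto intro: norm_triangle_ineq)
    also have "\<dots> = (\<Sum>n. norm (fps_nth f n)) + (\<Sum>n. norm (fps_nth g n))"
      using fg by (simp add: suminf_add)
    finally show "(\<Sum>n. norm (fps_nth (f + g) n)) \<le> (\<Sum>n. norm (fps_nth f n)) + (\<Sum>n. norm (fps_nth g n))" .
  qed
  show "norm (r *\<^sub>R a) = \<bar>r\<bar> * norm a"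
    by transfer (simp add: suminf_mult)
  show "norm (a * b) \<le> norm a * norm b"
    by transfer (rule sum_norm_fps_mult(2))
  show "norm (1 :: 'a ps) = 1"
  proof transfer
    have "(\<Sum>n. norm (fps_nth (1 :: 'a fps) n)) = (\<Sum>n\<in>{0}. norm (fps_nth (1 :: 'a fps) n))"
      by (rule suminf_finite) auto
    then show "(\<Sum>n. norm (fps_nth (1 :: 'a fps) n)) = 1" by simp
  qed
qed
end

lift_definition ps_nth :: "'a::cbanach_algebra ps \<Rightarrow> nat \<Rightarrow> 'a" is fps_nth .

lemma ps_eqI: "(\<And>n. ps_nth a n = ps_nth b n) \<Longrightarrow> a = b"
  by transfer (simp add: fps_eq_iff)

lemma summable_norm_ps_nth: "summable (\<lambda>n. norm (ps_nth a n))"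
  by transfer simp

lemma norm_ps_eq: "norm a = (\<Sum>n. norm (ps_nth a n))"
  by transfer simp

lemma ps_nth_simps [simp]:
  "ps_nth 0 n = 0" "ps_nth 1 n = (if n = 0 then 1 else 0)"
  "ps_nth (a + b) n = ps_nth a n + ps_nth b n" "ps_nth (a - b) n = ps_nth a n - ps_nth b n"
  "ps_nth (- a) n = - ps_nth a n" "ps_nth (r *\<^sub>R a) n = r *\<^sub>R ps_nth a n"
  by (transfer; simp)+

lemma ps_nth_mult: "ps_nth (a * b) n = (\<Sum>i\<le>n. ps_nth a i * ps_nth b (n - i))"
  by transfer (simp add: fps_mult_nth atMost_atLeast0)

text \<open>The value \<open>0\<close> on a non-summable sequence is a default that makes the
  function total; \<open>ps_nth_mk_ps\<close> reads off coefficients under summability.\<close>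

lift_definition mk_ps :: "(nat \<Rightarrow> 'a) \<Rightarrow> 'a::cbanach_algebra ps" is
  "\<lambda>f. if summable (\<lambda>n. norm (f n)) then Abs_fps f else 0"
  by simp

lemma ps_nth_mk_ps: "summable (\<lambda>n. norm (f n)) \<Longrightarrow> ps_nth (mk_ps f) n = f n"
  by transfer simp

lemma norm_ps_nth_le: "norm (ps_nth a n) \<le> norm a"
proof -
  have "(\<Sum>k\<in>{n}. norm (ps_nth a k)) \<le> (\<Sum>k. norm (ps_nth a k))"
    by (rule sum_le_suminf[OF summable_norm_ps_nth]) auto
  then show ?thesis by (simp add: norm_ps_eq)
qed

lemma bounded_linear_ps_nth: "bounded_linear (\<lambda>a. ps_nth a n)"
  by (rule bounded_linear_intro[of _ 1]) (auto simp: norm_ps_nth_le)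

text \<open>Completeness is that of \<open>l^1\<close>: a Cauchy sequence converges in each
  coefficient, and the sequence of limits is shown to be summable and to be the limit in
  norm.\<close>

instance ps :: (cbanach_algebra) cbanach_algebra
proof
  fix X :: "nat \<Rightarrow> 'a ps"
  assume X: "Cauchy X"
  define L where "L n = lim (\<lambda>k. ps_nth (X k) n)" for n
  have L: "(\<lambda>k. ps_nth (X k) n) \<longlonglongrightarrow> L n" for n
    using bounded_linear.Cauchy[OF bounded_linear_ps_nth X] Cauchy_convergent convergent_LIMSEQ_iff
    unfolding L_def by blast
  \<comment> \<open>Finite partial sums pass to the limit in \<open>k\<close> with a bound that does
    not depend on \<open>N\<close>. This one estimate gives both the summability of \<open>L\<close>
    and the convergence in norm.\<close>
  have part: "(\<Sum>n<N. norm (ps_nth (X m) n - L n)) \<le> e"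
    if m: "\<And>k. k \<ge> M \<Longrightarrow> norm (X m - X k) < e" for N m M e
  proof (rule tendsto_upperbound)
    show "(\<lambda>k. \<Sum>n<N. norm (ps_nth (X m) n - ps_nth (X k) n)) \<longlonglongrightarrow> (\<Sum>n<N. norm (ps_nth (X m) n - L n))"
      by (intro tendsto_intros L)
    show "\<forall>\<^sub>F k in sequentially. (\<Sum>n<N. norm (ps_nth (X m) n - ps_nth (X k) n)) \<le> e"
    proof (rule eventually_sequentiallyI)
      fix k assume "k \<ge> M"
      have "(\<Sum>n<N. norm (ps_nth (X m - X k) n)) \<le> norm (X m - X k)"
        unfolding norm_ps_eq by (rule sum_le_suminf[OF summable_norm_ps_nth]) auto
      then show "(\<Sum>n<N. norm (ps_nth (X m) n - ps_nth (X k) n)) \<le> e"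
        using m[OF \<open>k \<ge> M\<close>] by simp
    qed
  qed simp
  have cau: "\<exists>M. \<forall>m\<ge>M. \<forall>k\<ge>M. norm (X m - X k) < e" if "e > 0" for e
    using X that unfolding Cauchy_def dist_norm by blast
  have sumL: "summable (\<lambda>n. norm (L n))"
  proof -
    obtain M where M: "\<forall>m\<ge>M. \<forall>k\<ge>M. norm (X m - X k) < 1" using cau[of 1] by auto
    have "summable (\<lambda>n. norm (ps_nth (X M) n - L n))"
      by (rule summableI_nonneg_bounded[of _ 1]) (use part[of M M 1] M in auto)
    then have "summable (\<lambda>n. norm (ps_nth (X M) n) + norm (ps_nth (X M) n - L n))"
      by (intro summable_add summable_norm_ps_nth)
    then show ?thesis
      by (rule summable_comparison_test[rotated])
        (auto intro!: exI[of _ 0] simp: norm_minus_commute norm_triangle_sub)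
  qed
  have "X \<longlonglongrightarrow> mk_ps L"
  proof (rule LIMSEQ_I)
    fix e :: real assume "e > 0"
    then obtain M where M: "\<forall>m\<ge>M. \<forall>k\<ge>M. norm (X m - X k) < e / 2" using cau[of "e/2"] by auto
    have "norm (X m - mk_ps L) < e" if "m \<ge> M" for m
    proof -
      have "norm (X m - mk_ps L) \<le> e / 2"
        unfolding norm_ps_eq
        by (rule suminf_le_const[OF summable_norm_ps_nth])
          (use part[of M m "e/2"] M that in \<open>auto simp: ps_nth_mk_ps[OF sumL]\<close>)
      then show ?thesis using \<open>e > 0\<close> by simp
    qed
    then show "\<exists>no. \<forall>n\<ge>no. norm (X n - mk_ps L) < e" by blast
  qed
  then show "convergent X" by (rule convergentI)
qed

definition ps_const :: "'a::cbanach_algebra \<Rightarrow> 'a ps" where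
  "ps_const c = mk_ps (\<lambda>n. if n = 0 then c else 0)"

definition ps_X :: "'a::cbanach_algebra ps" where
  "ps_X = mk_ps (\<lambda>n. if n = 1 then 1 else 0)"

lemma ps_nth_const [simp]: "ps_nth (ps_const c) n = (if n = 0 then c else 0)"
  unfolding ps_const_def by (subst ps_nth_mk_ps) (auto intro!: summable_finite[of "{0}"] split: if_splits)

lemma ps_nth_X [simp]: "ps_nth ps_X n = (if n = 1 then 1 else 0)"
  unfolding ps_X_def by (subst ps_nth_mk_ps) (auto intro!: summable_finite[of "{1}"] split: if_splits)

lemma norm_ps_const [simp]: "norm (ps_const c) = norm c"
proof -
  have "(\<Sum>n. norm (ps_nth (ps_const c) n)) = (\<Sum>n\<in>{0}. norm (ps_nth (ps_const c) n))"
    by (rule suminf_finite) auto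
  then show ?thesis by (simp add: norm_ps_eq)
qed

lemma norm_ps_X [simp]: "norm (ps_X :: 'a::cbanach_algebra ps) = 1"
proof -
  have "(\<Sum>n. norm (ps_nth (ps_X::'a ps) n)) = (\<Sum>n\<in>{1}. norm (ps_nth (ps_X :: 'a ps) n))"
    by (rule suminf_finite) auto
  then show ?thesis by (simp add: norm_ps_eq)
qed

lemma ps_const_simps:
  "ps_const 0 = 0" "ps_const 1 = 1" "ps_const (a + b) = ps_const a + ps_const b"
  "ps_const (a - b) = ps_const a - ps_const b"
  "ps_const (a * b) = ps_const a * ps_const b" 
  "ps_const (r *\<^sub>R a) = r *\<^sub>R ps_const a"
      apply (auto intro!: ps_eqI simp: ps_nth_mult if_distrib[of "\<lambda>x. x * _"] cong: if_cong)
  done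

text \<open>The point belongs to the coefficient algebra. Evaluating an element of
  \<open>complex ps ps\<close> at a constant series therefore leaves a series in the remaining
  variable.\<close>

definition ps_eval :: "'a::cbanach_algebra \<Rightarrow> 'a ps \<Rightarrow> 'a" where
  "ps_eval z a = (\<Sum>n. ps_nth a n * z ^ n)"

lemma norm_power_le_1:
  fixes z :: "'a::real_normed_algebra_1"
  shows "norm z \<le> 1 \<Longrightarrow> norm (z ^ n) \<le> 1"
  by (meson norm_ge_zero norm_power_ineq order_trans power_le_one)

lemma ps_eval_summable:
  assumes "norm z \<le> 1"
  shows "summable (\<lambda>n. norm (ps_nth a n * z ^ n))"
proof (rule summable_comparison_test[OF _ summable_norm_ps_nth[of a]], intro exI allI impI)
  fix n :: nat
  have "norm (ps_nth a n * z ^ n) \<le> norm (ps_nth a n) * norm (z ^ n)" by (rule norm_mult_ineq)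
  also have "\<dots> \<le> norm (ps_nth a n) * 1"
    by (intro mult_left_mono norm_power_le_1 assms) auto
  finally show "norm (norm (ps_nth a n * z ^ n)) \<le> norm (ps_nth a n)" by simp
qed

lemma norm_ps_eval_le:
  assumes "norm z \<le> 1"
  shows "norm (ps_eval z a) \<le> norm a"
proof -
  have "norm (ps_nth a n * z ^ n) \<le> norm (ps_nth a n)" for n
    using norm_mult_ineq[of "ps_nth a n" "z ^ n"]
      mult_left_mono[OF norm_power_le_1[OF assms, of n], of "norm (ps_nth a n)"] by simp
  then show ?thesis
    unfolding ps_eval_def norm_ps_eq
    by (intro order.trans[OF summable_norm[OF ps_eval_summable[OF assms]]]
        suminf_le ps_eval_summable[OF assms] summable_norm_ps_nth)
qed

lemma ps_eval_mult:
  assumes "norm z \<le> 1"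
  shows "ps_eval z (a * b) = ps_eval z a * ps_eval z b"
proof -
  have "(\<Sum>i\<le>k. ps_nth a i * z ^ i * (ps_nth b (k - i) * z ^ (k - i))) = ps_nth (a * b) k * z ^ k" for k
  proof -
    have "ps_nth a i * z ^ i * (ps_nth b (k - i) * z ^ (k - i)) = ps_nth a i * ps_nth b (k - i) * z ^ k"
      if "i \<le> k" for i
      using that by (simp add: power_add[symmetric] mult.assoc mult.left_commute)
    then show ?thesis by (simp add: ps_nth_mult sum_distrib_right)
  qed
  with Cauchy_product[OF ps_eval_summable[OF assms, of a] ps_eval_summable[OF assms, of b]]
  show ?thesis by (simp add: ps_eval_def)
qed

lemma ps_eval_const [simp]: "ps_eval z (ps_const c) = c"
proof -
  have "(\<Sum>n. ps_nth (ps_const c) n * z ^ n) = (\<Sum>n\<in>{0}. ps_nth (ps_const c) n * z ^ n)"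
    by (rule suminf_finite) auto
  then show ?thesis by (simp add: ps_eval_def)
qed

lemma bounded_linear_ps_eval:
  assumes "norm z \<le> 1"
  shows "bounded_linear (ps_eval z)"
proof (rule bounded_linear_intro[of _ 1])
  note s = summable_norm_cancel[OF ps_eval_summable[OF assms]]
  show "ps_eval z (a + b) = ps_eval z a + ps_eval z b" for a b
    unfolding ps_eval_def ps_nth_simps distrib_right by (rule suminf_add[OF s s, symmetric])
  show "ps_eval z (r *\<^sub>R a) = r *\<^sub>R ps_eval z a" for r a
    unfolding ps_eval_def using suminf_scaleR_right[OF s[of a], of r] by simp
  show "norm (ps_eval z a) \<le> norm a * 1" for a
    using norm_ps_eval_le[OF assms] by simp
qed

section \<open>Taylor expansion in three variables\<close>

definition tcoef :: "nat \<Rightarrow> (complex \<Rightarrow> complex) \<Rightarrow> complex" where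
  "tcoef n f = (deriv ^^ n) f 0 / fact n"

lemma tcoef_0 [simp]: "tcoef 0 f = f 0"
  by (simp add: tcoef_def)

lemma tcoef_1: "tcoef (Suc 0) f = deriv f 0"
  by (simp add: tcoef_def)

lemma tcoef_zero [simp]: "tcoef n (\<lambda>x. 0) = 0"
proof -
  have "(deriv ^^ n) (\<lambda>x. 0 :: complex) = (\<lambda>x. 0)"
    by (induction n) auto
  then show ?thesis by (simp add: tcoef_def)
qed

lemma tcoef_sums:
  assumes "f holomorphic_on ball 0 S" "norm z < S"
  shows "(\<lambda>n. tcoef n f * z ^ n) sums f z"
  using holomorphic_power_series[OF assms(1), of z] assms(2) by (simp add: tcoef_def)

lemma norm_tcoef_le:
  assumes "f holomorphic_on ball 0 S" "\<And>z. norm z < S \<Longrightarrow> norm (f z) \<le> M" "0 < R" "R < S"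
  shows "norm (tcoef n f) \<le> M / R ^ n"
proof -
  have "norm ((deriv ^^ n) f 0) \<le> fact n * M / R ^ n"
  proof (rule Cauchy_inequality)
    show "f holomorphic_on ball 0 R"
      using assms by (auto intro: holomorphic_on_subset)
    show "continuous_on (cball 0 R) f"
      using assms by (auto intro!: holomorphic_on_imp_continuous_on intro: holomorphic_on_subset)
  qed (use assms in auto)
  then show ?thesis
    by (simp add: tcoef_def norm_divide pos_divide_le_eq mult.commute)
qed

text \<open>After division by \<open>h ^ n\<close>, the terms beyond the \<open>n\<close>-th carry a
  factor \<open>h\<close> times a series dominated by a geometric one of ratio \<open>1/2\<close>,
  because \<open>norm h \<le> R / 2\<close>. The bound depends on \<open>a\<close> only through the
  Cauchy estimates, so it is uniform in any parameter on which \<open>a\<close> depends.\<close>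

lemma norm_tcoef_series_remainder:
  fixes a :: "nat \<Rightarrow> complex"
  assumes sums: "(\<lambda>n. a n * h ^ n) sums s" and a: "\<And>n. norm (a n) \<le> M / R ^ n"
    and h: "h \<noteq> 0" "norm h \<le> R / 2" and "0 < R"
  shows "norm ((s - (\<Sum>k<n. a k * h ^ k)) / h ^ n - a n) \<le> 2 * M / R ^ Suc n * norm h"
proof -
  have M: "0 \<le> M" using order.trans[OF norm_ge_zero a[of 0]] by simp
  have "(\<lambda>k. a (k + Suc n) * h ^ (k + Suc n)) sums (s - (\<Sum>k<Suc n. a k * h ^ k))"
    by (rule sums_split_initial_segment[OF sums])
  then have tail: "(\<lambda>k. a (k + Suc n) * h ^ k * h) sums ((s - (\<Sum>k<Suc n. a k * h ^ k)) / h ^ n)"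
    using h by (subst sums_mult_iff[of "h ^ n", symmetric]) (auto simp: power_add mult_ac)
  have eq: "(s - (\<Sum>k<Suc n. a k * h ^ k)) / h ^ n = (s - (\<Sum>k<n. a k * h ^ k)) / h ^ n - a n"
    using h by (simp add: field_simps)
  have geo: "(\<lambda>k. M / R ^ Suc n * norm h * (1/2) ^ k) sums (M / R ^ Suc n * norm h * 2)"
    using sums_mult[OF geometric_sums[of "1/2 :: real"], of "M / R ^ Suc n * norm h"] by simp
  have le: "norm (a (k + Suc n) * h ^ k * h) \<le> M / R ^ Suc n * norm h * (1/2) ^ k" for k
  proof -
    have "norm (a (k + Suc n)) * norm h ^ k \<le> M / R ^ (k + Suc n) * (R / 2) ^ k"
      using a[of "k + Suc n"] h M \<open>0 < R\<close> by (intro mult_mono power_mono) auto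
    also have "\<dots> = M / R ^ Suc n * (1/2) ^ k"
      using \<open>0 < R\<close> by (simp add: power_add power_divide)
    finally have "norm (a (k + Suc n)) * norm h ^ k * norm h \<le> M / R ^ Suc n * (1/2) ^ k * norm h"
      by (intro mult_right_mono) auto
    then show ?thesis by (simp add: norm_mult norm_power mult_ac)
  qed
  have "norm (\<Sum>k. a (k + Suc n) * h ^ k * h) \<le> (\<Sum>k. M / R ^ Suc n * norm h * (1/2) ^ k)"
    by (rule norm_suminf_le[OF le sums_summable[OF geo]])
  then show ?thesis
    using sums_unique[OF tail] sums_unique[OF geo] eq by (simp add: mult_ac)
qed

text \<open>
  The \<open>n\<close>-th coefficient is the uniform limit, as \<open>h\<close> tends to \<open>0\<close>, of
  \<open>(f h w - (\<Sum>k<n. a\<^sub>k w * h ^ k)) / h ^ n\<close>, which is holomorphic in \<open>w\<close> by induction.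
\<close>

lemma holomorphic_tcoef_param:
  fixes f :: "complex \<Rightarrow> complex \<Rightarrow> complex"
  assumes z: "\<And>w. norm w < S \<Longrightarrow> (\<lambda>z. f z w) holomorphic_on ball 0 S"
    and w: "\<And>z. norm z < S \<Longrightarrow> (\<lambda>w. f z w) holomorphic_on ball 0 S"
    and M: "\<And>z w. norm z < S \<Longrightarrow> norm w < S \<Longrightarrow> norm (f z w) \<le> M"
  shows "(\<lambda>w. tcoef n (\<lambda>z. f z w)) holomorphic_on ball 0 S"
proof (cases "S > 0")
  case True
  define R where "R = S / 2"
  have R: "0 < R" "R < S" using True by (auto simp: R_def)
  show ?thesis
  proof (induction n rule: less_induct)
    case (less n)
    \<comment> \<open>A null sequence of nonzero numbers; the shift by 2 gives
      \<open>norm (h m) \<le> R / 2\<close> already for \<open>m = 0\<close>.\<close>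
    define h :: "nat \<Rightarrow> complex" where "h m = of_real (R / (real m + 2))" for m
    have h: "h m \<noteq> 0" "norm (h m) \<le> R / 2" for m
      using R by (auto simp: h_def norm_divide divide_simps simp del: of_real_divide)
    have hS: "norm (h m) < S" for m using h(2)[of m] R by linarith
    define g where "g m w = (f (h m) w - (\<Sum>k<n. tcoef k (\<lambda>z. f z w) * h m ^ k)) / h m ^ n" for m w
    show ?case
    proof (rule holomorphic_uniform_sequence[of _ g])
      show "g m holomorphic_on ball 0 S" for m
        unfolding g_def using h hS by (intro holomorphic_intros w less.IH) auto
      fix x :: complex assume x: "x \<in> ball 0 S"
      then obtain d where d: "d > 0" "cball x d \<subseteq> ball 0 S"
        using open_contains_cball open_ball by metis
      have "uniform_limit (cball x d) g (\<lambda>w. tcoef n (\<lambda>z. f z w)) sequentially"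
      proof (rule uniform_limitI)
        fix e :: real assume "e > 0"
        have "(\<lambda>m. 2 * M / R ^ Suc n * norm (h m)) \<longlonglongrightarrow> 2 * M / R ^ Suc n * 0"
        proof (intro tendsto_mult tendsto_const)
          have "norm (h m) = R / (real m + 2)" for m
            using R unfolding h_def norm_of_real by simp
          moreover have "(\<lambda>m. R / (real m + 2)) \<longlonglongrightarrow> 0" by real_asymp
          ultimately show "(\<lambda>m. norm (h m)) \<longlonglongrightarrow> 0" by simp
        qed
        then have "\<forall>\<^sub>F m in sequentially. 2 * M / R ^ Suc n * norm (h m) < e"
          using \<open>e > 0\<close> by (intro order_tendstoD) auto
        then show "\<forall>\<^sub>F m in sequentially. \<forall>w\<in>cball x d. dist (g m w) (tcoef n (\<lambda>z. f z w)) < e"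
        proof eventually_elim
          case (elim m)
          show ?case
          proof
            fix w' assume "w' \<in> cball x d"
            then have w': "norm w' < S" using d by auto
            have "norm (g m w' - tcoef n (\<lambda>z. f z w')) \<le> 2 * M / R ^ Suc n * norm (h m)"
              unfolding g_def
              using norm_tcoef_le[OF z[OF w'] M[OF _ w'] R] h[of m] R
              by (intro norm_tcoef_series_remainder tcoef_sums[OF z[OF w'] hS]) auto
            then show "dist (g m w') (tcoef n (\<lambda>z. f z w')) < e"
              using elim by (simp add: dist_norm)
          qed
        qed
      qed
      with d show "\<exists>d>0. cball x d \<subseteq> ball 0 S \<and> uniform_limit (cball x d) g (\<lambda>w. tcoef n (\<lambda>z. f z w)) sequentially"
        by blast
    qed auto
  qed
qed (simp add: ball_empty holomorphic_on_def)

text \<open>Iterated one-variable coefficients, the innermost one in \<open>x\<close>. Each outer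
  step requires the inner coefficient to be holomorphic in its parameter, which
  \<open>holomorphic_tcoef_param\<close> supplies.\<close>

definition tcoef3 :: "(complex \<Rightarrow> complex \<Rightarrow> complex \<Rightarrow> complex) \<Rightarrow> nat \<times> nat \<times> nat \<Rightarrow> complex" where
  "tcoef3 f = (\<lambda>(i, j, k). tcoef k (\<lambda>z. tcoef j (\<lambda>y. tcoef i (\<lambda>x. f x y z))))"

lemma summable_on_prod:
  fixes f :: "'a \<Rightarrow> real" and g :: "'b \<Rightarrow> real"
  assumes "f summable_on A" "g summable_on B" "\<And>x. 0 \<le> f x" "\<And>y. 0 \<le> g y"
  shows "(\<lambda>(x, y). f x * g y) summable_on A \<times> B"
proof (rule summable_on_SigmaI)
  show "((\<lambda>y. case (x, y) of (x, y) \<Rightarrow> f x * g y) has_sum f x * infsum g B) B" for x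
    using has_sum_cmult_right[OF has_sum_infsum[OF assms(2)]] by simp
  show "(\<lambda>x. f x * infsum g B) summable_on A"
    by (rule summable_on_cmult_left[OF assms(1)])
qed (use assms in auto)

lemma summable_on_triple:
  fixes c :: "nat \<times> nat \<times> nat \<Rightarrow> 'a::real_normed_vector"
  assumes c: "\<And>i j k. norm (c (i, j, k)) \<le> u i * v j * w k"
    and u: "\<And>i. 0 \<le> u i" "summable u" and v: "\<And>i. 0 \<le> v i" "summable v"
    and w: "\<And>i. 0 \<le> w i" "summable w"
  shows "(\<lambda>\<beta>. norm (c \<beta>)) summable_on UNIV"
proof -
  note s = summable_nonneg_imp_summable_on[rotated]
  have "(\<lambda>(i, jk). u i * (\<lambda>(j, k). v j * w k) jk) summable_on UNIV \<times> (UNIV \<times> UNIV)"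
    by (intro summable_on_prod s) (use u v w in \<open>auto simp: case_prod_unfold\<close>)
  then have "(\<lambda>(i, jk). u i * (\<lambda>(j, k). v j * w k) jk) summable_on UNIV" by simp
  then show ?thesis
    by (rule summable_on_comparison_test) (use c in \<open>auto simp: mult.assoc\<close>)
qed

text \<open>One variable is expanded at a time, and each Cauchy estimate serves as the bound
  \<open>M\<close> for the next expansion. The resulting estimate on the triple coefficients gives
  joint absolute summability, which allows the three iterated sums to be merged into one.\<close>

lemma tcoef3:
  assumes x: "\<And>y z. norm y < S \<Longrightarrow> norm z < S \<Longrightarrow> (\<lambda>x. f x y z) holomorphic_on ball 0 S"
    and y: "\<And>x z. norm x < S \<Longrightarrow> norm z < S \<Longrightarrow> (\<lambda>y. f x y z) holomorphic_on ball 0 S"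
    and z: "\<And>x y. norm x < S \<Longrightarrow> norm y < S \<Longrightarrow> (\<lambda>z. f x y z) holomorphic_on ball 0 S"
    and M: "\<And>x y z. norm x < S \<Longrightarrow> norm y < S \<Longrightarrow> norm z < S \<Longrightarrow> norm (f x y z) \<le> M"
    and R: "0 < R" "R < S"
  shows norm_tcoef3_le: "norm (tcoef3 f (i, j, k)) \<le> M / R ^ (i + j + k)"
    and tcoef3_has_sum: "norm a < R \<Longrightarrow> norm b < R \<Longrightarrow> norm d < R \<Longrightarrow>
       ((\<lambda>(i, j, k). tcoef3 f (i, j, k) * (a ^ i * b ^ j * d ^ k)) has_sum f a b d) UNIV"
proof -
  define A where "A i y z = tcoef i (\<lambda>x. f x y z)" for i y z
  define B where "B i j z = tcoef j (\<lambda>y. A i y z)" for i j z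
  have c: "tcoef3 f (i, j, k) = tcoef k (B i j)" for i j k
    by (simp add: tcoef3_def A_def B_def[abs_def])
  have Ay: "(\<lambda>y. A i y z) holomorphic_on ball 0 S" if "norm z < S" for i z
    unfolding A_def by (rule holomorphic_tcoef_param) (use x y M that in auto)
  have Az: "(\<lambda>z. A i y z) holomorphic_on ball 0 S" if "norm y < S" for i y
    unfolding A_def by (rule holomorphic_tcoef_param[where f = "\<lambda>x z. f x y z"]) (use x z M that in auto)
  have AM: "norm (A i y z) \<le> M / R ^ i" if "norm y < S" "norm z < S" for i y z
    unfolding A_def by (rule norm_tcoef_le) (use x M R that in auto)
  have Bz: "B i j holomorphic_on ball 0 S" for i j
    unfolding B_def by (rule holomorphic_tcoef_param) (use Ay Az AM in auto)
  have BM: "norm (B i j z) \<le> M / R ^ (i + j)" if "norm z < S" for i j z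
    using norm_tcoef_le[OF Ay[OF that] AM[OF _ that] R, of j i]
    by (simp add: B_def power_add)
  show cM: "norm (tcoef3 f (i, j, k)) \<le> M / R ^ (i + j + k)" for i j k
    using norm_tcoef_le[OF Bz BM R, of k i j] by (simp add: c power_add)
  assume abd: "norm a < R" "norm b < R" "norm d < R"
  let ?t = "\<lambda>(i, j, k). tcoef3 f (i, j, k) * (a ^ i * b ^ j * d ^ k)"
  have M0: "0 \<le> M" using order.trans[OF norm_ge_zero M[of 0 0 0]] R by auto
  have abs: "(\<lambda>\<beta>. norm (?t \<beta>)) summable_on UNIV"
  proof (rule summable_on_triple)
    fix i j k
    have "norm (tcoef3 f (i, j, k)) * norm (a ^ i * b ^ j * d ^ k) \<le>
        M / R ^ (i + j + k) * norm (a ^ i * b ^ j * d ^ k)"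
      by (rule mult_right_mono[OF cM]) auto
    also have "\<dots> = M * (norm a / R) ^ i * (norm b / R) ^ j * (norm d / R) ^ k"
      by (simp add: norm_mult norm_power power_add power_divide)
    finally show "norm (?t (i, j, k)) \<le> M * (norm a / R) ^ i * (norm b / R) ^ j * (norm d / R) ^ k"
      by (simp add: norm_mult)
  qed (use abd R M0 in \<open>auto intro!: summable_mult summable_geometric\<close>)
  then have sum: "?t summable_on (UNIV \<times> (UNIV \<times> UNIV))"
    using abs_summable_summable by simp
  note hs = norm_summable_imp_has_sum[rotated]
  have geo: "summable (\<lambda>n. norm (q n * t ^ n))"
    if "\<And>n. norm (q n) \<le> N / R ^ n" "norm t < R" for q :: "nat \<Rightarrow> complex" and t N
  proof -
    have N: "0 \<le> N" using order.trans[OF norm_ge_zero that(1)[of 0]] by simp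
    show ?thesis
    proof (rule summable_comparison_test[OF _ summable_mult[OF summable_geometric[of "norm t / R"], of N]])
      show "\<exists>m. \<forall>n\<ge>m. norm (norm (q n * t ^ n)) \<le> N * (norm t / R) ^ n"
        using mult_right_mono[OF that(1), of "norm t ^ _"]
        by (auto simp: norm_mult norm_power power_divide)
    qed (use that R in auto)
  qed
  have abdS: "norm a < S" "norm b < S" "norm d < S" using abd R by auto
  have 3: "((\<lambda>k. tcoef3 f (i, j, k) * d ^ k) has_sum B i j d) UNIV" for i j
    unfolding c by (rule hs[OF tcoef_sums[OF Bz abdS(3)] geo[where N = "M / R ^ (i + j)"]])
      (use norm_tcoef_le[OF Bz[of i j] BM R] abd in auto)
  have 2: "((\<lambda>j. B i j d * b ^ j) has_sum A i b d) UNIV" for i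
    unfolding B_def by (rule hs[OF tcoef_sums[OF Ay[OF abdS(3)] abdS(2)] geo[where N = "M / R ^ i"]])
      (use norm_tcoef_le[OF Ay[OF abdS(3)] AM[OF _ abdS(3)] R] abd in auto)
  have 1: "((\<lambda>i. A i b d * a ^ i) has_sum f a b d) UNIV"
    unfolding A_def by (rule hs[OF tcoef_sums[OF x[OF abdS(2,3)] abdS(1)] geo])
      (use norm_tcoef_le[OF x[OF abdS(2,3)] M[OF _ abdS(2,3)] R] abd in auto)
  have 4: "((\<lambda>(j, k). ?t (i, j, k)) has_sum A i b d * a ^ i) (UNIV \<times> UNIV)" for i
  proof (rule has_sum_SigmaI)
    show "((\<lambda>k. case (j, k) of (j, k) \<Rightarrow> ?t (i, j, k)) has_sum (B i j d * b ^ j * a ^ i)) UNIV" for j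
      using has_sum_cmult_left[OF 3[of i j], of "b ^ j * a ^ i"] by (simp add: mult_ac)
    show "((\<lambda>j. B i j d * b ^ j * a ^ i) has_sum A i b d * a ^ i) UNIV"
      by (rule has_sum_cmult_left[OF 2])
    show "(\<lambda>(j, k). ?t (i, j, k)) summable_on UNIV \<times> UNIV"
      using summable_on_SigmaD1[of "\<lambda>i jk. ?t (i, jk)" UNIV "\<lambda>_. UNIV \<times> UNIV" i] sum
      by (simp add: case_prod_unfold)
  qed
  have "(?t has_sum f a b d) (UNIV \<times> (UNIV \<times> UNIV))"
  proof (rule has_sum_SigmaI)
    show "((\<lambda>jk. ?t (i, jk)) has_sum A i b d * a ^ i) (UNIV \<times> UNIV)" for i
      using 4[of i] by (simp add: case_prod_unfold)
    show "((\<lambda>i. A i b d * a ^ i) has_sum f a b d) UNIV" by (rule 1)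
  qed (use sum in auto)
  then show "(?t has_sum f a b d) UNIV" by simp
qed

section \<open>Power series in three variables\<close>

text \<open>
  Here \<open>p\<close> and \<open>q\<close> are the values at \<open>x\<close> and \<open>x + h\<close> of a monomial of degree \<open>n\<close>, \<open>d\<close> is its
  differential at \<open>x\<close> applied to \<open>h\<close>, and \<open>e\<close> stands for \<open>\<parallel>h\<parallel> / r\<close>.
\<close>

definition approx2 :: "real \<Rightarrow> real \<Rightarrow> nat \<Rightarrow> complex \<Rightarrow> complex \<Rightarrow> complex \<Rightarrow> bool" where
  "approx2 r e n p q d \<longleftrightarrow> norm p \<le> r ^ n \<and> norm q \<le> r ^ n \<and> norm d \<le> n * r ^ n * e \<and>
     norm (q - p) \<le> n * r ^ n * e \<and> norm (q - p - d) \<le> (real n)\<^sup>2 * r ^ n * e\<^sup>2"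

text \<open>The product rule with error bounds. The second-order errors add up to the factor
  \<open>n^2 + n * m + m^2\<close>, at most \<open>(n + m)^2\<close>; the weight \<open>n^2\<close>
  in \<open>approx2\<close> is chosen so that it survives products.\<close>

lemma approx2_mult:
  assumes pq: "approx2 r e n p q d" and st: "approx2 r e m s t f" and "0 \<le> r" "0 \<le> e"
  shows "approx2 r e (n + m) (p * s) (q * t) (d * s + p * f)"
proof -
  note P = pq[unfolded approx2_def] and S = st[unfolded approx2_def]
  note nn = norm_ge_zero zero_le_power \<open>0 \<le> r\<close> \<open>0 \<le> e\<close> mult_nonneg_nonneg of_nat_0_le_iff
  have 1: "norm (p * s) \<le> r ^ (n + m)"
    unfolding norm_mult power_add by (intro mult_mono nn) (use P S in auto)
  have 2: "norm (q * t) \<le> r ^ (n + m)"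
    unfolding norm_mult power_add by (intro mult_mono nn) (use P S in auto)
  have "norm (d * s) \<le> (n * r ^ n * e) * r ^ m"
    unfolding norm_mult by (intro mult_mono nn) (use P S in auto)
  moreover have "norm (p * f) \<le> r ^ n * (m * r ^ m * e)"
    unfolding norm_mult by (intro mult_mono nn) (use P S in auto)
  ultimately have 3: "norm (d * s + p * f) \<le> (n + m) * r ^ (n + m) * e"
    using norm_triangle_ineq[of "d * s" "p * f"] by (simp add: algebra_simps power_add)
  have "norm ((q - p) * t) \<le> (n * r ^ n * e) * r ^ m"
    unfolding norm_mult by (intro mult_mono nn) (use P S in auto)
  moreover have "norm (p * (t - s)) \<le> r ^ n * (m * r ^ m * e)"
    unfolding norm_mult by (intro mult_mono nn) (use P S in auto)
  moreover have "q * t - p * s = (q - p) * t + p * (t - s)" by (simp add: algebra_simps)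
  ultimately have 4: "norm (q * t - p * s) \<le> (n + m) * r ^ (n + m) * e"
    using norm_triangle_ineq[of "(q - p) * t" "p * (t - s)"] by (simp add: algebra_simps power_add)
  have a: "norm ((q - p - d) * t) \<le> ((real n)\<^sup>2 * r ^ n * e\<^sup>2) * r ^ m"
    unfolding norm_mult by (intro mult_mono nn) (use P S in auto)
  have b: "norm (d * (t - s)) \<le> (n * r ^ n * e) * (m * r ^ m * e)"
    unfolding norm_mult by (intro mult_mono nn) (use P S in auto)
  have c: "norm (p * (t - s - f)) \<le> r ^ n * ((real m)\<^sup>2 * r ^ m * e\<^sup>2)"
    unfolding norm_mult by (intro mult_mono nn) (use P S in auto)
  have "q * t - p * s - (d * s + p * f) = (q - p - d) * t + d * (t - s) + p * (t - s - f)"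
    by (simp add: algebra_simps)
  then have "norm (q * t - p * s - (d * s + p * f)) \<le>
      ((real n)\<^sup>2 * r ^ n * e\<^sup>2) * r ^ m + (n * r ^ n * e) * (m * r ^ m * e) + r ^ n * ((real m)\<^sup>2 * r ^ m * e\<^sup>2)"
    using a b c by (metis (no_types, lifting) add_mono norm_triangle_le)
  also have "\<dots> = ((real n)\<^sup>2 + n * m + (real m)\<^sup>2) * (r ^ (n + m) * e\<^sup>2)"
    by (simp add: algebra_simps power_add power2_eq_square)
  also have "\<dots> \<le> (real (n + m))\<^sup>2 * (r ^ (n + m) * e\<^sup>2)"
    by (intro mult_right_mono) (use \<open>0 \<le> r\<close> in \<open>auto simp: power2_eq_square distrib_left distrib_right\<close>)
  finally have 5: "norm (q * t - p * s - (d * s + p * f)) \<le> (real (n + m))\<^sup>2 * r ^ (n + m) * e\<^sup>2"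
    by (simp add: mult_ac)
  show ?thesis
    unfolding approx2_def using 1 2 3 4 5 by simp
qed

lemma approx2_power:
  assumes "norm a \<le> r" "norm (a + h) \<le> r" "norm h \<le> r * e" "0 \<le> r" "0 \<le> e"
  shows "approx2 r e n (a ^ n) ((a + h) ^ n) (of_nat n * a ^ (n - 1) * h)"
proof (induction n)
  case 0
  show ?case by (simp add: approx2_def)
next
  case (Suc n)
  have "approx2 r e 1 a (a + h) h"
    using assms by (simp add: approx2_def)
  from approx2_mult[OF Suc this assms(4,5)]
  have "approx2 r e (Suc n) (a ^ n * a) ((a + h) ^ n * (a + h)) (of_nat n * a ^ (n - 1) * h * a + a ^ n * h)"
    by simp
  moreover have "of_nat n * a ^ (n - 1) * h * a + a ^ n * h = of_nat (Suc n) * a ^ (Suc n - 1) * h"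
    by (cases n) (auto simp: algebra_simps)
  ultimately show ?case by (simp add: mult.commute)
qed

text \<open>For termwise differentiation: the remainder is quadratic in \<open>h\<close>, and its
  constant is summable over all exponents when the coefficients decay geometrically.\<close>

lemma norm_monomial_remainder_le:
  fixes x h :: "complex^3"
  assumes x: "\<And>m. norm (x $ m) \<le> r" and xh: "\<And>m. norm ((x + h) $ m) \<le> r" and "0 < r"
  shows "norm (c * ((x + h) $ 1 ^ i * (x + h) $ 2 ^ j * (x + h) $ 3 ^ k) - c * (x $ 1 ^ i * x $ 2 ^ j * x $ 3 ^ k) -
      (c * (of_nat i * x $ 1 ^ (i - 1) * x $ 2 ^ j * x $ 3 ^ k) * h $ 1 +
       c * (x $ 1 ^ i * (of_nat j * x $ 2 ^ (j - 1)) * x $ 3 ^ k) * h $ 2 +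
       c * (x $ 1 ^ i * x $ 2 ^ j * (of_nat k * x $ 3 ^ (k - 1))) * h $ 3)) \<le>
    norm c * ((real (i + j + k))\<^sup>2 * r ^ (i + j + k)) * (norm h / r)\<^sup>2"
proof -
  define e where "e = norm h / r"
  have e: "0 \<le> e" "\<And>m. norm (h $ m) \<le> r * e"
    using \<open>0 < r\<close> Finite_Cartesian_Product.norm_nth_le[of h] by (auto simp: e_def)
  have ap: "approx2 r e n (x $ m ^ n) ((x + h) $ m ^ n) (of_nat n * x $ m ^ (n - 1) * h $ m)" for m n
    using approx2_power[OF x[of m] xh[of m, unfolded vector_add_component] e(2)] \<open>0 < r\<close> e(1) by simp
  note a2 = approx2_mult[OF approx2_mult[OF ap[where m = 1 and n = i] ap[where m = 2 and n = j]]
      ap[where m = 3 and n = k]]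
  define p where "p = x $ 1 ^ i * x $ 2 ^ j * x $ 3 ^ k"
  define q where "q = (x + h) $ 1 ^ i * (x + h) $ 2 ^ j * (x + h) $ 3 ^ k"
  define d where "d = (of_nat i * x $ 1 ^ (i - 1) * h $ 1 * x $ 2 ^ j + x $ 1 ^ i * (of_nat j * x $ 2 ^ (j - 1) * h $ 2)) * x $ 3 ^ k
            + x $ 1 ^ i * x $ 2 ^ j * (of_nat k * x $ 3 ^ (k - 1) * h $ 3)"
  have "approx2 r e (i + j + k) p q d"
    unfolding p_def q_def d_def using a2 e \<open>0 < r\<close> by simp
  then have "norm (q - p - d) \<le> (real (i + j + k))\<^sup>2 * r ^ (i + j + k) * e\<^sup>2"
    unfolding approx2_def by blast
  then have "norm c * norm (q - p - d) \<le> norm c * ((real (i + j + k))\<^sup>2 * r ^ (i + j + k) * e\<^sup>2)"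
    by (rule mult_left_mono) simp
  moreover have "c * q - c * p - (c * (of_nat i * x $ 1 ^ (i - 1) * x $ 2 ^ j * x $ 3 ^ k) * h $ 1 +
       c * (x $ 1 ^ i * (of_nat j * x $ 2 ^ (j - 1)) * x $ 3 ^ k) * h $ 2 +
       c * (x $ 1 ^ i * x $ 2 ^ j * (of_nat k * x $ 3 ^ (k - 1))) * h $ 3) = c * (q - p - d)"
    unfolding d_def by (simp add: distrib_left distrib_right right_diff_distrib mult_ac)
  ultimately show ?thesis
    unfolding p_def[symmetric] q_def[symmetric] e_def[symmetric] by (simp only: norm_mult mult.assoc)
qed

section \<open>Power series on polydiscs and their termwise differentiation\<close>

definition polydisc :: "real \<Rightarrow> (complex^3) set" where
  "polydisc R = {x. \<forall>m. norm (x $ m) < R}"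

lemma open_polydisc: "open (polydisc R)"
proof -
  have "open {x :: complex^3. \<forall>m. x $ m \<in> ball 0 R}"
    by (rule open_vector_box) auto
  then show ?thesis by (simp add: polydisc_def)
qed

lemma polydisc_mono: "R \<le> S \<Longrightarrow> polydisc R \<subseteq> polydisc S"
  by (auto simp: polydisc_def intro: less_le_trans)

lemma zero_in_polydisc: "0 < R \<Longrightarrow> 0 \<in> polydisc R"
  by (simp add: polydisc_def)

definition tseries :: "(nat \<times> nat \<times> nat \<Rightarrow> complex) \<Rightarrow> complex^3 \<Rightarrow> complex" where
  "tseries c x = (\<Sum>\<^sub>\<infinity>(i, j, k). c (i, j, k) * (x $ 1 ^ i * x $ 2 ^ j * x $ 3 ^ k))"

text \<open>The shape of Cauchy's inequalities for a function bounded by \<open>M\<close>, kept as a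
  condition on the coefficients alone; it yields convergence on \<open>polydisc R\<close>.\<close>

definition geo_bounded :: "real \<Rightarrow> real \<Rightarrow> (nat \<times> nat \<times> nat \<Rightarrow> complex) \<Rightarrow> bool" where
  "geo_bounded M R c \<longleftrightarrow> (\<forall>i j k. norm (c (i, j, k)) \<le> M / R ^ (i + j + k))"

definition dcoef1 :: "(nat \<times> nat \<times> nat \<Rightarrow> complex) \<Rightarrow> nat \<times> nat \<times> nat \<Rightarrow> complex" where
  "dcoef1 c = (\<lambda>(i, j, k). of_nat (Suc i) * c (Suc i, j, k))"
definition dcoef2 :: "(nat \<times> nat \<times> nat \<Rightarrow> complex) \<Rightarrow> nat \<times> nat \<times> nat \<Rightarrow> complex" where
  "dcoef2 c = (\<lambda>(i, j, k). of_nat (Suc j) * c (i, Suc j, k))"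
definition dcoef3 :: "(nat \<times> nat \<times> nat \<Rightarrow> complex) \<Rightarrow> nat \<times> nat \<times> nat \<Rightarrow> complex" where
  "dcoef3 c = (\<lambda>(i, j, k). of_nat (Suc k) * c (i, j, Suc k))"

lemma geo_bounded_nonneg:
  assumes "geo_bounded M R c"
  shows "0 \<le> M"
proof -
  have "norm (c (0, 0, 0)) \<le> M / R ^ (0 + 0 + 0)" using assms unfolding geo_bounded_def by blast
  then have "norm (c (0, 0, 0)) \<le> M" by simp
  then show ?thesis by (rule order.trans[OF norm_ge_zero])
qed

text \<open>Write \<open>q = s * s\<close>: one factor \<open>s ^ n\<close> absorbs the polynomial,
  the other remains as a convergent geometric majorant.\<close>

lemma summable_sq_geometric:
  assumes "0 \<le> q" "q < 1"
  shows "summable (\<lambda>n. (real n + 1)\<^sup>2 * q ^ n)"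
proof (cases "q = 0")
  case True
  then show ?thesis by (intro summable_finite[of "{0}"]) (auto simp: power_0_left)
next
  case False
  define s where "s = sqrt q"
  have s: "0 < s" "s < 1" "q = s * s" using assms False by (auto simp: s_def)
  have "(\<lambda>n. (real n + 1)\<^sup>2 * s ^ n) \<longlonglongrightarrow> 0" using s(1,2) by real_asymp
  then have "\<forall>\<^sub>F n in sequentially. (real n + 1)\<^sup>2 * s ^ n < 1"
    by (rule order_tendstoD) simp
  then have "\<forall>\<^sub>F n in sequentially. norm ((real n + 1)\<^sup>2 * q ^ n) \<le> s ^ n"
  proof eventually_elim
    case (elim n)
    have "(real n + 1)\<^sup>2 * s ^ n * s ^ n \<le> 1 * s ^ n"
      by (rule mult_right_mono) (use elim s in auto)
    then show ?case using s by (simp add: power_mult_distrib mult.assoc)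
  qed
  then show ?thesis
    by (rule summable_comparison_test_ev) (use s in \<open>auto intro: summable_geometric\<close>)
qed

lemma summable_weighted:
  fixes R :: real
  assumes c: "geo_bounded M R c" and "0 \<le> r" "r < R"
  shows "(\<lambda>(i, j, k). norm (c (i, j, k)) * ((real (i + j + k))\<^sup>2 * r ^ (i + j + k))) summable_on UNIV"
    and "(\<lambda>(i, j, k). norm (c (i, j, k)) * r ^ (i + j + k)) summable_on UNIV"
proof -
  let ?u = "\<lambda>i :: nat. (real i + 1)\<^sup>2 * (r / R) ^ i"
  have M: "0 \<le> M"
    using c by (rule geo_bounded_nonneg)
  have le1: "norm (c (i, j, k)) * r ^ (i + j + k) \<le> M * ((r / R) ^ i * (r / R) ^ j * (r / R) ^ k)" for i j k
  proof -
    have "norm (c (i, j, k)) * r ^ (i + j + k) \<le> M / R ^ (i + j + k) * r ^ (i + j + k)"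
      using c assms by (intro mult_right_mono) (auto simp: geo_bounded_def)
    then show ?thesis by (simp add: power_add power_divide mult_ac)
  qed
  \<comment> \<open>Splits the degree weight into one-variable factors, the form that
    \<open>summable_on_triple\<close> accepts.\<close>
  have le2: "real (i + j + k) \<le> (real i + 1) * (real j + 1) * (real k + 1)" for i j k
    by (simp add: algebra_simps)
  have le3: "norm (c (i, j, k)) * ((real (i + j + k))\<^sup>2 * r ^ (i + j + k)) \<le> M * ?u i * ?u j * ?u k" for i j k
  proof -
    have "(norm (c (i, j, k)) * r ^ (i + j + k)) * (real (i + j + k))\<^sup>2 \<le>
       M * ((r / R) ^ i * (r / R) ^ j * (r / R) ^ k) * ((real i + 1) * (real j + 1) * (real k + 1))\<^sup>2"
      by (intro mult_mono le1 power_mono le2) (use M assms in auto)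
    then show ?thesis by (simp add: power_mult_distrib mult_ac)
  qed
  have s: "summable ?u" using summable_sq_geometric[of "r / R"] assms by simp
  have "(\<lambda>\<beta>. norm (case \<beta> of (i, j, k) \<Rightarrow> norm (c (i, j, k)) * ((real (i + j + k))\<^sup>2 * r ^ (i + j + k)))) summable_on UNIV"
  proof (rule summable_on_triple)
    show "norm (case (i, j, k) of (i, j, k) \<Rightarrow> norm (c (i, j, k)) * ((real (i + j + k))\<^sup>2 * r ^ (i + j + k)))
      \<le> M * ?u i * ?u j * ?u k" for i j k
      using le3[of i j k] \<open>0 \<le> r\<close> by simp
  qed (use s M assms in \<open>auto intro: summable_mult\<close>)
  then show "(\<lambda>(i, j, k). norm (c (i, j, k)) * ((real (i + j + k))\<^sup>2 * r ^ (i + j + k))) summable_on UNIV"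
    by (rule abs_summable_summable)
  have "(\<lambda>\<beta>. norm (case \<beta> of (i, j, k) \<Rightarrow> norm (c (i, j, k)) * r ^ (i + j + k))) summable_on UNIV"
  proof (rule summable_on_triple)
    show "norm (case (i, j, k) of (i, j, k) \<Rightarrow> norm (c (i, j, k)) * r ^ (i + j + k))
      \<le> M * (r / R) ^ i * (r / R) ^ j * (r / R) ^ k" for i j k
      using le1[of i j k] \<open>0 \<le> r\<close> by (simp add: mult_ac)
  qed (use M assms in \<open>auto intro: summable_mult\<close>)
  then show "(\<lambda>(i, j, k). norm (c (i, j, k)) * r ^ (i + j + k)) summable_on UNIV"
    by (rule abs_summable_summable)
qed

lemma polydisc_radius:
  assumes "x \<in> polydisc R"
  obtains r where "0 < r" "r < R" "x \<in> polydisc r"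
proof -
  have R: "norm (x $ m) < R" for m using assms by (simp add: polydisc_def)
  define s where "s = Max (range (\<lambda>m. norm (x $ m)))"
  have s: "norm (x $ m) \<le> s" for m unfolding s_def by (rule Max_ge) auto
  have "s < R" unfolding s_def using R by (subst Max_less_iff) auto
  have "0 \<le> s" by (rule order.trans[OF norm_ge_zero s[of 1]])
  show thesis
  proof (rule that[of "(s + R) / 2"])
    show "x \<in> polydisc ((s + R) / 2)"
      unfolding polydisc_def
    proof (intro CollectI allI)
      show "norm (x $ m) < (s + R) / 2" for m using s[of m] \<open>s < R\<close> by simp
    qed
  qed (use \<open>0 \<le> s\<close> \<open>s < R\<close> in auto)
qed

lemma norm_monomial_le:
  fixes a b d :: complex
  assumes "norm a \<le> r" "norm b \<le> r" "norm d \<le> r"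
  shows "norm (a ^ i * b ^ j * d ^ k) \<le> r ^ (i + j + k)"
proof -
  have "0 \<le> r" by (rule order.trans[OF norm_ge_zero assms(1)])
  then show ?thesis
    unfolding norm_mult norm_power power_add by (intro mult_mono power_mono assms) auto
qed

lemma tseries_has_sum:
  assumes c: "geo_bounded M R c" and x: "x \<in> polydisc R"
  shows "((\<lambda>(i, j, k). c (i, j, k) * (x $ 1 ^ i * x $ 2 ^ j * x $ 3 ^ k)) has_sum tseries c x) UNIV"
proof -
  obtain r where r: "0 < r" "r < R" "x \<in> polydisc r" using polydisc_radius[OF x] .
  have "(\<lambda>\<beta>. norm (case \<beta> of (i, j, k) \<Rightarrow> c (i, j, k) * (x $ 1 ^ i * x $ 2 ^ j * x $ 3 ^ k))) summable_on UNIV"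
  proof (rule summable_on_comparison_test[OF summable_weighted(2)[OF c _ r(2)]])
    show "norm (case \<beta> of (i, j, k) \<Rightarrow> c (i, j, k) * (x $ 1 ^ i * x $ 2 ^ j * x $ 3 ^ k))
       \<le> (case \<beta> of (i, j, k) \<Rightarrow> norm (c (i, j, k)) * r ^ (i + j + k))" for \<beta>
    proof -
      obtain i j k where b: "\<beta> = (i, j, k)" by (cases \<beta>)
      have "norm (x $ m) \<le> r" for m using r(3) by (simp add: polydisc_def less_imp_le)
      then have "norm (x $ 1 ^ i * x $ 2 ^ j * x $ 3 ^ k) \<le> r ^ (i + j + k)"
        by (intro norm_monomial_le)
      then show ?thesis
        unfolding b prod.case norm_mult[of "c (i, j, k)"] by (rule mult_left_mono) simp
    qed
  qed (use r in auto)
  then show ?thesis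
    unfolding tseries_def by (rule has_sum_infsum[OF abs_summable_summable])
qed

text \<open>Differentiation produces a factor \<open>Suc n \<le> 2 ^ N\<close>, where
  \<open>N\<close> is the degree that remains; halving the radius absorbs it. This is why statements
  about derivatives hold on \<open>polydisc (R / 2)\<close>.\<close>

lemma geo_bounded_dcoef:
  assumes c: "geo_bounded M R c" and "R > 0"
  shows "geo_bounded (M / R) (R / 2) (dcoef1 c)" "geo_bounded (M / R) (R / 2) (dcoef2 c)"
    "geo_bounded (M / R) (R / 2) (dcoef3 c)"
proof -
  have M: "0 \<le> M"
    using c by (rule geo_bounded_nonneg)
  have *: "real (Suc n) * norm (c (i, j, k)) \<le> M / R / (R / 2) ^ N"
    if "i + j + k = Suc N" "n \<le> N" for i j k n N
  proof -
    have "real (Suc n) \<le> real (2 ^ N)"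
      using less_exp[of n] power_increasing[OF that(2), of "2::nat"] unfolding of_nat_le_iff by linarith
    moreover have "norm (c (i, j, k)) \<le> M / R ^ Suc N" using c that unfolding geo_bounded_def by metis
    ultimately have "real (Suc n) * norm (c (i, j, k)) \<le> real (2 ^ N) * (M / R ^ Suc N)"
      using M \<open>R > 0\<close> by (intro mult_mono) auto
    then show ?thesis using \<open>R > 0\<close> by (simp add: power_divide mult_ac)
  qed
  show "geo_bounded (M / R) (R / 2) (dcoef1 c)" "geo_bounded (M / R) (R / 2) (dcoef2 c)"
    "geo_bounded (M / R) (R / 2) (dcoef3 c)"
    unfolding geo_bounded_def dcoef1_def dcoef2_def dcoef3_def
    by (auto simp only: prod.case norm_mult norm_of_nat intro!: *)
qed

text \<open>The derivative series indexed by the exponents of the original one, so that both can be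
  combined term by term. The exponents outside the range of the shift carry the factor
  \<open>of_nat 0\<close>, so the truncated subtraction in \<open>i - 1\<close> does no
  harm.\<close>

lemma dcoef_has_sum:
  assumes c: "geo_bounded M R c" and "R > 0" and x: "x \<in> polydisc (R / 2)"
  shows "((\<lambda>(i, j, k). c (i, j, k) * (of_nat i * x $ 1 ^ (i - 1) * x $ 2 ^ j * x $ 3 ^ k))
            has_sum tseries (dcoef1 c) x) UNIV"
    and "((\<lambda>(i, j, k). c (i, j, k) * (x $ 1 ^ i * (of_nat j * x $ 2 ^ (j - 1)) * x $ 3 ^ k))
            has_sum tseries (dcoef2 c) x) UNIV"
    and "((\<lambda>(i, j, k). c (i, j, k) * (x $ 1 ^ i * x $ 2 ^ j * (of_nat k * x $ 3 ^ (k - 1))))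
            has_sum tseries (dcoef3 c) x) UNIV"
proof -
  note d = geo_bounded_dcoef[OF c \<open>R > 0\<close>]
  have reindex: "(f has_sum s) UNIV" if g: "(g has_sum s) UNIV" and h: "inj h"
    and fh: "\<And>\<beta>. f (h \<beta>) = g \<beta>" and 0: "\<And>\<beta>. \<beta> \<notin> range h \<Longrightarrow> f \<beta> = 0"
    for f g :: "nat \<times> nat \<times> nat \<Rightarrow> complex" and s and h :: "nat \<times> nat \<times> nat \<Rightarrow> nat \<times> nat \<times> nat"
  proof -
    have "(f has_sum s) (range h)" using g fh unfolding has_sum_reindex[OF h] comp_def by simp
    then show ?thesis using has_sum_cong_neutral[of UNIV "range h" f f s] 0 by auto
  qed
  show "((\<lambda>(i, j, k). c (i, j, k) * (of_nat i * x $ 1 ^ (i - 1) * x $ 2 ^ j * x $ 3 ^ k))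
            has_sum tseries (dcoef1 c) x) UNIV"
  proof (rule reindex[OF tseries_has_sum[OF d(1) x], of "\<lambda>(i, j, k). (Suc i, j, k)"])
    show "(case \<beta> of (i, j, k) \<Rightarrow> c (i, j, k) * (of_nat i * x $ 1 ^ (i - 1) * x $ 2 ^ j * x $ 3 ^ k)) = 0"
      if "\<beta> \<notin> range (\<lambda>(i, j, k). (Suc i, j, k))" for \<beta>
    proof -
      obtain i j k where b: "\<beta> = (i, j, k)" by (cases \<beta>)
      have "i = 0" using that unfolding b by (cases i) (force simp: image_iff)+
      then show ?thesis by (simp add: b)
    qed
  qed (auto simp: inj_def dcoef1_def mult_ac)
  show "((\<lambda>(i, j, k). c (i, j, k) * (x $ 1 ^ i * (of_nat j * x $ 2 ^ (j - 1)) * x $ 3 ^ k))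
            has_sum tseries (dcoef2 c) x) UNIV"
  proof (rule reindex[OF tseries_has_sum[OF d(2) x], of "\<lambda>(i, j, k). (i, Suc j, k)"])
    show "(case \<beta> of (i, j, k) \<Rightarrow> c (i, j, k) * (x $ 1 ^ i * (of_nat j * x $ 2 ^ (j - 1)) * x $ 3 ^ k)) = 0"
      if "\<beta> \<notin> range (\<lambda>(i, j, k). (i, Suc j, k))" for \<beta>
    proof -
      obtain i j k where b: "\<beta> = (i, j, k)" by (cases \<beta>)
      have "j = 0" using that unfolding b by (cases j) (force simp: image_iff)+
      then show ?thesis by (simp add: b)
    qed
  qed (auto simp: inj_def dcoef2_def mult_ac)
  show "((\<lambda>(i, j, k). c (i, j, k) * (x $ 1 ^ i * x $ 2 ^ j * (of_nat k * x $ 3 ^ (k - 1))))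
            has_sum tseries (dcoef3 c) x) UNIV"
  proof (rule reindex[OF tseries_has_sum[OF d(3) x], of "\<lambda>(i, j, k). (i, j, Suc k)"])
    show "(case \<beta> of (i, j, k) \<Rightarrow> c (i, j, k) * (x $ 1 ^ i * x $ 2 ^ j * (of_nat k * x $ 3 ^ (k - 1)))) = 0"
      if "\<beta> \<notin> range (\<lambda>(i, j, k). (i, j, Suc k))" for \<beta>
    proof -
      obtain i j k where b: "\<beta> = (i, j, k)" by (cases \<beta>)
      have "k = 0" using that unfolding b by (cases k) (force simp: image_iff)+
      then show ?thesis by (simp add: b)
    qed
  qed (auto simp: inj_def dcoef3_def mult_ac)
qed

lemma has_sum_diff:
  fixes f g :: "'a \<Rightarrow> 'b::topological_ab_group_add"
  assumes "(f has_sum a) A" "(g has_sum b) A"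
  shows "((\<lambda>x. f x - g x) has_sum a - b) A"
  using has_sum_add[OF assms(1), of "\<lambda>x. - g x" "- b"] assms(2) by (simp add: has_sum_uminus)

lemma bounded_linear_coords: "bounded_linear (\<lambda>h::complex^3. a * h $ 1 + b * h $ 2 + d * h $ 3)"
  by (intro bounded_linear_add bounded_linear_const_mult bounded_linear_vec_nth)

text \<open>Summing the monomial remainders gives a total error of at most
  \<open>K * (norm h / r)^2\<close>. The intermediate radius \<open>r\<close> keeps both
  \<open>x\<close> and \<open>x + h\<close> in one polydisc on which the weighted series defining
  \<open>K\<close> converges.\<close>

lemma has_derivative_tseries:
  assumes c: "geo_bounded M R c" and "R > 0" and x: "x \<in> polydisc (R / 2)"
  shows "(tseries c has_derivative
     (\<lambda>h. tseries (dcoef1 c) x * h $ 1 + tseries (dcoef2 c) x * h $ 2 + tseries (dcoef3 c) x * h $ 3)) (at x)"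
    (is "(_ has_derivative ?D) _")
proof -
  obtain r where r: "0 < r" "r < R / 2" "x \<in> polydisc r" using polydisc_radius[OF x] .
  obtain e where e: "0 < e" "ball x e \<subseteq> polydisc r"
    using open_polydisc[of r] r(3) open_contains_ball by blast
  have rR: "r < R" using r \<open>R > 0\<close> by simp
  define K where "K = (\<Sum>\<^sub>\<infinity>(i, j, k). norm (c (i, j, k)) * ((real (i + j + k))\<^sup>2 * r ^ (i + j + k)))"
  have est: "norm (tseries c y - tseries c x - ?D (y - x)) \<le> K * (norm (y - x) / r)\<^sup>2"
    if "dist y x < e" for y
  proof -
    define h where "h = y - x"
    have y: "y = x + h" by (simp add: h_def)
    have yr: "y \<in> polydisc r" using e that by (auto simp: dist_commute)
    have yR: "y \<in> polydisc R" and xR: "x \<in> polydisc R"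
      using polydisc_mono[of r R] rR yr r by auto
    let ?m = "\<lambda>x (i, j, k). c (i, j, k) * (x $ 1 ^ i * x $ 2 ^ j * x $ 3 ^ k)"
    let ?d1 = "\<lambda>(i, j, k). c (i, j, k) * (of_nat i * x $ 1 ^ (i - 1) * x $ 2 ^ j * x $ 3 ^ k)"
    let ?d2 = "\<lambda>(i, j, k). c (i, j, k) * (x $ 1 ^ i * (of_nat j * x $ 2 ^ (j - 1)) * x $ 3 ^ k)"
    let ?d3 = "\<lambda>(i, j, k). c (i, j, k) * (x $ 1 ^ i * x $ 2 ^ j * (of_nat k * x $ 3 ^ (k - 1)))"
    have D: "((\<lambda>\<beta>. ?d1 \<beta> * h $ 1 + ?d2 \<beta> * h $ 2 + ?d3 \<beta> * h $ 3) has_sum ?D h) UNIV"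
      by (rule has_sum_add[OF has_sum_add[OF has_sum_cmult_left[OF dcoef_has_sum(1)[OF c \<open>R > 0\<close> x]]
              has_sum_cmult_left[OF dcoef_has_sum(2)[OF c \<open>R > 0\<close> x]]]
            has_sum_cmult_left[OF dcoef_has_sum(3)[OF c \<open>R > 0\<close> x]]])
    have sum: "((\<lambda>\<beta>. ?m y \<beta> - ?m x \<beta> - (?d1 \<beta> * h $ 1 + ?d2 \<beta> * h $ 2 + ?d3 \<beta> * h $ 3)) has_sum
        (tseries c y - tseries c x - ?D h)) UNIV"
      by (rule has_sum_diff[OF has_sum_diff[OF tseries_has_sum[OF c yR] tseries_has_sum[OF c xR]] D])
    have Ks: "((\<lambda>\<beta>. (case \<beta> of (i, j, k) \<Rightarrow> norm (c (i, j, k)) * ((real (i + j + k))\<^sup>2 * r ^ (i + j + k)))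
         * (norm h / r)\<^sup>2) has_sum K * (norm h / r)\<^sup>2) UNIV"
      unfolding K_def
      by (rule has_sum_cmult_left[OF has_sum_infsum[OF summable_weighted(1)[OF c less_imp_le[OF r(1)] rR]]])
    have le: "norm (?m y \<beta> - ?m x \<beta> - (?d1 \<beta> * h $ 1 + ?d2 \<beta> * h $ 2 + ?d3 \<beta> * h $ 3)) \<le>
       (case \<beta> of (i, j, k) \<Rightarrow> norm (c (i, j, k)) * ((real (i + j + k))\<^sup>2 * r ^ (i + j + k))) * (norm h / r)\<^sup>2" for \<beta>
    proof -
      obtain i j k where b: "\<beta> = (i, j, k)" by (cases \<beta>)
      have "norm (x $ m) \<le> r" "norm ((x + h) $ m) \<le> r" for m
        using r(3) yr unfolding y[symmetric] polydisc_def by (auto simp: less_imp_le)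
      from norm_monomial_remainder_le[OF this r(1), where c = "c (i, j, k)" and i = i and j = j and k = k]
      show ?thesis
        unfolding b prod.case y[symmetric] .
    qed
    have "norm (tseries c y - tseries c x - ?D h) \<le> K * (norm h / r)\<^sup>2"
      by (rule norm_infsum_le[OF sum Ks le])
    then show ?thesis by (simp add: h_def)
  qed
  show ?thesis
  proof (rule has_derivativeI_sandwich[OF e(1) bounded_linear_coords])
    show "norm (tseries c y - tseries c x - ?D (y - x)) / norm (y - x) \<le> K / r\<^sup>2 * norm (y - x)"
      if "y \<noteq> x" "dist y x < e" for y
    proof -
      have "norm (tseries c y - tseries c x - ?D (y - x)) / norm (y - x) \<le> K * (norm (y - x) / r)\<^sup>2 / norm (y - x)"
        using est[OF that(2)] by (rule divide_right_mono) simp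
      then show ?thesis using that(1) by (simp add: power2_eq_square)
    qed
    have "((\<lambda>y. K / r\<^sup>2 * norm (y - x)) \<longlongrightarrow> K / r\<^sup>2 * norm (x - x)) (at x)"
      by (intro tendsto_intros)
    then show "((\<lambda>y. K / r\<^sup>2 * norm (y - x)) \<longlongrightarrow> 0) (at x)" by simp
  qed
qed

lemma mv_holomorphic_on3I:
  fixes f :: "complex^3 \<Rightarrow> complex"
  assumes "open U"
    and "\<And>z. z \<in> U \<Longrightarrow> (f has_derivative (\<lambda>h. a z * h $ 1 + b z * h $ 2 + d z * h $ 3)) (at z)"
  shows "mv_holomorphic_on f U"
  unfolding mv_holomorphic_on_def
proof (intro conjI ballI)
  show "open U" by fact
  fix z assume "z \<in> U"
  have "(f has_derivative (\<lambda>h. \<Sum>i\<in>UNIV. vector [a z, b z, d z] $ i * h $ i)) (at z)"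
    using assms(2)[OF \<open>z \<in> U\<close>] by (simp add: sum_3)
  then show "\<exists>a::complex^3. (f has_derivative (\<lambda>h. \<Sum>i\<in>UNIV. a $ i * h $ i)) (at z)" ..
qed

lemma mv_holomorphic_on_tseries:
  assumes "geo_bounded M R c" "R > 0"
  shows "mv_holomorphic_on (tseries c) (polydisc (R / 2))"
  by (rule mv_holomorphic_on3I[OF open_polydisc has_derivative_tseries[OF assms]])

section \<open>Divisors in the Poincare domain\<close>

text \<open>Divided by \<open>i + j\<close>, the combination becomes a point of the convex hull,
  which is compact and hence at a positive distance from \<open>0\<close>.\<close>

lemma in_poincare_domain_lower_bound:
  assumes "in_poincare_domain l1 l2"
  obtains d where "d > 0" "\<And>i j :: nat. d * real (i + j) \<le> norm (of_nat i * l1 + of_nat j * l2)"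
proof -
  have "closed (convex hull {l1, l2})"
    by (intro compact_imp_closed finite_imp_compact_convex_hull) auto
  then obtain d where d: "d > 0" "\<And>z. z \<in> convex hull {l1, l2} \<Longrightarrow> d \<le> dist 0 z"
    using separate_point_closed[of "convex hull {l1, l2}" 0] assms
    unfolding in_poincare_domain_def by blast
  have "d * real (i + j) \<le> norm (of_nat i * l1 + of_nat j * l2)" for i j :: nat
  proof (cases "i + j = 0")
    case False
    define s where "s = real (i + j)"
    have s: "s > 0" using False unfolding s_def of_nat_0_less_iff by simp
    have "(real i / s) *\<^sub>R l1 + (real j / s) *\<^sub>R l2 \<in> convex hull {l1, l2}"
    proof -
      have "real i / s + real j / s = 1" using s by (simp add: s_def add_divide_distrib[symmetric])
      then show ?thesis unfolding convex_hull_2 using s by force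
    qed
    from d(2)[OF this] have "d \<le> norm ((real i / s) *\<^sub>R l1 + (real j / s) *\<^sub>R l2)" by simp
    also have "(real i / s) *\<^sub>R l1 + (real j / s) *\<^sub>R l2 = (1 / s) *\<^sub>R (of_nat i * l1 + of_nat j * l2)"
      by (simp add: scaleR_conv_of_real algebra_simps)
    also have "norm \<dots> = norm (of_nat i * l1 + of_nat j * l2) / s" using s by simp
    finally show ?thesis using s by (simp add: pos_le_divide_eq s_def)
  qed simp
  with d(1) show thesis by (rule that)
qed

text \<open>Small divisors do not occur in the Poincare domain: \<open>i * l1 + j * l2\<close> grows
  linearly with the degree, so all but finitely many divisors have norm at least 1, and the
  remaining ones are nonzero by hypothesis.\<close>

lemma small_divisor_bound:
  assumes "in_poincare_domain l1 l2"
    and ne: "\<And>i j :: nat. i + j \<ge> 2 \<Longrightarrow> l \<noteq> of_nat i * l1 + of_nat j * l2"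
  obtains e where "e > 0" "\<And>i j :: nat. i + j \<ge> 2 \<Longrightarrow> e \<le> norm (of_nat i * l1 + of_nat j * l2 - l)"
proof -
  obtain d where d: "d > 0" "\<And>i j :: nat. d * real (i + j) \<le> norm (of_nat i * l1 + of_nat j * l2)"
    using in_poincare_domain_lower_bound[OF assms(1)] by blast
  obtain N :: nat where N: "(1 + norm l) / d < real N" using reals_Archimedean2 by blast
  define T where "T = (\<lambda>(i, j). norm (of_nat i * l1 + of_nat j * l2 - l)) ` {(i, j). i + j \<ge> 2 \<and> i \<le> N \<and> j \<le> N}"
  have fin: "finite T"
    unfolding T_def by (rule finite_imageI, rule finite_subset[of _ "{..N} \<times> {..N}"]) auto
  \<comment> \<open>The element \<open>1\<close> accounts for the exponents outside the finite box,
    where the divisor is at least 1.\<close>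
  define e where "e = Min (insert 1 T)"
  have "e > 0"
    unfolding e_def using fin ne by (subst Min_gr_iff) (auto simp: T_def)
  moreover have "e \<le> norm (of_nat i * l1 + of_nat j * l2 - l)" if ij: "i + j \<ge> 2" for i j :: nat
  proof (cases "i \<le> N \<and> j \<le> N")
    case True
    then have "norm (of_nat i * l1 + of_nat j * l2 - l) \<in> T" using ij by (auto simp: T_def)
    then show ?thesis unfolding e_def using fin by (intro Min_le) auto
  next
    case False
    then have "N \<le> i + j" by auto
    then have "1 + norm l \<le> d * real (i + j)"
      using N d(1) by (simp add: divide_less_eq) (smt (verit) mult_left_mono mult.commute of_nat_add of_nat_mono)
    then have "1 \<le> norm (of_nat i * l1 + of_nat j * l2) - norm l" using d(2)[of i j] by linarith
    also have "\<dots> \<le> norm (of_nat i * l1 + of_nat j * l2 - l)" by (rule norm_triangle_ineq2)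
    finally have "1 \<le> norm (of_nat i * l1 + of_nat j * l2 - l)" .
    moreover have "e \<le> 1" unfolding e_def using fin by simp
    ultimately show ?thesis by linarith
  qed
  ultimately show thesis by (rule that)
qed

section \<open>Substitution into a power series\<close>

type_synonym bps = "complex ps ps"

definition coef2 :: "bps \<Rightarrow> nat \<Rightarrow> nat \<Rightarrow> complex" where
  "coef2 a i j = ps_nth (ps_nth a i) j"

definition emb :: "complex \<Rightarrow> bps" where "emb c = ps_const (ps_const c)"

text \<open>The outer series is evaluated first, at the constant series \<open>u\<close>; hence
  \<open>u\<close> goes with the first index of \<open>coef2\<close> and \<open>v\<close> with the
  second.\<close>

definition eval2 :: "complex \<Rightarrow> complex \<Rightarrow> bps \<Rightarrow> complex" where
  "eval2 u v a = ps_eval v (ps_eval (ps_const u) a)"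

lemma coef2_simps [simp]:
  "coef2 0 i j = 0" "coef2 (a + b) i j = coef2 a i j + coef2 b i j"
  "coef2 (a - b) i j = coef2 a i j - coef2 b i j" "coef2 (r *\<^sub>R a) i j = r *\<^sub>R coef2 a i j"
  by (simp_all add: coef2_def)

lemma bounded_linear_coef2: "bounded_linear (\<lambda>a. coef2 a i j)"
  unfolding coef2_def
  by (rule bounded_linear_compose[OF bounded_linear_ps_nth bounded_linear_ps_nth])

lemma norm_coef2_le: "norm (coef2 a i j) \<le> norm a"
  unfolding coef2_def by (rule order.trans[OF norm_ps_nth_le norm_ps_nth_le])

lemma norm_emb [simp]: "norm (emb c) = norm c" by (simp add: emb_def)

lemma coef2_emb_mult: "coef2 (emb c * a) i j = c * coef2 a i j"
  by (simp add: coef2_def emb_def ps_nth_mult if_distrib[of "\<lambda>x. x * _"] cong: if_cong)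

text \<open>The algebraic properties follow by composing two one-variable evaluations. The
  identification with a double series needs joint summability as well: the norm of \<open>a\<close>
  is the iterated sum of the norms of its coefficients, and monomials have norm at most 1 on the
  closed bidisc.\<close>

lemma
  assumes "norm u \<le> 1" "norm v \<le> 1"
  shows bounded_linear_eval2: "bounded_linear (eval2 u v)"
    and eval2_mult: "eval2 u v (a * b) = eval2 u v a * eval2 u v b"
    and norm_eval2_le: "norm (eval2 u v a) \<le> norm a"
    and eval2_emb: "eval2 u v (emb c) = c"
    and eval2_has_sum: "((\<lambda>(i, j). coef2 a i j * (u ^ i * v ^ j)) has_sum eval2 u v a) UNIV"
proof -
  have cu: "norm (ps_const u) \<le> 1" using assms by simp
  show "bounded_linear (eval2 u v)"
    unfolding eval2_def
    by (rule bounded_linear_compose[OF bounded_linear_ps_eval[OF assms(2)] bounded_linear_ps_eval[OF cu]])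
  show "eval2 u v (a * b) = eval2 u v a * eval2 u v b"
    unfolding eval2_def by (simp add: ps_eval_mult[OF cu] ps_eval_mult[OF assms(2)])
  show "norm (eval2 u v a) \<le> norm a"
    unfolding eval2_def by (rule order.trans[OF norm_ps_eval_le[OF assms(2)] norm_ps_eval_le[OF cu]])
  show "eval2 u v (emb c) = c" by (simp add: eval2_def emb_def)
  have const_pow: "ps_const u ^ n = ps_const (u ^ n)" for n
    by (induction n) (auto simp: ps_const_simps)
  have inner: "((\<lambda>j. coef2 a i j * (u ^ i * v ^ j)) has_sum (ps_eval v (ps_nth a i) * u ^ i)) UNIV" for i
  proof -
    have "((\<lambda>j. ps_nth (ps_nth a i) j * v ^ j) has_sum ps_eval v (ps_nth a i)) UNIV"
      unfolding ps_eval_def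
      by (rule norm_summable_imp_has_sum[OF _ summable_sums[OF summable_norm_cancel]]) (rule ps_eval_summable[OF assms(2)])+
    from has_sum_cmult_left[OF this, of "u ^ i"] show ?thesis
      by (simp add: coef2_def mult_ac)
  qed
  have outer: "((\<lambda>i. ps_eval v (ps_nth a i) * u ^ i) has_sum eval2 u v a) UNIV"
  proof -
    have "((\<lambda>i. ps_nth a i * ps_const u ^ i) has_sum ps_eval (ps_const u) a) UNIV"
      unfolding ps_eval_def
      by (rule norm_summable_imp_has_sum[OF _ summable_sums[OF summable_norm_cancel]]) (rule ps_eval_summable[OF cu])+
    from has_sum_bounded_linear[OF bounded_linear_ps_eval[OF assms(2)] this] show ?thesis
      by (simp add: eval2_def const_pow ps_eval_mult[OF assms(2)])
  qed
  have sumn: "(\<lambda>(i, j). norm (coef2 a i j)) summable_on UNIV \<times> UNIV"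
  proof (rule summable_on_SigmaI)
    show "((\<lambda>j. case (i, j) of (i, j) \<Rightarrow> norm (coef2 a i j)) has_sum norm (ps_nth a i)) UNIV" for i
      unfolding norm_ps_eq[of "ps_nth a i"] coef2_def prod.case
      by (intro sums_nonneg_imp_has_sum summable_sums summable_norm_ps_nth) auto
    show "(\<lambda>i. norm (ps_nth a i)) summable_on UNIV"
      by (rule summable_nonneg_imp_summable_on[OF summable_norm_ps_nth]) auto
  qed auto
  have "(\<lambda>(i, j). coef2 a i j * (u ^ i * v ^ j)) summable_on UNIV \<times> UNIV"
  proof (rule abs_summable_summable, rule summable_on_comparison_test[OF sumn])
    fix p :: "nat \<times> nat"
    obtain i j where p: "p = (i, j)" by (cases p)
    have "norm (u ^ i * v ^ j) \<le> 1"
      using assms by (simp add: norm_mult norm_power mult_le_one power_le_one)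
    then show "norm (case p of (i, j) \<Rightarrow> coef2 a i j * (u ^ i * v ^ j)) \<le> (case p of (i, j) \<Rightarrow> norm (coef2 a i j))"
      using mult_left_mono[of "norm (u ^ i * v ^ j)" 1 "norm (coef2 a i j)"] by (simp add: p norm_mult)
  qed auto
  then have "((\<lambda>(i, j). coef2 a i j * (u ^ i * v ^ j)) has_sum eval2 u v a) (UNIV \<times> UNIV)"
    by (intro has_sum_SigmaI[OF _ outer]) (use inner in auto)
  then show "((\<lambda>(i, j). coef2 a i j * (u ^ i * v ^ j)) has_sum eval2 u v a) UNIV" by simp
qed

text \<open>A diagonal operator on coefficients. Taken with reciprocals of the divisors, it inverts
  \<open>l1 * u1 * d/du1 + l2 * u2 * d/du2 - L\<close> on the series of order at least 2.\<close>

definition multiplier :: "(nat \<Rightarrow> nat \<Rightarrow> complex) \<Rightarrow> bps \<Rightarrow> bps" where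
  "multiplier m a = mk_ps (\<lambda>i. mk_ps (\<lambda>j. m i j * coef2 a i j))"

lemma
  assumes m: "\<And>i j. norm (m i j) \<le> B"
  shows coef2_multiplier: "coef2 (multiplier m a) i j = m i j * coef2 a i j"
    and norm_multiplier_le: "norm (multiplier m a) \<le> B * norm a"
proof -
  have le: "norm (m i j * coef2 a i j) \<le> B * norm (ps_nth (ps_nth a i) j)" for i j
    unfolding coef2_def norm_mult by (intro mult_right_mono m) auto
  have s1: "summable (\<lambda>j. norm (m i j * coef2 a i j))" for i
    by (rule summable_comparison_test[OF _ summable_mult[OF summable_norm_ps_nth]]) (use le in auto)
  let ?r = "\<lambda>i. mk_ps (\<lambda>j. m i j * coef2 a i j)"
  have n1: "norm (?r i) \<le> B * norm (ps_nth a i)" for i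
  proof -
    have "norm (?r i) = (\<Sum>j. norm (m i j * coef2 a i j))"
      by (simp add: norm_ps_eq ps_nth_mk_ps[OF s1])
    also have "\<dots> \<le> (\<Sum>j. B * norm (ps_nth (ps_nth a i) j))"
      by (rule suminf_le[OF le s1 summable_mult[OF summable_norm_ps_nth]])
    also have "\<dots> = B * norm (ps_nth a i)"
      by (simp add: norm_ps_eq suminf_mult[OF summable_norm_ps_nth])
    finally show ?thesis .
  qed
  have s2: "summable (\<lambda>i. norm (?r i))"
    by (rule summable_comparison_test[OF _ summable_mult[OF summable_norm_ps_nth]]) (use n1 in auto)
  show "coef2 (multiplier m a) i j = m i j * coef2 a i j"
    by (simp add: multiplier_def coef2_def[of "mk_ps _"] ps_nth_mk_ps[OF s2] ps_nth_mk_ps[OF s1])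
  have "norm (multiplier m a) = (\<Sum>i. norm (?r i))"
    using norm_ps_eq[of "multiplier m a"] by (simp add: multiplier_def ps_nth_mk_ps[OF s2])
  also have "\<dots> \<le> (\<Sum>i. B * norm (ps_nth a i))"
    by (rule suminf_le[OF n1 s2 summable_mult[OF summable_norm_ps_nth]])
  also have "\<dots> = B * norm a"
    by (simp add: norm_ps_eq[of a] suminf_mult[OF summable_norm_ps_nth])
  finally show "norm (multiplier m a) \<le> B * norm a" .
qed

lemma bps_eqI: "(\<And>i j. coef2 a i j = coef2 b i j) \<Longrightarrow> a = b"
  by (intro ps_eqI) (simp add: coef2_def)

definition lowest :: "nat \<Rightarrow> bps \<Rightarrow> bool" where
  "lowest n a \<longleftrightarrow> (\<forall>i j. i + j < n \<longrightarrow> coef2 a i j = 0)"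

lemma coef2_mult: "coef2 (a * b) i j = (\<Sum>p\<le>i. \<Sum>q\<le>j. coef2 a p q * coef2 b (i - p) (j - q))"
proof -
  have "ps_nth (sum f S) j = (\<Sum>p\<in>S. ps_nth (f p) j)" if "finite S" for f :: "nat \<Rightarrow> complex ps" and S
    using that by (induction S rule: finite_induct) auto
  then show ?thesis by (simp add: coef2_def ps_nth_mult)
qed

lemma lowest_mult: "lowest n a \<Longrightarrow> lowest m b \<Longrightarrow> lowest (n + m) (a * b)"
  unfolding lowest_def coef2_mult
proof (intro allI impI sum.neutral ballI)
  fix i j p q
  assume a: "\<forall>i j. i + j < n \<longrightarrow> coef2 a i j = 0" and b: "\<forall>i j. i + j < m \<longrightarrow> coef2 b i j = 0"
    and "i + j < n + m" "p \<in> {..i}" "q \<in> {..j}"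
  then have "p + q < n \<or> (i - p) + (j - q) < m" by auto
  with a b show "coef2 a p q * coef2 b (i - p) (j - q) = 0" by auto
qed

lemma lowest_0 [simp]: "lowest 0 a" by (simp add: lowest_def)

lemma lowest_power: "lowest 1 a \<Longrightarrow> lowest n (a ^ n)"
  by (induction n) (use lowest_mult[of 1 a] in auto)

definition mon3 :: "nat \<times> nat \<times> nat \<Rightarrow> bps ^ 3 \<Rightarrow> bps" where
  "mon3 = (\<lambda>(i, j, k) a. a $ 1 ^ i * a $ 2 ^ j * a $ 3 ^ k)"

definition deg3 :: "nat \<times> nat \<times> nat \<Rightarrow> nat" where "deg3 = (\<lambda>(i, j, k). i + j + k)"

definition subst3 :: "(nat \<times> nat \<times> nat \<Rightarrow> complex) \<Rightarrow> bps ^ 3 \<Rightarrow> bps" where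
  "subst3 c a = (\<Sum>\<^sub>\<infinity>\<beta>. emb (c \<beta>) * mon3 \<beta> a)"

text \<open>First-order analogue of \<open>approx2\<close>: \<open>p\<close> and \<open>q\<close>
  are the values of a monomial of degree \<open>n\<close> at two points with entries of norm at most
  \<open>s\<close>, and \<open>e\<close> stands for the distance of the entries divided by
  \<open>s\<close>.\<close>

definition close2 :: "real \<Rightarrow> real \<Rightarrow> nat \<Rightarrow> bps \<Rightarrow> bps \<Rightarrow> bool" where
  "close2 s e n p q \<longleftrightarrow> norm p \<le> s ^ n \<and> norm q \<le> s ^ n \<and> norm (p - q) \<le> n * s ^ n * e"

lemma norm_mult_mono:
  fixes a b :: "'a::real_normed_algebra"
  shows "norm a \<le> x \<Longrightarrow> norm b \<le> y \<Longrightarrow> norm (a * b) \<le> x * y"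
  by (rule order.trans[OF norm_mult_ineq mult_mono]) (auto intro: order.trans[OF norm_ge_zero])

lemma close2_mult:
  assumes "close2 s e n p q" "close2 s e m t w"
  shows "close2 s e (n + m) (p * t) (q * w)"
proof -
  note P = assms(1)[unfolded close2_def] and T = assms(2)[unfolded close2_def]
  have 1: "norm (p * t) \<le> s ^ (n + m)" "norm (q * w) \<le> s ^ (n + m)"
    unfolding power_add using P T by (blast intro: norm_mult_mono)+
  have "norm ((p - q) * t) \<le> (n * s ^ n * e) * s ^ m" "norm (q * (t - w)) \<le> s ^ n * (m * s ^ m * e)"
    using P T by (blast intro: norm_mult_mono)+
  moreover have "p * t - q * w = (p - q) * t + q * (t - w)" by (simp add: algebra_simps)
  ultimately have "norm (p * t - q * w) \<le> (n + m) * s ^ (n + m) * e"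
    using norm_triangle_ineq[of "(p - q) * t" "q * (t - w)"] by (simp add: algebra_simps power_add)
  with 1 show ?thesis by (simp add: close2_def)
qed

lemma close2_power:
  assumes "norm p \<le> s" "norm q \<le> s" "norm (p - q) \<le> s * e"
  shows "close2 s e n (p ^ n) (q ^ n)"
proof (induction n)
  case (Suc n)
  have "close2 s e 1 p q" using assms by (simp add: close2_def)
  from close2_mult[OF this Suc] show ?case by simp
qed (simp add: close2_def)

lemma close2_mon3:
  assumes "\<And>m. norm (a $ m) \<le> s" "\<And>m. norm (b $ m) \<le> s" "\<And>m. norm (a $ m - b $ m) \<le> s * e"
  shows "close2 s e (deg3 \<beta>) (mon3 \<beta> a) (mon3 \<beta> b)"
  unfolding mon3_def deg3_def
  by (auto split: prod.split intro!: close2_mult close2_power assms)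

lemma norm_mon3_le:
  assumes "\<And>m. norm (a $ m) \<le> s"
  shows "norm (mon3 \<beta> a) \<le> s ^ deg3 \<beta>"
  using close2_mon3[of a s a 0 \<beta>, OF assms assms] by (simp add: close2_def order_trans[OF norm_ge_zero assms])

lemma lowest_mon3:
  assumes "\<And>m. lowest 1 (a $ m)"
  shows "lowest (deg3 \<beta>) (mon3 \<beta> a)"
  unfolding mon3_def deg3_def
  by (auto split: prod.split intro!: lowest_mult lowest_power assms)

text \<open>The weight \<open>deg3\<close> in \<open>summ\<close> is what bounds the Lipschitz constant of the substitution map.\<close>

locale nonlinear_coeffs =
  fixes c :: "nat \<times> nat \<times> nat \<Rightarrow> complex"
  assumes low: "\<And>\<beta>. deg3 \<beta> < 2 \<Longrightarrow> c \<beta> = 0"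
    and summ: "(\<lambda>\<beta>. norm (c \<beta>) * real (deg3 \<beta>)) summable_on UNIV"
begin

definition K where "K = (\<Sum>\<^sub>\<infinity>\<beta>. norm (c \<beta>) * real (deg3 \<beta>))"

lemma K_nonneg: "0 \<le> K"
  unfolding K_def by (rule infsum_nonneg) auto

lemma pow_le: fixes s :: real shows "c \<beta> \<noteq> 0 \<Longrightarrow> 0 \<le> s \<Longrightarrow> s \<le> 1 \<Longrightarrow> s ^ deg3 \<beta> \<le> s\<^sup>2"
  using low[of \<beta>] by (intro power_decreasing) (auto simp: not_less[symmetric])

lemma term_le:
  assumes "\<And>m. norm (a $ m) \<le> s" "0 \<le> s" "s \<le> 1"
  shows "norm (emb (c \<beta>) * mon3 \<beta> a) \<le> norm (c \<beta>) * real (deg3 \<beta>) * s\<^sup>2"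
proof (cases "c \<beta> = 0")
  case False
  then have "2 \<le> deg3 \<beta>" using low[of \<beta>] by force
  have "norm (emb (c \<beta>) * mon3 \<beta> a) \<le> norm (c \<beta>) * s ^ deg3 \<beta>"
    by (rule norm_mult_mono) (use norm_mon3_le[OF assms(1)] in auto)
  also have "\<dots> \<le> norm (c \<beta>) * (1 * s\<^sup>2)"
    using pow_le[OF False assms(2,3)] by (intro mult_left_mono) auto
  also have "\<dots> \<le> norm (c \<beta>) * (real (deg3 \<beta>) * s\<^sup>2)"
    using \<open>2 \<le> deg3 \<beta>\<close> by (intro mult_left_mono mult_right_mono) auto
  finally show ?thesis by (simp add: mult.assoc)
qed (simp add: emb_def ps_const_simps)

lemma subst3_has_sum:
  assumes "\<And>m. norm (a $ m) \<le> s" "0 \<le> s" "s \<le> 1"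
  shows "((\<lambda>\<beta>. emb (c \<beta>) * mon3 \<beta> a) has_sum subst3 c a) UNIV"
  unfolding subst3_def
  by (rule has_sum_infsum, rule abs_summable_summable,
      rule summable_on_comparison_test[OF summable_on_cmult_left[OF summ]])
    (use term_le[OF assms] in auto)

lemma norm_subst3_le:
  assumes "\<And>m. norm (a $ m) \<le> s" "0 \<le> s" "s \<le> 1"
  shows "norm (subst3 c a) \<le> K * s\<^sup>2"
  by (rule norm_infsum_le[OF subst3_has_sum[OF assms] has_sum_cmult_left[OF has_sum_infsum[OF summ], folded K_def]])
    (use term_le[OF assms] in auto)

text \<open>Only degrees at least 2 contribute, so one factor \<open>s\<close> is left beside
  \<open>d\<close>. The Lipschitz constant \<open>K * s\<close> on the ball of radius
  \<open>s\<close> becomes as small as desired when the ball shrinks.\<close>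

lemma norm_subst3_diff_le:
  assumes "\<And>m. norm (a $ m) \<le> s" "\<And>m. norm (b $ m) \<le> s" "\<And>m. norm (a $ m - b $ m) \<le> d" "0 < s" "s \<le> 1"
  shows "norm (subst3 c a - subst3 c b) \<le> K * (s * d)"
proof (rule norm_infsum_le[OF has_sum_diff[OF subst3_has_sum subst3_has_sum]
      has_sum_cmult_left[OF has_sum_infsum[OF summ], folded K_def]])
  fix \<beta>
  show "norm (emb (c \<beta>) * mon3 \<beta> a - emb (c \<beta>) * mon3 \<beta> b) \<le> norm (c \<beta>) * real (deg3 \<beta>) * (s * d)"
  proof (cases "c \<beta> = 0")
    case False
    have d: "0 \<le> d" by (rule order.trans[OF norm_ge_zero assms(3)[of 1]])
    have "close2 s (d / s) (deg3 \<beta>) (mon3 \<beta> a) (mon3 \<beta> b)"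
      by (rule close2_mon3) (use assms in auto)
    then have "norm (mon3 \<beta> a - mon3 \<beta> b) \<le> real (deg3 \<beta>) * s ^ deg3 \<beta> * (d / s)"
      by (simp add: close2_def)
    also have "\<dots> \<le> real (deg3 \<beta>) * s\<^sup>2 * (d / s)"
      using pow_le[OF False] assms d by (intro mult_right_mono mult_left_mono) auto
    also have "\<dots> = real (deg3 \<beta>) * (s * d)" using \<open>0 < s\<close> by (simp add: power2_eq_square)
    finally have "norm (emb (c \<beta>) * (mon3 \<beta> a - mon3 \<beta> b)) \<le> norm (c \<beta>) * (real (deg3 \<beta>) * (s * d))"
      by (intro norm_mult_mono) auto
    then show ?thesis by (simp add: right_diff_distrib mult.assoc)
  qed (simp add: emb_def ps_const_simps)
qed (use assms in auto)

text \<open>Inserting series without constant term into terms of degree at least 2 creates nothing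
  of degree below 2. The nonlinear part thus imposes no condition on the linear coefficients of the
  parametrization.\<close>

lemma lowest_subst3:
  assumes "\<And>m. norm (a $ m) \<le> 1" "\<And>m. lowest 1 (a $ m)"
  shows "lowest 2 (subst3 c a)"
  unfolding lowest_def
proof (intro allI impI)
  fix i j :: nat assume ij: "i + j < 2"
  have "coef2 (emb (c \<beta>) * mon3 \<beta> a) i j = 0" for \<beta>
  proof (cases "c \<beta> = 0")
    case False
    then have "i + j < deg3 \<beta>" using low[of \<beta>] ij by linarith
    then show ?thesis
      using lowest_mon3[of a \<beta>, OF assms(2)] by (simp add: coef2_emb_mult lowest_def)
  qed (simp add: coef2_emb_mult)
  then have "((\<lambda>\<beta>. 0) has_sum coef2 (subst3 c a) i j) (UNIV :: (nat \<times> nat \<times> nat) set)"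
    using has_sum_bounded_linear[OF bounded_linear_coef2 subst3_has_sum[OF assms(1)], of i j] by simp
  then show "coef2 (subst3 c a) i j = 0" by (rule has_sum_unique) simp
qed

text \<open>Evaluation is a continuous algebra homomorphism, so it passes through the infinite sum
  and through every monomial.\<close>

lemma eval2_subst3:
  assumes "\<And>m. norm (a $ m) \<le> 1" "norm u \<le> 1" "norm v \<le> 1"
  shows "eval2 u v (subst3 c a) = tseries c (\<chi> m. eval2 u v (a $ m))"
proof -
  have pow: "eval2 u v (x ^ n) = eval2 u v x ^ n" for x n
  proof (induction n)
    case 0
    then show ?case using eval2_emb[OF assms(2,3), of 1] by (simp add: emb_def ps_const_simps)
  qed (simp add: eval2_mult[OF assms(2,3)])
  have "((\<lambda>\<beta>. eval2 u v (emb (c \<beta>) * mon3 \<beta> a)) has_sum eval2 u v (subst3 c a)) UNIV"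
    using has_sum_bounded_linear[OF bounded_linear_eval2[OF assms(2,3)] subst3_has_sum[OF assms(1)]] by simp
  then show ?thesis
    unfolding tseries_def
    by (intro infsumI[symmetric])
      (simp add: eval2_mult[OF assms(2,3)] eval2_emb[OF assms(2,3)] mon3_def pow case_prod_unfold)
qed

end

section \<open>The linearizing parametrization of the invariant surface\<close>

lemma norm_vec3_le: "norm (x :: 'a::real_normed_vector ^ 3) \<le> norm (x $ 1) + norm (x $ 2) + norm (x $ 3)"
  unfolding norm_vec_def using L2_set_le_sum[of "UNIV :: 3 set" "\<lambda>i. norm (x $ i)"] by (simp add: sum_3)

lemma multiplier_diff:
  assumes "\<And>i j. norm (m i j) \<le> B"
  shows "multiplier m a - multiplier m b = multiplier m (a - b)"
  by (rule bps_eqI) (simp add: coef2_multiplier[of m B, OF assms] right_diff_distrib)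

lemma coef2_ps_X: "coef2 ps_X i j = (if i = 1 \<and> j = 0 then 1 else 0)"
  by (simp add: coef2_def)

lemma coef2_const_ps_X: "coef2 (ps_const ps_X) i j = (if i = 0 \<and> j = 1 then 1 else 0)"
  by (simp add: coef2_def)

lemma nat_pair_cases: "(i :: nat) + j \<ge> 2 \<or> (i = 0 \<and> j = 0) \<or> (i = 1 \<and> j = 0) \<or> (i = 0 \<and> j = 1)"
  by linarith

text \<open>Banach's fixed point theorem for \<open>g = G - r * U\<close>, where \<open>U\<close> is
  the inclusion of the \<open>(u1, u2)\<close>-plane. Degrees at least 2 are solved by division; in
  lower degrees both sides of the coefficient equation vanish.\<close>

lemma invariant_manifold_series:
  fixes c :: "3 \<Rightarrow> nat \<times> nat \<times> nat \<Rightarrow> complex" and L :: "3 \<Rightarrow> complex"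
  assumes c: "\<And>m. nonlinear_coeffs (c m)"
    and e: "0 < e" "\<And>m i j. i + j \<ge> 2 \<Longrightarrow> e \<le> norm (of_nat i * l1 + of_nat j * l2 - L m)"
    and L: "L 1 = l1" "L 2 = l2"
  shows "\<exists>(r::real) G. 0 < r \<and> (\<forall>m. norm (G $ m) \<le> 1 \<and> coef2 (G $ m) 0 0 = 0 \<and>
    coef2 (G $ m) 1 0 = (if m = 1 then of_real r else 0) \<and>
    coef2 (G $ m) 0 1 = (if m = 2 then of_real r else 0) \<and>
    (\<forall>i j. (of_nat i * l1 + of_nat j * l2 - L m) * coef2 (G $ m) i j = coef2 (subst3 (c m) G) i j))"
proof -
  \<comment> \<open>The value \<open>0\<close> in degrees below 2 leaves the linear part
    \<open>r * U\<close> untouched and avoids the divisors \<open>l1 - L 1\<close> and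
    \<open>l2 - L 2\<close>, which are zero.\<close>
  define \<mu> where "\<mu> m i j = (if i + j \<ge> 2 then 1 / (of_nat i * l1 + of_nat j * l2 - L m) else 0)" for m i j
  have \<mu>: "norm (\<mu> m i j) \<le> 1 / e" for m i j
  proof (cases "i + j \<ge> 2")
    case True
    have "1 / norm (of_nat i * l1 + of_nat j * l2 - L m) \<le> 1 / e"
      by (rule frac_le) (use e True in auto)
    then show ?thesis using True by (simp add: \<mu>_def norm_divide)
  qed (use e in \<open>simp add: \<mu>_def\<close>)
  define U :: "bps ^ 3" where "U = vector [ps_X, ps_const ps_X, 0]"
  have U: "U $ 1 = ps_X" "U $ 2 = ps_const ps_X" "U $ 3 = 0" by (simp_all add: U_def)
  have normU: "norm (U $ m) \<le> 1" for m using exhaust_3[of m] U by auto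
  define K where "K m = nonlinear_coeffs.K (c m)" for m
  have K0: "0 \<le> K m" for m unfolding K_def by (rule nonlinear_coeffs.K_nonneg[OF c])
  define KK where "KK = K 1 + K 2 + K 3"
  have KK0: "0 \<le> KK" using K0 by (simp add: KK_def)
  \<comment> \<open>The bound \<open>1/2\<close> keeps the argument \<open>P g\<close>, of norm at
    most \<open>2 * r\<close>, inside the unit ball. From \<open>4 * KK * r \<le> e\<close> come
    both the self-map bound \<open>4 * KK * r^2 / e \<le> r\<close> and the contraction factor
    \<open>2 * KK * r / e \<le> 1/2\<close>. The summand 1 covers \<open>KK = 0\<close>.\<close>
  define r where "r = min (1/2) (e / (4 * (1 + KK)))"
  have r: "0 < r" "r \<le> 1/2"
    using e KK0 min.cobounded1[of "1/2" "e / (4 * (1 + KK))"] unfolding r_def by auto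
  have "r \<le> e / (4 * (1 + KK))" by (simp add: r_def)
  then have "r * (4 * (1 + KK)) \<le> e" using KK0 by (subst (asm) pos_le_divide_eq) auto
  then have rK: "4 * KK * r \<le> e" using r by (simp add: algebra_simps)
  define P where "P g = g + r *\<^sub>R U" for g
  have normP: "norm (P g $ m) \<le> 2 * r" if "norm g \<le> r" for g m
  proof -
    have "norm (P g $ m) \<le> norm (g $ m) + r * norm (U $ m)"
      unfolding P_def using norm_triangle_ineq[of "g $ m" "r *\<^sub>R U $ m"] r by simp
    also have "\<dots> \<le> r + r * 1"
      using Finite_Cartesian_Product.norm_nth_le[of g m] that normU[of m] r
      by (intro add_mono mult_left_mono) auto
    finally show ?thesis by simp
  qed
  have r2: "0 < 2 * r" "2 * r \<le> 1" using r by auto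
  define F where "F g = (\<chi> m. multiplier (\<mu> m) (subst3 (c m) (P g)))" for g
  have nF: "norm (F g) \<le> r" if g: "norm g \<le> r" for g
  proof -
    have "norm (F g $ m) \<le> 1 / e * (K m * (2 * r)\<^sup>2)" for m
    proof -
      have "norm (F g $ m) \<le> 1 / e * norm (subst3 (c m) (P g))"
        by (simp only: F_def vec_lambda_beta) (rule norm_multiplier_le[OF \<mu>])
      also have "\<dots> \<le> 1 / e * (K m * (2 * r)\<^sup>2)"
        unfolding K_def
        by (intro mult_left_mono nonlinear_coeffs.norm_subst3_le[OF c normP[OF g]]) (use r2 e in auto)
      finally show ?thesis .
    qed
    then have "norm (F g) \<le> 1 / e * (K 1 * (2 * r)\<^sup>2) + 1 / e * (K 2 * (2 * r)\<^sup>2) + 1 / e * (K 3 * (2 * r)\<^sup>2)"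
      by (intro order.trans[OF norm_vec3_le] add_mono)
    also have "\<dots> = (4 * KK * r) * r / e" by (simp add: KK_def algebra_simps power2_eq_square add_divide_distrib)
    also have "\<dots> \<le> e * r / e" using rK r e by (intro divide_right_mono mult_right_mono) auto
    also have "\<dots> = r" using e by simp
    finally show ?thesis .
  qed
  have lF: "norm (F g - F h) \<le> 1/2 * norm (g - h)" if g: "norm g \<le> r" and h: "norm h \<le> r" for g h
  proof -
    have "norm ((F g - F h) $ m) \<le> 1 / e * (K m * (2 * r * norm (g - h)))" for m
    proof -
      have d: "norm (P g $ m - P h $ m) \<le> norm (g - h)" for m
        using Finite_Cartesian_Product.norm_nth_le[of "g - h" m] by (simp add: P_def)
      have "(F g - F h) $ m = multiplier (\<mu> m) (subst3 (c m) (P g) - subst3 (c m) (P h))"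
        by (simp add: F_def multiplier_diff[OF \<mu>])
      then have "norm ((F g - F h) $ m) \<le> 1 / e * norm (subst3 (c m) (P g) - subst3 (c m) (P h))"
        by (simp only:) (rule norm_multiplier_le[OF \<mu>])
      also have "\<dots> \<le> 1 / e * (K m * (2 * r * norm (g - h)))"
        unfolding K_def
        by (intro mult_left_mono nonlinear_coeffs.norm_subst3_diff_le[OF c normP[OF g] normP[OF h] d]) (use r2 e in auto)
      finally show ?thesis .
    qed
    then have "norm (F g - F h) \<le> 1 / e * (K 1 * (2 * r * norm (g - h))) + 1 / e * (K 2 * (2 * r * norm (g - h)))
         + 1 / e * (K 3 * (2 * r * norm (g - h)))"
      by (intro order.trans[OF norm_vec3_le] add_mono)
    also have "\<dots> = (4 * KK * r) * (norm (g - h) / (2 * e))" by (simp add: KK_def algebra_simps add_divide_distrib)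
    also have "\<dots> \<le> e * (norm (g - h) / (2 * e))" using rK e by (intro mult_right_mono) auto
    also have "\<dots> = 1/2 * norm (g - h)" using e by simp
    finally show ?thesis .
  qed
  have "\<exists>!g\<in>cball 0 r. F g = g"
  proof (rule Banach_fix[of _ "1/2"])
    show "complete (cball (0 :: bps ^ 3) r)" by (simp add: complete_eq_closed)
    show "cball (0 :: bps ^ 3) r \<noteq> {}" using r by auto
    show "F ` cball 0 r \<subseteq> cball 0 r" using nF by auto
    show "dist (F g) (F h) \<le> 1/2 * dist g h" if "g \<in> cball 0 r" "h \<in> cball 0 r" for g h
      using lF[of g h] that by (simp add: dist_norm)
  qed auto
  then obtain g where "g \<in> cball 0 r" and gF: "F g = g" by blast
  then have "norm g \<le> r" by simp
  note g = this gF
  have cg: "coef2 (g $ m) i j = \<mu> m i j * coef2 (subst3 (c m) (P g)) i j" for m i j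
  proof -
    have "g $ m = multiplier (\<mu> m) (subst3 (c m) (P g))" by (subst g(2)[symmetric]) (simp add: F_def)
    then show ?thesis by (simp only:) (rule coef2_multiplier[OF \<mu>])
  qed
  have cg0: "coef2 (g $ m) i j = 0" if "i + j < 2" for m i j
    using that by (simp add: cg \<mu>_def)
  have cP: "coef2 (P g $ m) i j = coef2 (g $ m) i j + r *\<^sub>R coef2 (U $ m) i j" for m i j
    by (simp add: P_def)
  have cU: "coef2 (U $ m) i j = (if m = 1 \<and> i = 1 \<and> j = 0 \<or> m = 2 \<and> i = 0 \<and> j = 1 then 1 else 0)" for m i j
    using exhaust_3[of m] U by (auto simp: coef2_ps_X coef2_const_ps_X)
  have nP1: "norm (P g $ m) \<le> 1" for m using normP[OF g(1), of m] r2 by linarith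
  have P00: "coef2 (P g $ m) 0 0 = 0" for m by (simp add: cP cU cg0)
  have "lowest 2 (subst3 (c m) (P g))" for m
    by (rule nonlinear_coeffs.lowest_subst3[OF c nP1]) (use P00 in \<open>simp add: lowest_def\<close>)
  then have low: "coef2 (subst3 (c m) (P g)) i j = 0" if "i + j < 2" for m i j
    using that by (simp add: lowest_def)
  have main: "(of_nat i * l1 + of_nat j * l2 - L m) * coef2 (P g $ m) i j = coef2 (subst3 (c m) (P g)) i j" for m i j
  proof (cases "i + j \<ge> 2")
    case True
    then have "coef2 (U $ m) i j = 0" by (auto simp: cU)
    moreover have "of_nat i * l1 + of_nat j * l2 - L m \<noteq> 0"
      using e(1) e(2)[OF True, of m] by auto
    ultimately show ?thesis using True by (simp add: cP cg \<mu>_def)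
  next
    case False
    \<comment> \<open>The nonzero coefficients of \<open>U\<close> sit exactly where the divisor is
      \<open>l1 - L 1\<close> or \<open>l2 - L 2\<close>.\<close>
    then have "(of_nat i * l1 + of_nat j * l2 - L m) * coef2 (U $ m) i j = 0"
      using nat_pair_cases[of i j] L by (auto simp: cU)
    then show ?thesis using False low[of i j m] cg0[of i j m] by (simp add: cP)
  qed
  show ?thesis
  proof (rule exI[of _ r], rule exI[of _ "P g"], intro conjI allI)
    show "coef2 (P g $ m) 1 0 = (if m = 1 then of_real r else 0)" for m
      by (simp add: cP cU cg0 scaleR_conv_of_real)
    show "coef2 (P g $ m) 0 1 = (if m = 2 then of_real r else 0)" for m
      by (simp add: cP cU cg0 scaleR_conv_of_real)
  qed (rule r(1) nP1 P00 main)+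
qed

text \<open>A series in \<open>y1, y2\<close>, read as a series in \<open>y1, y2, y3\<close>.\<close>

definition coef3_of :: "bps \<Rightarrow> nat \<times> nat \<times> nat \<Rightarrow> complex" where
  "coef3_of a = (\<lambda>(i, j, k). if k = 0 then coef2 a i j else 0)"

lemma geo_bounded_coef3_of:
  assumes "norm a \<le> 1"
  shows "geo_bounded 1 1 (coef3_of a)"
proof -
  have "norm (coef2 a i j) \<le> 1" for i j
    by (rule order.trans[OF norm_coef2_le assms])
  then show ?thesis by (simp add: geo_bounded_def coef3_of_def)
qed

lemma has_sum_coef3_of:
  assumes "norm (y $ 1) \<le> 1" "norm (y $ 2) \<le> 1"
  shows "((\<lambda>(i, j, k). coef3_of a (i, j, k) * (y $ 1 ^ i * y $ 2 ^ j * y $ 3 ^ k)) has_sum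
     eval2 (y $ 1) (y $ 2) a) UNIV" (is "(?f has_sum _) _")
proof -
  let ?h = "\<lambda>(i :: nat, j :: nat). (i, j, 0 :: nat)"
  have inj: "inj ?h" by (auto simp: inj_def)
  have "(?f has_sum eval2 (y $ 1) (y $ 2) a) (range ?h)"
    unfolding has_sum_reindex[OF inj]
    using eval2_has_sum[OF assms, of a] by (simp add: comp_def case_prod_unfold coef3_of_def)
  moreover have "?f \<beta> = 0" if "\<beta> \<notin> range ?h" for \<beta>
  proof -
    obtain i j k where b: "\<beta> = (i, j, k)" by (cases \<beta>)
    have "k \<noteq> 0" using that unfolding b by (auto simp: image_iff)
    then show ?thesis by (simp add: b coef3_of_def)
  qed
  then have "(?f has_sum s) (range ?h) \<longleftrightarrow> (?f has_sum s) UNIV" for s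
    by (intro has_sum_cong_neutral) auto
  ultimately show ?thesis by simp
qed

lemma tseries_coef3_of:
  assumes "norm (y $ 1) \<le> 1" "norm (y $ 2) \<le> 1"
  shows "tseries (coef3_of a) y = eval2 (y $ 1) (y $ 2) a"
  unfolding tseries_def using has_sum_coef3_of[OF assms] by (rule infsumI)

text \<open>The operators \<open>y1 * d/dy1\<close> and \<open>y2 * d/dy2\<close> multiply a
  monomial by its exponents, so the coefficient identity makes both sides sums of one and the same
  family. The radius \<open>1/2\<close> is where the derivatives of series with coefficients bounded
  by 1 are under control.\<close>

lemma invariance_equation:
  fixes G :: "bps ^ 3" and y :: "complex ^ 3"
  assumes c: "nonlinear_coeffs c"
    and G: "\<And>m. norm (G $ m) \<le> 1"
    and eq: "\<And>i j. (of_nat i * l1 + of_nat j * l2 - L) * coef2 (G $ m) i j = coef2 (subst3 c G) i j"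
    and y: "y \<in> polydisc (1 / 2)"
  shows "l1 * y $ 1 * tseries (dcoef1 (coef3_of (G $ m))) y + l2 * y $ 2 * tseries (dcoef2 (coef3_of (G $ m))) y
     = L * tseries (coef3_of (G $ m)) y + tseries c (\<chi> m. tseries (coef3_of (G $ m)) y)"
proof -
  have "norm (y $ m) < 1 / 2" for m using y by (simp add: polydisc_def)
  then have y1: "norm (y $ m) \<le> 1" for m by (rule less_imp_le[OF less_trans[of _ "1 / 2"]]) simp 
  let ?a = "G $ m" and ?m = "\<lambda>(i, j, k). y $ 1 ^ i * y $ 2 ^ j * y $ 3 ^ k"
  note g = geo_bounded_coef3_of[OF G]
  have d1: "((\<lambda>\<beta>. (case \<beta> of (i, j, k) \<Rightarrow> coef3_of ?a (i, j, k) * (of_nat i * y $ 1 ^ (i - 1) * y $ 2 ^ j * y $ 3 ^ k)) * (l1 * y $ 1))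
     has_sum tseries (dcoef1 (coef3_of ?a)) y * (l1 * y $ 1)) UNIV"
    by (rule has_sum_cmult_left[OF dcoef_has_sum(1)[OF g _ y]]) simp
  have d2: "((\<lambda>\<beta>. (case \<beta> of (i, j, k) \<Rightarrow> coef3_of ?a (i, j, k) * (y $ 1 ^ i * (of_nat j * y $ 2 ^ (j - 1)) * y $ 3 ^ k)) * (l2 * y $ 2))
     has_sum tseries (dcoef2 (coef3_of ?a)) y * (l2 * y $ 2)) UNIV"
    by (rule has_sum_cmult_left[OF dcoef_has_sum(2)[OF g _ y]]) simp
  have p: "of_nat n * z ^ (n - 1) * z = of_nat n * z ^ n" for n and z :: complex by (cases n) auto
  have l: "((\<lambda>(i, j, k). (of_nat i * l1 + of_nat j * l2) * coef3_of ?a (i, j, k) * (y $ 1 ^ i * y $ 2 ^ j * y $ 3 ^ k)) has_sum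
      (tseries (dcoef1 (coef3_of ?a)) y * (l1 * y $ 1) + tseries (dcoef2 (coef3_of ?a)) y * (l2 * y $ 2))) UNIV"
  proof (rule has_sum_cong[THEN iffD1, OF _ has_sum_add[OF d1 d2]])
    fix \<beta> :: "nat \<times> nat \<times> nat"
    obtain i j k where b: "\<beta> = (i, j, k)" by (cases \<beta>)
    have A: "coef3_of ?a (i, j, k) * (of_nat i * y $ 1 ^ (i - 1) * y $ 2 ^ j * y $ 3 ^ k) * (l1 * y $ 1) =
       coef3_of ?a (i, j, k) * ((of_nat i * y $ 1 ^ i) * y $ 2 ^ j * y $ 3 ^ k) * l1"
      unfolding p[symmetric] by (simp only: mult_ac)
    have B: "coef3_of ?a (i, j, k) * (y $ 1 ^ i * (of_nat j * y $ 2 ^ (j - 1)) * y $ 3 ^ k) * (l2 * y $ 2) =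
       coef3_of ?a (i, j, k) * (y $ 1 ^ i * (of_nat j * y $ 2 ^ j) * y $ 3 ^ k) * l2"
      unfolding p[symmetric] by (simp only: mult_ac)
    show "(case \<beta> of (i, j, k) \<Rightarrow> coef3_of ?a (i, j, k) * (of_nat i * y $ 1 ^ (i - 1) * y $ 2 ^ j * y $ 3 ^ k)) * (l1 * y $ 1)
      + (case \<beta> of (i, j, k) \<Rightarrow> coef3_of ?a (i, j, k) * (y $ 1 ^ i * (of_nat j * y $ 2 ^ (j - 1)) * y $ 3 ^ k)) * (l2 * y $ 2)
      = (case \<beta> of (i, j, k) \<Rightarrow> (of_nat i * l1 + of_nat j * l2) * coef3_of ?a (i, j, k) * (y $ 1 ^ i * y $ 2 ^ j * y $ 3 ^ k))"
      unfolding b prod.case A B by (simp add: algebra_simps)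
  qed
  have r: "((\<lambda>(i, j, k). (of_nat i * l1 + of_nat j * l2) * coef3_of ?a (i, j, k) * (y $ 1 ^ i * y $ 2 ^ j * y $ 3 ^ k)) has_sum
      (L * eval2 (y $ 1) (y $ 2) ?a + eval2 (y $ 1) (y $ 2) (subst3 c G))) UNIV"
  proof (rule has_sum_cong[THEN iffD1, OF _ has_sum_add[OF has_sum_cmult_right[OF has_sum_coef3_of[OF y1 y1]] has_sum_coef3_of[OF y1 y1]]])
    fix \<beta> :: "nat \<times> nat \<times> nat"
    obtain i j k where b: "\<beta> = (i, j, k)" by (cases \<beta>)
    have "L * coef2 ?a i j + coef2 (subst3 c G) i j = (of_nat i * l1 + of_nat j * l2) * coef2 ?a i j"
      using eq[of i j] by (simp add: algebra_simps)
    then have "L * coef3_of ?a (i, j, k) + coef3_of (subst3 c G) (i, j, k) = (of_nat i * l1 + of_nat j * l2) * coef3_of ?a (i, j, k)"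
      by (simp add: coef3_of_def)
    then show "L * (case \<beta> of (i, j, k) \<Rightarrow> coef3_of ?a (i, j, k) * (y $ 1 ^ i * y $ 2 ^ j * y $ 3 ^ k)) +
       (case \<beta> of (i, j, k) \<Rightarrow> coef3_of (subst3 c G) (i, j, k) * (y $ 1 ^ i * y $ 2 ^ j * y $ 3 ^ k)) =
       (case \<beta> of (i, j, k) \<Rightarrow> (of_nat i * l1 + of_nat j * l2) * coef3_of ?a (i, j, k) * (y $ 1 ^ i * y $ 2 ^ j * y $ 3 ^ k))"
      unfolding b prod.case by (simp only: distrib_right[symmetric] mult.assoc[symmetric])
  qed
  have "eval2 (y $ 1) (y $ 2) (subst3 c G) = tseries c (\<chi> m. eval2 (y $ 1) (y $ 2) (G $ m))"
    by (rule nonlinear_coeffs.eval2_subst3[OF c G y1 y1])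
  with has_sum_unique[OF l r] show ?thesis
    by (simp add: tseries_coef3_of[OF y1 y1] mult_ac)
qed

section \<open>Holomorphic maps and division by a coordinate\<close>

lemma has_derivative_vec_componentwise:
  fixes F :: "'a::real_normed_vector \<Rightarrow> complex^'n"
  assumes "\<And>i. ((\<lambda>x. F x $ i) has_derivative (\<lambda>h. D h $ i)) (at z)"
  shows "(F has_derivative D) (at z)"
proof (subst has_derivative_componentwise_within, rule ballI)
  fix b :: "complex^'n" assume "b \<in> Basis"
  then obtain i u where b: "b = axis i u" by (auto simp: Basis_vec_def)
  show "((\<lambda>x. F x \<bullet> b) has_derivative (\<lambda>x. D x \<bullet> b)) (at z)"
    unfolding b inner_axis by (rule has_derivative_inner_left[OF assms])
qed

lemma has_derivative_vec_nth:
  "(F has_derivative D) (at z) \<Longrightarrow> ((\<lambda>x. F x $ i) has_derivative (\<lambda>h. D h $ i)) (at z)"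
  by (rule bounded_linear.has_derivative[OF bounded_linear_vec_nth])

text \<open>Additivity is already part of \<open>has_derivative\<close>, so complex homogeneity is
  enough: the coefficient vector is recovered from the values on the axis vectors. In this form the
  product and chain rules need no bookkeeping of coefficients.\<close>

lemma mv_holomorphic_on_iff:
  fixes f :: "complex^'n \<Rightarrow> complex"
  shows "mv_holomorphic_on f U \<longleftrightarrow>
    open U \<and> (\<forall>z\<in>U. \<exists>D. (f has_derivative D) (at z) \<and> (\<forall>c h. D (c *s h) = c * D h))"
proof -
  have "(\<exists>a::complex^'n. (f has_derivative (\<lambda>h. \<Sum>i\<in>UNIV. a $ i * h $ i)) (at z)) \<longleftrightarrow>
     (\<exists>D. (f has_derivative D) (at z) \<and> (\<forall>c h. D (c *s h) = c * D h))" for z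
  proof
    assume "\<exists>a::complex^'n. (f has_derivative (\<lambda>h. \<Sum>i\<in>UNIV. a $ i * h $ i)) (at z)"
    then obtain a :: "complex^'n" where a: "(f has_derivative (\<lambda>h. \<Sum>i\<in>UNIV. a $ i * h $ i)) (at z)" ..
    show "\<exists>D. (f has_derivative D) (at z) \<and> (\<forall>c h. D (c *s h) = c * D h)"
      by (rule exI, rule conjI, rule a) (simp add: sum_distrib_left mult_ac)
  next
    assume "\<exists>D. (f has_derivative D) (at z) \<and> (\<forall>c h. D (c *s h) = c * D h)"
    then obtain D where D: "(f has_derivative D) (at z)" and lin: "\<And>c h. D (c *s h) = c * D h" by blast
    have "D h = (\<Sum>i\<in>UNIV. (\<chi> i. D (axis i 1)) $ i * h $ i)" for h
    proof -
      have "D h = D (\<Sum>i\<in>UNIV. (h $ i) *s axis i 1)" by (simp only: basis_expansion)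
      also have "\<dots> = (\<Sum>i\<in>UNIV. D ((h $ i) *s axis i 1))"
        by (rule linear_sum[OF has_derivative_linear[OF D]])
      finally show ?thesis by (simp add: lin mult.commute)
    qed
    then have "(f has_derivative (\<lambda>h. \<Sum>i\<in>UNIV. (\<chi> i. D (axis i 1)) $ i * h $ i)) (at z)"
      by (intro has_derivative_eq_rhs[OF D] ext)
    then show "\<exists>a::complex^'n. (f has_derivative (\<lambda>h. \<Sum>i\<in>UNIV. a $ i * h $ i)) (at z)" ..
  qed
  then show ?thesis by (simp add: mv_holomorphic_on_def)
qed

lemma holomorphic_map_on_iff:
  fixes F :: "complex^'n \<Rightarrow> complex^'m"
  shows "holomorphic_map_on F U \<longleftrightarrow>
    open U \<and> (\<forall>z\<in>U. \<exists>D. (F has_derivative D) (at z) \<and> (\<forall>c h. D (c *s h) = c *s D h))"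
proof
  assume F: "holomorphic_map_on F U"
  then have "open U" by (auto simp: holomorphic_map_on_def mv_holomorphic_on_def)
  moreover have "\<exists>D. (F has_derivative D) (at z) \<and> (\<forall>c h. D (c *s h) = c *s D h)" if "z \<in> U" for z
  proof -
    have "\<forall>i. \<exists>D. ((\<lambda>x. F x $ i) has_derivative D) (at z) \<and> (\<forall>c h. D (c *s h) = c * D h)"
      using F that by (auto simp: holomorphic_map_on_def mv_holomorphic_on_iff)
    from choice[OF this] obtain D where D: "\<And>i. ((\<lambda>x. F x $ i) has_derivative D i) (at z)"
      and lin: "\<And>i c h. D i (c *s h) = c * D i h" by blast
    have "(F has_derivative (\<lambda>h. \<chi> i. D i h)) (at z)"
      by (rule has_derivative_vec_componentwise) (simp add: D)
    moreover have "(\<chi> i. D i (c *s h)) = c *s (\<chi> i. D i h)" for c h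
      by (simp add: vec_eq_iff lin)
    ultimately show ?thesis by blast
  qed
  ultimately show "open U \<and> (\<forall>z\<in>U. \<exists>D. (F has_derivative D) (at z) \<and> (\<forall>c h. D (c *s h) = c *s D h))"
    by blast
next
  assume F: "open U \<and> (\<forall>z\<in>U. \<exists>D. (F has_derivative D) (at z) \<and> (\<forall>c h. D (c *s h) = c *s D h))"
  show "holomorphic_map_on F U"
    unfolding holomorphic_map_on_def mv_holomorphic_on_iff
  proof (intro allI conjI ballI)
    fix i z assume "z \<in> U"
    with F obtain D where D: "(F has_derivative D) (at z)" "\<And>c h. D (c *s h) = c *s D h" by blast
    then show "\<exists>D. ((\<lambda>z. F z $ i) has_derivative D) (at z) \<and> (\<forall>c h. D (c *s h) = c * D h)"
      by (intro exI[of _ "\<lambda>h. D h $ i"] conjI has_derivative_vec_nth) auto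
  qed (use F in auto)
qed

lemma mv_holomorphic_onD:
  assumes "mv_holomorphic_on f U" "z \<in> U"
  obtains D where "(f has_derivative D) (at z)" "\<forall>c h. D (c *s h) = c * D h"
  using assms by (auto simp: mv_holomorphic_on_iff)

lemma mv_holomorphic_on_open: "mv_holomorphic_on f U \<Longrightarrow> open U"
  by (simp add: mv_holomorphic_on_def)

lemma mv_holomorphic_onI:
  assumes "open U"
    and "\<And>z. z \<in> U \<Longrightarrow> (f has_derivative D z) (at z)" "\<And>z c h. z \<in> U \<Longrightarrow> D z (c *s h) = c * D z h"
  shows "mv_holomorphic_on f U"
  using assms unfolding mv_holomorphic_on_iff by blast

lemma mv_holomorphic_on_subset:
  "mv_holomorphic_on f U \<Longrightarrow> open V \<Longrightarrow> V \<subseteq> U \<Longrightarrow> mv_holomorphic_on f V"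
  unfolding mv_holomorphic_on_def by blast

lemma mv_holomorphic_on_cong:
  assumes "mv_holomorphic_on f U" "\<And>z. z \<in> U \<Longrightarrow> g z = f z"
  shows "mv_holomorphic_on g U"
  unfolding mv_holomorphic_on_iff
proof (intro conjI ballI)
  show U: "open U" using assms(1) by (rule mv_holomorphic_on_open)
  fix z assume z: "z \<in> U"
  obtain D where D: "(f has_derivative D) (at z)" "\<forall>c h. D (c *s h) = c * D h"
    by (rule mv_holomorphic_onD[OF assms(1) z])
  have "(g has_derivative D) (at z)"
    by (rule has_derivative_transform_within_open[OF D(1) U z]) (simp add: assms(2))
  with D(2) show "\<exists>D. (g has_derivative D) (at z) \<and> (\<forall>c h. D (c *s h) = c * D h)" by blast
qed

lemma mv_holomorphic_on_imp_continuous_on: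
  assumes "mv_holomorphic_on f U"
  shows "continuous_on U f"
proof (rule continuous_at_imp_continuous_on, rule ballI)
  fix z assume z: "z \<in> U"
  obtain D where "(f has_derivative D) (at z)" "\<forall>c h. D (c *s h) = c * D h"
    by (rule mv_holomorphic_onD[OF assms z])
  from this(1) show "isCont f z" by (rule has_derivative_continuous)
qed

lemma mv_holomorphic_on_const: "open U \<Longrightarrow> mv_holomorphic_on (\<lambda>z. a) U"
  by (rule mv_holomorphic_onI[where D = "\<lambda>z h. 0"]) auto

lemma mv_holomorphic_on_nth: "open U \<Longrightarrow> mv_holomorphic_on (\<lambda>z. z $ i) U"
  by (rule mv_holomorphic_onI[where D = "\<lambda>z h. h $ i"])
    (auto intro: bounded_linear_imp_has_derivative[OF bounded_linear_vec_nth])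

lemma mv_holomorphic_on_add:
  assumes "mv_holomorphic_on f U" "mv_holomorphic_on g U"
  shows "mv_holomorphic_on (\<lambda>z. f z + g z) U"
  unfolding mv_holomorphic_on_iff
proof (intro conjI ballI)
  fix z assume z: "z \<in> U"
  obtain D where D: "(f has_derivative D) (at z)" "\<forall>c h. D (c *s h) = c * D h"
    by (rule mv_holomorphic_onD[OF assms(1) z])
  obtain E where E: "(g has_derivative E) (at z)" "\<forall>c h. E (c *s h) = c * E h"
    by (rule mv_holomorphic_onD[OF assms(2) z])
  show "\<exists>D. ((\<lambda>z. f z + g z) has_derivative D) (at z) \<and> (\<forall>c h. D (c *s h) = c * D h)"
    by (rule exI, rule conjI, rule has_derivative_add[OF D(1) E(1)]) (simp add: D(2) E(2) algebra_simps)
qed (rule mv_holomorphic_on_open[OF assms(1)])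

lemma mv_holomorphic_on_mult:
  assumes "mv_holomorphic_on f U" "mv_holomorphic_on g U"
  shows "mv_holomorphic_on (\<lambda>z. f z * g z) U"
  unfolding mv_holomorphic_on_iff
proof (intro conjI ballI)
  fix z assume z: "z \<in> U"
  obtain D where D: "(f has_derivative D) (at z)" "\<forall>c h. D (c *s h) = c * D h"
    by (rule mv_holomorphic_onD[OF assms(1) z])
  obtain E where E: "(g has_derivative E) (at z)" "\<forall>c h. E (c *s h) = c * E h"
    by (rule mv_holomorphic_onD[OF assms(2) z])
  show "\<exists>D. ((\<lambda>z. f z * g z) has_derivative D) (at z) \<and> (\<forall>c h. D (c *s h) = c * D h)"
    by (rule exI, rule conjI, rule has_derivative_mult[OF D(1) E(1)]) (simp add: D(2) E(2) algebra_simps)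
qed (rule mv_holomorphic_on_open[OF assms(1)])

lemma mv_holomorphic_on_diff:
  assumes "mv_holomorphic_on f U" "mv_holomorphic_on g U"
  shows "mv_holomorphic_on (\<lambda>z. f z - g z) U"
  using mv_holomorphic_on_add[OF assms(1) mv_holomorphic_on_mult[OF mv_holomorphic_on_const[of U "-1"] assms(2)]]
    mv_holomorphic_on_open[OF assms(1)] by simp

lemma mv_holomorphic_on_compose_field:
  assumes "mv_holomorphic_on f U" "\<And>z. z \<in> U \<Longrightarrow> (g has_field_derivative g' z) (at (f z))"
  shows "mv_holomorphic_on (\<lambda>z. g (f z)) U"
  unfolding mv_holomorphic_on_iff
proof (intro conjI ballI)
  fix z assume z: "z \<in> U"
  obtain D where D: "(f has_derivative D) (at z)" "\<forall>c h. D (c *s h) = c * D h"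
    by (rule mv_holomorphic_onD[OF assms(1) z])
  have "((\<lambda>z. g (f z)) has_derivative (\<lambda>h. g' z * D h)) (at z)"
    using has_derivative_compose[OF D(1) assms(2)[OF z, unfolded has_field_derivative_def]] .
  then show "\<exists>D. ((\<lambda>z. g (f z)) has_derivative D) (at z) \<and> (\<forall>c h. D (c *s h) = c * D h)"
    by - (rule exI, rule conjI, assumption, simp add: D(2))
qed (rule mv_holomorphic_on_open[OF assms(1)])

lemma mv_holomorphic_on_divide:
  assumes "mv_holomorphic_on f U" "mv_holomorphic_on g U" "\<And>z. z \<in> U \<Longrightarrow> g z \<noteq> 0"
  shows "mv_holomorphic_on (\<lambda>z. f z / g z) U"
proof -
  have "mv_holomorphic_on (\<lambda>z. inverse (g z)) U"
    by (rule mv_holomorphic_on_compose_field[OF assms(2) DERIV_inverse]) (rule assms(3))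
  from mv_holomorphic_on_mult[OF assms(1) this] show ?thesis by (simp add: divide_inverse)
qed

lemma mv_holomorphic_on_compose:
  assumes F: "holomorphic_map_on F U" and f: "mv_holomorphic_on f V" and "F ` U \<subseteq> V"
  shows "mv_holomorphic_on (\<lambda>z. f (F z)) U"
  unfolding mv_holomorphic_on_iff
proof (intro conjI ballI)
  show "open U" using F by (simp add: holomorphic_map_on_iff)
  fix z assume z: "z \<in> U"
  with F obtain D where D: "(F has_derivative D) (at z)" "\<And>c h. D (c *s h) = c *s D h"
    unfolding holomorphic_map_on_iff by blast
  from z assms(3) have FV: "F z \<in> V" by blast
  obtain E where E: "(f has_derivative E) (at (F z))" "\<forall>c h. E (c *s h) = c * E h"
    by (rule mv_holomorphic_onD[OF f FV])
  have "((\<lambda>z. f (F z)) has_derivative (\<lambda>h. E (D h))) (at z)"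
    by (rule has_derivative_compose[OF D(1) E(1)])
  then show "\<exists>D. ((\<lambda>z. f (F z)) has_derivative D) (at z) \<and> (\<forall>c h. D (c *s h) = c * D h)"
    by - (rule exI, rule conjI, assumption, simp add: D(2) E(2))
qed

lemma mv_holomorphic_on_slice:
  assumes f: "mv_holomorphic_on f U" and S: "open S" and "\<And>t. t \<in> S \<Longrightarrow> a + t *s b \<in> U"
  shows "(\<lambda>t. f (a + t *s b)) holomorphic_on S"
  unfolding holomorphic_on_open[OF S]
proof
  fix t assume t: "t \<in> S"
  obtain D where D: "(f has_derivative D) (at (a + t *s b))" "\<forall>c h. D (c *s h) = c * D h"
    by (rule mv_holomorphic_onD[OF f assms(3)[OF t]])
  have "((\<lambda>t. a + t *s b) has_derivative (\<lambda>h. h *s b)) (at t)"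
    by (rule has_derivative_vec_componentwise) (auto intro!: derivative_eq_intros)
  from has_derivative_compose[OF this D(1)]
  have "((\<lambda>t. f (a + t *s b)) has_field_derivative D b) (at t)"
    by (simp add: has_field_derivative_def D(2) mult.commute[of _ "D b"])
  then show "\<exists>f'. ((\<lambda>t. f (a + t *s b)) has_field_derivative f') (at t)" ..
qed

lemma vector3_eqs:
  "vector [x, y, z] = vector [0, y, z] + x *s (axis 1 1 :: complex^3)"
  "vector [x, y, z] = vector [x, 0, z] + y *s (axis 2 1 :: complex^3)"
  "vector [x, y, z] = vector [x, y, 0] + z *s (axis 3 1 :: complex^3)"
  by (simp_all add: vec_eq_iff forall_3 axis_def)

lemma mem_polydisc3: "x \<in> polydisc R \<longleftrightarrow> norm (x $ 1) < R \<and> norm (x $ 2) < R \<and> norm (x $ 3) < R"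
  by (simp add: polydisc_def forall_3)

lemma vector3_eta: "vector [x $ 1, x $ 2, x $ 3] = (x :: complex^3)"
  by (simp add: vec_eq_iff forall_3)

section \<open>Taylor expansion and division by the third coordinate\<close>

definition taylor3 :: "(complex^3 \<Rightarrow> complex) \<Rightarrow> nat \<times> nat \<times> nat \<Rightarrow> complex" where
  "taylor3 f = tcoef3 (\<lambda>x y z. f (vector [x, y, z]))"

text \<open>Frechet holomorphy gives holomorphy along lines parallel to the axes. Together with the
  uniform bound \<open>M\<close>, this is all that the iterated one-variable expansion asks
  for.\<close>

lemma taylor3:
  assumes f: "mv_holomorphic_on f (polydisc S)" and M: "\<And>x. x \<in> polydisc S \<Longrightarrow> norm (f x) \<le> M"
    and R: "0 < R" "R < S"
  shows geo_bounded_taylor3: "geo_bounded M R (taylor3 f)"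
    and tseries_taylor3: "x \<in> polydisc R \<Longrightarrow> tseries (taylor3 f) x = f x"
proof -
  have h: "(\<lambda>x. f (vector [x, y, z])) holomorphic_on ball 0 S" if "norm y < S" "norm z < S" for y z
    using mv_holomorphic_on_slice[OF f open_ball, of 0 S "vector [0, y, z]" "axis 1 1"] that
    unfolding vector3_eqs(1)[symmetric] by (simp add: mem_polydisc3)
  have h': "(\<lambda>y. f (vector [x, y, z])) holomorphic_on ball 0 S" if "norm x < S" "norm z < S" for x z
    using mv_holomorphic_on_slice[OF f open_ball, of 0 S "vector [x, 0, z]" "axis 2 1"] that
    unfolding vector3_eqs(2)[symmetric] by (simp add: mem_polydisc3)
  have h'': "(\<lambda>z. f (vector [x, y, z])) holomorphic_on ball 0 S" if "norm x < S" "norm y < S" for x y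
    using mv_holomorphic_on_slice[OF f open_ball, of 0 S "vector [x, y, 0]" "axis 3 1"] that
    unfolding vector3_eqs(3)[symmetric] by (simp add: mem_polydisc3)
  have b: "norm (f (vector [x, y, z])) \<le> M" if "norm x < S" "norm y < S" "norm z < S" for x y z
    by (rule M) (use that in \<open>simp add: mem_polydisc3\<close>)
  show "geo_bounded M R (taylor3 f)"
    unfolding geo_bounded_def taylor3_def using norm_tcoef3_le[OF h h' h'' b R] by blast
  show "tseries (taylor3 f) x = f x" if "x \<in> polydisc R"
    unfolding tseries_def taylor3_def
    using tcoef3_has_sum[OF h h' h'' b R, of "x $ 1" "x $ 2" "x $ 3"] that
    by (intro infsumI) (simp add: mem_polydisc3 vector3_eta)
qed

lemma bounded_on_smaller_polydisc:
  assumes f: "continuous_on (polydisc S) f" and "R < S"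
  obtains M where "\<And>x. x \<in> polydisc R \<Longrightarrow> norm (f x :: complex) \<le> M"
proof -
  let ?C = "{x :: complex^3. \<forall>m. x $ m \<in> cball 0 R}"
  have "closed ?C" by (rule closed_vector_box) auto
  moreover have "bounded ?C"
  proof (rule boundedI)
    fix x :: "complex^3" assume "x \<in> ?C"
    then have "norm (x $ m) \<le> R" for m by simp
    then have "norm (x $ 1) + norm (x $ 2) + norm (x $ 3) \<le> R + R + R" by (intro add_mono)
    then show "norm x \<le> R + R + R" using norm_vec3_le[of x] by linarith
  qed
  ultimately have "compact ?C" by (simp add: compact_eq_bounded_closed)
  moreover have "continuous_on ?C f"
  proof (rule continuous_on_subset[OF f], rule subsetI)
    fix x :: "complex^3" assume "x \<in> ?C"
    then have "norm (x $ m) \<le> R" for m by simp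
    then show "x \<in> polydisc S"
      unfolding polydisc_def using \<open>R < S\<close> by (auto intro: le_less_trans)
  qed
  ultimately have "bounded (f ` ?C)" using compact_continuous_image compact_imp_bounded by blast
  then obtain M where "\<And>y. y \<in> f ` ?C \<Longrightarrow> norm y \<le> M" unfolding bounded_iff by blast
  then show thesis by (intro that[of M]) (auto simp: polydisc_def less_imp_le)
qed

text \<open>The disjunction covers two situations at once: a series free of the third variable on
  the whole third axis, and an arbitrary series at the origin.\<close>

lemma tseries_axis3:
  assumes "x $ 1 = 0" "x $ 2 = 0" "\<And>k. k > 0 \<Longrightarrow> c (0, 0, k) = 0 \<or> x $ 3 = 0"
  shows "tseries c x = c (0, 0, 0)"
proof -
  have "tseries c x = (\<Sum>\<^sub>\<infinity>\<beta>\<in>{(0, 0, 0)}. c \<beta>)"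
    unfolding tseries_def
  proof (rule infsum_cong_neutral)
    fix \<beta> :: "nat \<times> nat \<times> nat" assume "\<beta> \<in> UNIV - {(0, 0, 0)}"
    moreover obtain i j k where "\<beta> = (i, j, k)" by (cases \<beta>)
    ultimately show "(case \<beta> of (i, j, k) \<Rightarrow> c (i, j, k) * (x $ 1 ^ i * x $ 2 ^ j * x $ 3 ^ k)) = 0"
      using assms by (auto simp: power_0_left)
  qed auto
  then show ?thesis by simp
qed

text \<open>Vanishing on the plane kills every coefficient with third exponent \<open>0\<close>, so
  the quotient is the series with that exponent shifted by one; its value at the origin is the
  coefficient of \<open>y3\<close>. The radii are \<open>s / 2\<close> for the bound,
  \<open>s / 4\<close> for the Cauchy estimates and \<open>s / 8\<close> for differentiating the
  quotient.\<close>

lemma division_by_third_coordinate: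
  assumes f: "mv_holomorphic_on f (polydisc s)" and "s > 0"
    and zero: "\<And>x. x $ 3 = 0 \<Longrightarrow> f x = 0"
  obtains \<psi> where "mv_holomorphic_on \<psi> (polydisc (s / 8))"
    "\<And>x. x \<in> polydisc (s / 8) \<Longrightarrow> f x = x $ 3 * \<psi> x"
    "\<psi> 0 = deriv (\<lambda>z. f (vector [0, 0, z])) 0"
proof -
  obtain M where M: "\<And>x. x \<in> polydisc (s / 2) \<Longrightarrow> norm (f x) \<le> M"
    using bounded_on_smaller_polydisc[OF mv_holomorphic_on_imp_continuous_on[OF f], of "s / 2"] \<open>s > 0\<close> by auto
  have f2: "mv_holomorphic_on f (polydisc (s / 2))"
    by (rule mv_holomorphic_on_subset[OF f open_polydisc polydisc_mono]) (use \<open>s > 0\<close> in simp)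
  define R where "R = s / 4"
  have R: "0 < R" "R < s / 2" using \<open>s > 0\<close> by (simp_all add: R_def)
  define c where "c = taylor3 f"
  have c: "geo_bounded M R c" and fc: "\<And>x. x \<in> polydisc R \<Longrightarrow> tseries c x = f x"
    unfolding c_def using taylor3[OF f2 M R] by blast+
  have c0: "c (i, j, 0) = 0" for i j
    by (simp add: c_def taylor3_def tcoef3_def zero)
  define d where "d = (\<lambda>(i, j, k). c (i, j, Suc k))"
  have d: "geo_bounded (M / R) R d"
    unfolding geo_bounded_def
  proof (intro allI)
    fix i j k
    have "norm (c (i, j, Suc k)) \<le> M / R ^ (i + j + Suc k)" using c unfolding geo_bounded_def by blast
    then show "norm (d (i, j, k)) \<le> M / R / R ^ (i + j + k)" by (simp add: d_def)
  qed
  show thesis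
  proof (rule that)
    show "mv_holomorphic_on (tseries d) (polydisc (s / 8))"
      using mv_holomorphic_on_tseries[OF d R(1)] by (simp add: R_def)
    show "tseries d 0 = deriv (\<lambda>z. f (vector [0, 0, z])) 0"
      using tseries_axis3[of 0 d] by (simp add: d_def c_def taylor3_def tcoef3_def tcoef_1)
    fix x :: "complex^3" assume "x \<in> polydisc (s / 8)"
    then have x: "x \<in> polydisc R" using polydisc_mono[of "s / 8" R] \<open>s > 0\<close> by (auto simp: R_def)
    let ?h = "\<lambda>(i :: nat, j :: nat, k :: nat). (i, j, Suc k)"
    let ?f = "\<lambda>(i, j, k). c (i, j, k) * (x $ 1 ^ i * x $ 2 ^ j * x $ 3 ^ k)"
    have inj: "inj ?h" by (auto simp: inj_def)
    have "((\<lambda>(i, j, k). x $ 3 * (d (i, j, k) * (x $ 1 ^ i * x $ 2 ^ j * x $ 3 ^ k))) has_sum x $ 3 * tseries d x) UNIV"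
      using has_sum_cmult_right[OF tseries_has_sum[OF d x], of "x $ 3"] by (simp add: case_prod_unfold)
    moreover have "(\<lambda>(i, j, k). x $ 3 * (d (i, j, k) * (x $ 1 ^ i * x $ 2 ^ j * x $ 3 ^ k))) = ?f \<circ> ?h"
      by (auto simp: fun_eq_iff d_def)
    ultimately have "(?f has_sum x $ 3 * tseries d x) (range ?h)"
      unfolding has_sum_reindex[OF inj] by simp
    moreover have "?f \<beta> = 0" if "\<beta> \<notin> range ?h" for \<beta>
    proof -
      obtain i j k where b: "\<beta> = (i, j, k)" by (cases \<beta>)
      have "k = 0" using that unfolding b by (cases k) (force simp: image_iff)+
      then show ?thesis by (simp add: b c0)
    qed
    then have "(?f has_sum t) (range ?h) \<longleftrightarrow> (?f has_sum t) UNIV" for t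
      by (intro has_sum_cong_neutral) auto
    ultimately have "(?f has_sum x $ 3 * tseries d x) UNIV" by simp
    with tseries_has_sum[OF c x] have "tseries c x = x $ 3 * tseries d x" by (rule has_sum_unique)
    then show "f x = x $ 3 * tseries d x" using fc[OF x] by simp
  qed
qed

section \<open>Vector fields with diagonal linear part\<close>

definition eigen3 :: "complex \<Rightarrow> complex \<Rightarrow> 3 \<Rightarrow> complex" where
  "eigen3 l1 l2 m = (if m = 1 then l1 else if m = 2 then l2 else 0)"

lemma eigen3_simps [simp]: "eigen3 l1 l2 1 = l1" "eigen3 l1 l2 2 = l2" "eigen3 l1 l2 3 = 0"
  by (simp_all add: eigen3_def)

lemma deriv_slice:
  fixes f :: "complex^'n \<Rightarrow> complex"
  assumes D: "(f has_derivative D) (at 0)" and lin: "\<And>c h. D (c *s h) = c * D h"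
  shows "((\<lambda>t. f (t *s b)) has_field_derivative D b) (at 0)"
proof -
  have "((\<lambda>t. t *s b) has_derivative (\<lambda>h. h *s b)) (at (0 :: complex))"
    by (rule has_derivative_vec_componentwise) (auto intro!: derivative_eq_intros)
  from has_derivative_compose[of _ _ 0 UNIV f D, OF this] D
  have "((\<lambda>t. f (t *s b)) has_derivative (\<lambda>h. D (h *s b))) (at 0)" by simp
  then show ?thesis by (simp add: has_field_derivative_def lin mult.commute[of _ "D b"])
qed

text \<open>Only four exponents have degree below 2, so the two series differ by a finite
  sum.\<close>

lemma tseries_split_low_order:
  assumes a: "geo_bounded M R a" and x: "x \<in> polydisc R" and "a (0, 0, 0) = 0"
  shows "tseries a x = a (1, 0, 0) * x $ 1 + a (0, 1, 0) * x $ 2 + a (0, 0, 1) * x $ 3 +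
    tseries (\<lambda>\<beta>. if deg3 \<beta> < 2 then 0 else a \<beta>) x"
proof -
  define c where "c = (\<lambda>\<beta>. if deg3 \<beta> < 2 then 0 else a \<beta>)"
  have M: "0 \<le> M" by (rule geo_bounded_nonneg[OF a])
  have R: "0 < R" using x by (auto simp: mem_polydisc3 intro: le_less_trans[OF norm_ge_zero])
  have c: "geo_bounded M R c"
    using a M R by (auto simp: geo_bounded_def c_def)
  let ?m = "\<lambda>(i, j, k). x $ 1 ^ i * x $ 2 ^ j * x $ 3 ^ k"
  let ?T = "{(1, 0, 0), (0, 1, 0), (0, 0, 1), (0, 0, 0)} :: (nat \<times> nat \<times> nat) set"
  have T: "\<beta> \<in> ?T" if "deg3 \<beta> < 2" for \<beta>
  proof -
    obtain i j k where b: "\<beta> = (i, j, k)" by (cases \<beta>)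
    with that have "i + j + k < 2" by (simp add: deg3_def)
    then have "i = 0 \<and> j = 0 \<and> k = 0 \<or> i = 1 \<and> j = 0 \<and> k = 0 \<or> i = 0 \<and> j = 1 \<and> k = 0 \<or> i = 0 \<and> j = 0 \<and> k = 1"
      by linarith
    then show ?thesis by (auto simp: b)
  qed
  have "((\<lambda>\<beta>. (case \<beta> of (i, j, k) \<Rightarrow> a (i, j, k) * (x $ 1 ^ i * x $ 2 ^ j * x $ 3 ^ k)) -
        (case \<beta> of (i, j, k) \<Rightarrow> c (i, j, k) * (x $ 1 ^ i * x $ 2 ^ j * x $ 3 ^ k))) has_sum tseries a x - tseries c x) UNIV"
    by (rule has_sum_diff[OF tseries_has_sum[OF a x] tseries_has_sum[OF c x]])
  moreover have "(case \<beta> of (i, j, k) \<Rightarrow> a (i, j, k) * (x $ 1 ^ i * x $ 2 ^ j * x $ 3 ^ k)) -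
        (case \<beta> of (i, j, k) \<Rightarrow> c (i, j, k) * (x $ 1 ^ i * x $ 2 ^ j * x $ 3 ^ k)) = (a \<beta> - c \<beta>) * ?m \<beta>" for \<beta>
    by (simp add: case_prod_unfold left_diff_distrib)
  ultimately have "((\<lambda>\<beta>. (a \<beta> - c \<beta>) * ?m \<beta>) has_sum tseries a x - tseries c x) UNIV" by simp
  moreover have "((\<lambda>\<beta>. (a \<beta> - c \<beta>) * ?m \<beta>) has_sum (\<Sum>\<beta>\<in>?T. (a \<beta> - c \<beta>) * ?m \<beta>)) ?T"
    by (rule has_sum_finite) simp
  then have "((\<lambda>\<beta>. (a \<beta> - c \<beta>) * ?m \<beta>) has_sum (\<Sum>\<beta>\<in>?T. (a \<beta> - c \<beta>) * ?m \<beta>)) UNIV"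
    by (subst has_sum_cong_neutral[where S = UNIV and T = ?T and g = "\<lambda>\<beta>. (a \<beta> - c \<beta>) * ?m \<beta>"])
      (use T in \<open>auto simp: c_def\<close>)
  ultimately have "tseries a x - tseries c x = (\<Sum>\<beta>\<in>?T. (a \<beta> - c \<beta>) * ?m \<beta>)"
    by (rule has_sum_unique)
  also have "\<dots> = a (1, 0, 0) * x $ 1 + a (0, 1, 0) * x $ 2 + a (0, 0, 1) * x $ 3"
    using assms(3) by (simp add: c_def deg3_def)
  finally show ?thesis by (simp add: c_def diff_eq_eq)
qed

text \<open>The radii descend from 3: boundedness at \<open>5/2\<close>, Cauchy estimates at 2, and
  the degree-weighted sum at 1. The last radius matches the substituted algebra elements, which have
  norm at most 1.\<close>

lemma linear_plus_nonlinear: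
  fixes f :: "complex^3 \<Rightarrow> complex"
  assumes f: "mv_holomorphic_on f (polydisc 3)" and f0: "f 0 = 0"
    and Df: "(f has_derivative (\<lambda>h. l * h $ m)) (at 0)"
  obtains c where "nonlinear_coeffs c"
    "\<And>x. x \<in> polydisc 2 \<Longrightarrow> f x = l * x $ m + tseries c x"
proof -
  obtain M where M: "\<And>x. x \<in> polydisc (5/2) \<Longrightarrow> norm (f x) \<le> M"
    by (rule bounded_on_smaller_polydisc[OF mv_holomorphic_on_imp_continuous_on[OF f], of "5/2"]) auto
  have f2: "mv_holomorphic_on f (polydisc (5/2))"
    by (rule mv_holomorphic_on_subset[OF f open_polydisc polydisc_mono]) simp
  define a where "a = taylor3 f"
  have a: "geo_bounded M 2 a" and fa: "\<And>x. x \<in> polydisc 2 \<Longrightarrow> tseries a x = f x"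
    unfolding a_def using taylor3[OF f2 M, of 2] by auto
  have v0: "vector [0, 0, 0] = (0 :: complex^3)" by (simp add: vec_eq_iff forall_3)
  have v1: "vector [t, 0, 0] = t *s (axis 1 1 :: complex^3)" "vector [0, t, 0] = t *s (axis 2 1 :: complex^3)"
    "vector [0, 0, t] = t *s (axis 3 1 :: complex^3)" for t
    by (simp_all add: vec_eq_iff forall_3 axis_def)
  have d: "deriv (\<lambda>t. f (t *s b)) 0 = l * b $ m" for b
    by (rule DERIV_imp_deriv[OF deriv_slice[OF Df]]) simp
  have a0: "a (0, 0, 0) = 0" "a (1, 0, 0) = l * axis 1 1 $ m" "a (0, 1, 0) = l * axis 2 1 $ m" "a (0, 0, 1) = l * axis 3 1 $ m"
    using v0 f0 by (simp_all add: a_def taylor3_def tcoef3_def tcoef_1 v1 d)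
  define c where "c = (\<lambda>\<beta>. if deg3 \<beta> < 2 then 0 else a \<beta>)"
  have c: "geo_bounded M 2 c"
    using a geo_bounded_nonneg[OF a] by (auto simp: geo_bounded_def c_def)
  show thesis
  proof (rule that)
    show "nonlinear_coeffs c"
    proof
      show "c \<beta> = 0" if "deg3 \<beta> < 2" for \<beta> using that by (simp add: c_def)
      have s: "(\<lambda>(i, j, k). norm (c (i, j, k)) * ((real (i + j + k))\<^sup>2 * 1 ^ (i + j + k))) summable_on UNIV"
        by (rule summable_weighted(1)[OF c]) auto
      show "(\<lambda>\<beta>. norm (c \<beta>) * real (deg3 \<beta>)) summable_on UNIV"
      proof (rule summable_on_comparison_test[OF s])
        fix \<beta> :: "nat \<times> nat \<times> nat"
        obtain i j k where b: "\<beta> = (i, j, k)" by (cases \<beta>)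
        have "real n \<le> (real n)\<^sup>2" for n by (cases n) (auto simp: power2_eq_square)
        from mult_left_mono[OF this[of "i + j + k"], of "norm (c (i, j, k))"]
        show "norm (c \<beta>) * real (deg3 \<beta>) \<le> (case \<beta> of (i, j, k) \<Rightarrow> norm (c (i, j, k)) * ((real (i + j + k))\<^sup>2 * 1 ^ (i + j + k)))"
          by (simp add: b deg3_def)
      qed auto
    qed
    fix x :: "complex^3" assume x: "x \<in> polydisc 2"
    have "l * axis 1 1 $ m * x $ 1 + l * axis 2 1 $ m * x $ 2 + l * axis 3 1 $ m * x $ 3 = l * x $ m"
      using exhaust_3[of m] by (auto simp: axis_def)
    moreover have "tseries a x = l * axis 1 1 $ m * x $ 1 + l * axis 2 1 $ m * x $ 2 + l * axis 3 1 $ m * x $ 3 + tseries c x"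
      unfolding c_def a0(2-4)[symmetric] by (rule tseries_split_low_order[OF a x a0(1)])
    ultimately show "f x = l * x $ m + tseries c x" using fa[OF x] by simp
  qed
qed

text \<open>Translates the fixed point into functions: \<open>g\<close> is the parametrization,
  \<open>g1\<close> and \<open>g2\<close> are its partial derivatives. The statements on the axis
  hold for every \<open>y $ 3\<close> because the series are free of the third variable.\<close>

lemma invariant_manifold_chart:
  fixes X :: "complex^3 \<Rightarrow> complex^3"
  assumes X: "\<And>m. mv_holomorphic_on (\<lambda>x. X x $ m) (polydisc 3)" and X0: "X 0 = 0"
    and DX: "\<And>m. ((\<lambda>x. X x $ m) has_derivative (\<lambda>h. eigen3 l1 l2 m * h $ m)) (at 0)"
    and e: "0 < e" "\<And>m i j. i + j \<ge> 2 \<Longrightarrow> e \<le> norm (of_nat i * l1 + of_nat j * l2 - eigen3 l1 l2 m)"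
  obtains r :: real and g g1 g2 :: "3 \<Rightarrow> complex^3 \<Rightarrow> complex" where "r > 0"
    "\<And>m y. y \<in> polydisc (1/2) \<Longrightarrow> (g m has_derivative (\<lambda>h. g1 m y * h $ 1 + g2 m y * h $ 2)) (at y)"
    "\<And>m. mv_holomorphic_on (g1 m) (polydisc (1/4))" "\<And>m. mv_holomorphic_on (g2 m) (polydisc (1/4))"
    "\<And>m y. y \<in> polydisc (1/2) \<Longrightarrow> norm (g m y) \<le> 1"
    "\<And>m y. y $ 1 = 0 \<Longrightarrow> y $ 2 = 0 \<Longrightarrow> g m y = 0"
    "\<And>m y. y $ 1 = 0 \<Longrightarrow> y $ 2 = 0 \<Longrightarrow> g1 m y = (if m = 1 then of_real r else 0)"
    "\<And>m y. y $ 1 = 0 \<Longrightarrow> y $ 2 = 0 \<Longrightarrow> g2 m y = (if m = 2 then of_real r else 0)"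
    "\<And>m y. y \<in> polydisc (1/2) \<Longrightarrow> l1 * y $ 1 * g1 m y + l2 * y $ 2 * g2 m y = X (\<chi> m. g m y) $ m"
proof -
  have "\<exists>c. nonlinear_coeffs c \<and> (\<forall>x\<in>polydisc 2. X x $ m = eigen3 l1 l2 m * x $ m + tseries c x)" for m
  proof -
    have "X 0 $ m = 0" by (simp add: X0)
    show ?thesis
    proof (rule linear_plus_nonlinear[OF X \<open>X 0 $ m = 0\<close> DX])
      fix c assume "nonlinear_coeffs c" "\<And>x. x \<in> polydisc 2 \<Longrightarrow> X x $ m = eigen3 l1 l2 m * x $ m + tseries c x"
      then show ?thesis by (intro exI[of _ c]) simp
    qed
  qed
  then have "\<forall>m. \<exists>c. nonlinear_coeffs c \<and> (\<forall>x\<in>polydisc 2. X x $ m = eigen3 l1 l2 m * x $ m + tseries c x)" ..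
  then obtain c where
    cX: "\<forall>m. nonlinear_coeffs (c m) \<and> (\<forall>x\<in>polydisc 2. X x $ m = eigen3 l1 l2 m * x $ m + tseries (c m) x)"
    by (rule exE[OF choice])
  have c: "nonlinear_coeffs (c m)" for m using cX by simp
  have Xc: "X x $ m = eigen3 l1 l2 m * x $ m + tseries (c m) x" if "x \<in> polydisc 2" for m x
    using cX that by simp
  obtain r :: real and G where r: "0 < r"
    and "\<forall>m. norm (G $ m) \<le> 1 \<and> coef2 (G $ m) 0 0 = 0 \<and>
      coef2 (G $ m) 1 0 = (if m = 1 then of_real r else 0) \<and>
      coef2 (G $ m) 0 1 = (if m = 2 then of_real r else 0) \<and>
      (\<forall>i j. (of_nat i * l1 + of_nat j * l2 - eigen3 l1 l2 m) * coef2 (G $ m) i j = coef2 (subst3 (c m) G) i j)"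
    using invariant_manifold_series[where c = c and L = "eigen3 l1 l2" and e = e, OF c e(1) e(2) eigen3_simps(1,2)]
    by blast
  then have G: "norm (G $ m) \<le> 1" and G00: "coef2 (G $ m) 0 0 = 0"
    and G10: "coef2 (G $ m) 1 0 = (if m = 1 then of_real r else 0)"
    and G01: "coef2 (G $ m) 0 1 = (if m = 2 then of_real r else 0)"
    and eq: "(of_nat i * l1 + of_nat j * l2 - eigen3 l1 l2 m) * coef2 (G $ m) i j = coef2 (subst3 (c m) G) i j" for m i j
    by blast+
  define a where "a m = coef3_of (G $ m)" for m
  have a: "geo_bounded 1 1 (a m)" for m unfolding a_def by (rule geo_bounded_coef3_of[OF G])
  note d = geo_bounded_dcoef[OF a, simplified]
  have d3: "tseries (dcoef3 (a m)) y = 0" for m y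
    by (simp add: tseries_def dcoef3_def a_def coef3_of_def case_prod_unfold)
  have half: "norm (y $ m) \<le> 1" if "y \<in> polydisc (1/2)" for y :: "complex^3" and m
  proof -
    have "norm (y $ m) < 1/2" using that by (simp add: polydisc_def)
    then show ?thesis by simp
  qed
  have norm_g: "norm (tseries (a m) y) \<le> 1" if "y \<in> polydisc (1/2)" for m y
    unfolding a_def tseries_coef3_of[OF half[OF that] half[OF that]]
    by (rule order.trans[OF norm_eval2_le[OF half[OF that] half[OF that]] G])
  show thesis
  proof (rule that[where r = r and g = "\<lambda>m. tseries (a m)" and ?g1.0 = "\<lambda>m. tseries (dcoef1 (a m))" and ?g2.0 = "\<lambda>m. tseries (dcoef2 (a m))"])
    show "0 < r" by (rule r)
    show "(tseries (a m) has_derivative (\<lambda>h. tseries (dcoef1 (a m)) y * h $ 1 + tseries (dcoef2 (a m)) y * h $ 2)) (at y)"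
      if "y \<in> polydisc (1/2)" for m y
      using has_derivative_tseries[OF a _ that] by (simp add: d3)
    show "mv_holomorphic_on (tseries (dcoef1 (a m))) (polydisc (1/4))" for m
      using mv_holomorphic_on_tseries[OF d(1)[of m]] by simp
    show "mv_holomorphic_on (tseries (dcoef2 (a m))) (polydisc (1/4))" for m
      using mv_holomorphic_on_tseries[OF d(2)[of m]] by simp
    fix m and y :: "complex^3"
    show "norm (tseries (a m) y) \<le> 1" if "y \<in> polydisc (1/2)" by (rule norm_g[OF that])
    show "tseries (a m) y = 0" if "y $ 1 = 0" "y $ 2 = 0"
      using tseries_axis3[OF that, of "a m"] by (simp add: a_def coef3_of_def G00)
    show "tseries (dcoef1 (a m)) y = (if m = 1 then of_real r else 0)" if "y $ 1 = 0" "y $ 2 = 0"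
      using tseries_axis3[OF that, of "dcoef1 (a m)"] G10[of m] by (simp add: a_def dcoef1_def coef3_of_def)
    show "tseries (dcoef2 (a m)) y = (if m = 2 then of_real r else 0)" if "y $ 1 = 0" "y $ 2 = 0"
      using tseries_axis3[OF that, of "dcoef2 (a m)"] G01[of m] by (simp add: a_def dcoef2_def coef3_of_def)
    assume y: "y \<in> polydisc (1/2)"
    have "norm (tseries (a m) y) < 2" for m using norm_g[OF y, of m] by simp
    then have "(\<chi> m. tseries (a m) y) \<in> polydisc 2" by (simp add: polydisc_def)
    then show "l1 * y $ 1 * tseries (dcoef1 (a m)) y + l2 * y $ 2 * tseries (dcoef2 (a m)) y = X (\<chi> m. tseries (a m) y) $ m"
      using invariance_equation[OF c G eq y, of m] by (simp add: Xc a_def)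
  qed
qed

text \<open>The conclusion of the theorem as a predicate, so that it can be established for a
  rescaled field with diagonal linear part and then carried back by a linear change of
  coordinates.\<close>

definition has_normal_form ::
    "(complex^3 \<Rightarrow> complex^3) \<Rightarrow> (complex^3) set \<Rightarrow> complex \<Rightarrow> complex \<Rightarrow> bool" where
  "has_normal_form X U l1 l2 \<longleftrightarrow> (\<exists>\<Phi> V W \<psi>1 \<psi>2 H.
           V \<subseteq> U \<and> local_biholomorphism \<Phi> V W \<and>
           mv_holomorphic_on \<psi>1 W \<and> mv_holomorphic_on \<psi>2 W \<and> mv_holomorphic_on H W \<and>
           \<psi>1 0 = 0 \<and> \<psi>2 0 = 0 \<and> H 0 = 0 \<and>
           expressed_in_coordinates X \<Phi> V (normal_form l1 l2 \<psi>1 \<psi>2 H) \<and>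
           invariant_subspace_on (normal_form l1 l2 \<psi>1 \<psi>2 H) W {y. y $ 3 = 0})"

lemma invariant_subspace_on_normal_form:
  "invariant_subspace_on (normal_form l1 l2 \<psi>1 \<psi>2 H) W {y. y $ 3 = 0}"
  by (simp add: invariant_subspace_on_def normal_form_def)

lemma polydisc_subset_open:
  assumes "open S" "0 \<in> S"
  obtains s where "s > 0" "polydisc s \<subseteq> S"
proof -
  obtain e where e: "e > 0" "ball 0 e \<subseteq> S" using assms open_contains_ball by blast
  have "polydisc (e / 3) \<subseteq> ball 0 e"
  proof
    fix x :: "complex^3" assume "x \<in> polydisc (e / 3)"
    then have "norm (x $ 1) + norm (x $ 2) + norm (x $ 3) < e" by (simp add: mem_polydisc3)
    then show "x \<in> ball 0 e" using norm_vec3_le[of x] by simp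
  qed
  with e show thesis by (intro that[of "e / 3"]) auto
qed

text \<open>The inverse function theorem gives a real-differentiable inverse whose derivative is
  \<open>inv (DQ y)\<close>. The explicit two-sided inverse \<open>E y\<close> identifies that
  derivative and makes it complex-linear. All radii \<open>t \<le> s\<close> share one
  \<open>\<Phi>\<close>, so the target can later be shrunk to the polydisc on which the quotients by
  \<open>y3\<close> exist.\<close>

lemma local_inverse_of_holomorphic_map:
  fixes Q :: "complex^3 \<Rightarrow> complex^3"
  assumes U: "open U" "0 \<in> U" and Q0: "Q 0 = 0"
    and DQ: "\<And>y. y \<in> U \<Longrightarrow> (Q has_derivative DQ y) (at y)"
    and contDQ: "\<And>h. continuous_on U (\<lambda>y. DQ y h)"
    and lin: "\<And>y c h. y \<in> U \<Longrightarrow> E y (c *s h) = c *s E y h"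
    and ED: "\<And>y h. y \<in> U \<Longrightarrow> E y (DQ y h) = h" and DE: "\<And>y h. y \<in> U \<Longrightarrow> DQ y (E y h) = h"
  shows "\<exists>s \<Phi>. 0 < s \<and> polydisc s \<subseteq> U \<and>
    (\<forall>t. 0 < t \<and> t \<le> s \<longrightarrow> local_biholomorphism \<Phi> (Q ` polydisc t) (polydisc t)) \<and>
    (\<forall>y\<in>polydisc s. \<Phi> (Q y) = y \<and> frechet_derivative \<Phi> (at (Q y)) = E y)"
proof -
  have bl: "bounded_linear (DQ y)" if "y \<in> U" for y
    using DQ[OF that] by (rule has_derivative_bounded_linear)
  have app: "blinfun_apply (Blinfun (DQ y)) = DQ y" if "y \<in> U" for y
    using bl[OF that] by (rule bounded_linear_Blinfun_apply)
  have inv_DQ: "inv (DQ y) = E y" if "y \<in> U" for y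
    using ED[OF that] DE[OF that] by (rule inv_equality)
  have linD: "DQ y (c *s h) = c *s DQ y h" if "y \<in> U" for y c h
    using lin[OF that, of c "DQ y h"] ED[OF that] DE[OF that, of "c *s DQ y h"] by simp
  have blE: "bounded_linear (E 0)"
  proof (rule linear_conv_bounded_linear[THEN iffD1])
    have l: "linear (DQ 0)" using bl[OF U(2)] by (rule bounded_linear.linear)
    show "linear (E 0)"
    proof (rule linearI)
      fix a b and r :: real
      have "DQ 0 (E 0 a + E 0 b) = a + b" "DQ 0 (r *\<^sub>R E 0 a) = r *\<^sub>R a"
        by (simp_all add: linear_add[OF l] linear_scale[OF l] DE[OF U(2)])
      then show "E 0 (a + b) = E 0 a + E 0 b" "E 0 (r *\<^sub>R a) = r *\<^sub>R E 0 a"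
        using ED[OF U(2), of "E 0 a + E 0 b"] ED[OF U(2), of "r *\<^sub>R E 0 a"] by simp_all
    qed
  qed
  have invf: "Blinfun (E 0) o\<^sub>L Blinfun (DQ 0) = id_blinfun"
    by (rule blinfun_eqI) (simp add: app[OF U(2)] bounded_linear_Blinfun_apply[OF blE] ED[OF U(2)])
  have contf: "continuous_on U (\<lambda>y. Blinfun (DQ y))"
  proof (rule continuous_on_blinfun_componentwise)
    show "continuous_on U (\<lambda>y. Blinfun (DQ y) i)" for i
      using contDQ[of i] by (rule continuous_on_eq) (simp add: app)
  qed
  have "\<exists>U' V \<Phi>. open U' \<and> U' \<subseteq> U \<and> 0 \<in> U' \<and> open V \<and> homeomorphism U' V Q \<Phi> \<and>
    (\<forall>x\<in>V. (\<Phi> has_derivative inv (blinfun_apply (Blinfun (DQ (\<Phi> x))))) (at x))"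
  proof (rule inverse_function_theorem[of U Q "\<lambda>y. Blinfun (DQ y)" 0 "Blinfun (E 0)"])
    show "(Q has_derivative blinfun_apply (Blinfun (DQ y))) (at y)" if "y \<in> U" for y
      using DQ[OF that] by (simp add: app[OF that])
    fix U' V \<Phi> \<Phi>'
    assume "open U'" "U' \<subseteq> U" "0 \<in> U'" "open V" "homeomorphism U' V Q \<Phi>"
      and der: "\<And>x. x \<in> V \<Longrightarrow> (\<Phi> has_derivative \<Phi>' x) (at x)"
      and der': "\<And>x. x \<in> V \<Longrightarrow> \<Phi>' x = inv (blinfun_apply (Blinfun (DQ (\<Phi> x))))"
    moreover have "\<forall>x\<in>V. (\<Phi> has_derivative inv (blinfun_apply (Blinfun (DQ (\<Phi> x))))) (at x)"
      using der der' by simp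
    ultimately show ?thesis by blast
  qed (use U contf invf in auto)
  then obtain U' V \<Phi> where U': "open U'" "U' \<subseteq> U" "0 \<in> U'" and V: "open V"
    and hom: "homeomorphism U' V Q \<Phi>"
    and der: "\<forall>x\<in>V. (\<Phi> has_derivative inv (blinfun_apply (Blinfun (DQ (\<Phi> x))))) (at x)"
    by blast
  obtain s where s: "s > 0" "polydisc s \<subseteq> U'"
    using polydisc_subset_open[OF U'(1,3)] .
  have inU: "y \<in> U" if "y \<in> U'" for y using that U'(2) by blast
  have QV: "Q y \<in> V" if "y \<in> U'" for y using hom that by (auto simp: homeomorphism_def)
  have \<Phi>Q: "\<Phi> (Q y) = y" if "y \<in> U'" for y using hom that by (auto simp: homeomorphism_def)
  have D\<Phi>: "(\<Phi> has_derivative E y) (at (Q y))" if "y \<in> U'" for y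
    using bspec[OF der QV[OF that]] by (simp add: \<Phi>Q[OF that] app[OF inU[OF that]] inv_DQ[OF inU[OF that]])
  show ?thesis
  proof (rule exI[of _ s], rule exI[of _ \<Phi>], intro conjI allI ballI impI)
    show "s > 0" by (rule s(1))
    show "polydisc s \<subseteq> U" using s(2) U'(2) by blast
    show "\<Phi> (Q y) = y" if "y \<in> polydisc s" for y using \<Phi>Q s(2) that by blast
    show "frechet_derivative \<Phi> (at (Q y)) = E y" if "y \<in> polydisc s" for y
    proof -
      have "y \<in> U'" using s(2) that by blast
      then show ?thesis using frechet_derivative_at[OF D\<Phi>] by simp
    qed
    fix t :: real assume "0 < t \<and> t \<le> s"
    then have t: "0 < t" "t \<le> s" by auto
    have tU: "polydisc t \<subseteq> U'" using polydisc_mono[OF t(2)] s(2) by blast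
    have "openin (top_of_set V) (Q ` polydisc t)"
      by (rule homeomorphism_imp_open_map[OF hom]) (use tU open_polydisc in \<open>simp add: openin_open_eq[OF U'(1)]\<close>)
    then have oV: "open (Q ` polydisc t)" using V openin_open_trans by blast
    have inj: "inj_on Q (polydisc t)" by (rule inj_on_inverseI[of _ \<Phi>]) (use \<Phi>Q tU in blast)
    have bij: "bij_betw \<Phi> (Q ` polydisc t) (polydisc t)"
      by (rule bij_betwI[of _ _ _ Q]) (use \<Phi>Q tU in auto)
    have hol\<Phi>: "holomorphic_map_on \<Phi> (Q ` polydisc t)"
      unfolding holomorphic_map_on_iff
    proof (intro conjI oV ballI)
      fix z assume "z \<in> Q ` polydisc t"
      then obtain y where y: "z = Q y" "y \<in> U'" using tU by blast
      show "\<exists>D. (\<Phi> has_derivative D) (at z) \<and> (\<forall>c h. D (c *s h) = c *s D h)"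
        unfolding y(1) by (rule exI, rule conjI, rule D\<Phi>[OF y(2)]) (simp add: lin inU[OF y(2)])
    qed
    have inv: "inv_into (Q ` polydisc t) \<Phi> y = Q y" if "y \<in> polydisc t" for y
      by (rule inv_into_f_eq[OF bij_betw_imp_inj_on[OF bij]]) (use that \<Phi>Q tU in auto)
    have holQ: "holomorphic_map_on (inv_into (Q ` polydisc t) \<Phi>) (polydisc t)"
      unfolding holomorphic_map_on_iff
    proof (intro conjI open_polydisc ballI)
      fix y assume y: "y \<in> polydisc t"
      then have yU: "y \<in> U" using tU U'(2) by blast
      have "(inv_into (Q ` polydisc t) \<Phi> has_derivative DQ y) (at y)"
        by (rule has_derivative_transform_within_open[OF DQ[OF yU] open_polydisc y]) (simp add: inv)
      then show "\<exists>D. (inv_into (Q ` polydisc t) \<Phi> has_derivative D) (at y) \<and> (\<forall>c h. D (c *s h) = c *s D h)"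
        by - (rule exI, rule conjI, assumption, simp add: linD[OF yU])
    qed
    have "0 \<in> polydisc t" using t(1) by (rule zero_in_polydisc)
    moreover have "0 \<in> Q ` polydisc t" using imageI[OF calculation, of Q] by (simp add: Q0)
    moreover have "\<Phi> 0 = 0" using \<Phi>Q[OF U'(3)] by (simp add: Q0)
    ultimately show "local_biholomorphism \<Phi> (Q ` polydisc t) (polydisc t)"
      using oV bij hol\<Phi> holQ by (simp add: local_biholomorphism_def open_polydisc)
  qed
qed

lemma cramer2:
  fixes a b c d x y :: complex
  assumes "a * d - b * c \<noteq> 0"
  shows "(d * (a * x + b * y) - b * (c * x + d * y)) / (a * d - b * c) = x"
    and "(a * (c * x + d * y) - c * (a * x + b * y)) / (a * d - b * c) = y"
    and "a * ((d * x - b * y) / (a * d - b * c)) + b * ((a * y - c * x) / (a * d - b * c)) = x"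
    and "c * ((d * x - b * y) / (a * d - b * c)) + d * ((a * y - c * x) / (a * d - b * c)) = y"
proof -
  have 1: "d * (a * x + b * y) - b * (c * x + d * y) = x * (a * d - b * c)"
    and 2: "a * (c * x + d * y) - c * (a * x + b * y) = y * (a * d - b * c)"
    and 3: "a * (d * x - b * y) + b * (a * y - c * x) = x * (a * d - b * c)"
    and 4: "c * (d * x - b * y) + d * (a * y - c * x) = y * (a * d - b * c)"
    by (simp_all add: algebra_simps)
  show "(d * (a * x + b * y) - b * (c * x + d * y)) / (a * d - b * c) = x"
    "(a * (c * x + d * y) - c * (a * x + b * y)) / (a * d - b * c) = y"
    unfolding 1 2 using assms by simp_all
  show "a * ((d * x - b * y) / (a * d - b * c)) + b * ((a * y - c * x) / (a * d - b * c)) = x"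
    unfolding times_divide_eq_right add_divide_distrib[symmetric] 3 using assms by simp
  show "c * ((d * x - b * y) / (a * d - b * c)) + d * ((a * y - c * x) / (a * d - b * c)) = y"
    unfolding times_divide_eq_right add_divide_distrib[symmetric] 4 using assms by simp
qed

lemma normal_form_from_chart:
  fixes X :: "complex^3 \<Rightarrow> complex^3" and g g1 g2 :: "3 \<Rightarrow> complex^3 \<Rightarrow> complex" and r :: real
  assumes X: "\<And>m. mv_holomorphic_on (\<lambda>x. X x $ m) (polydisc 3)"
    and DX: "\<And>m. ((\<lambda>x. X x $ m) has_derivative (\<lambda>h. eigen3 l1 l2 m * h $ m)) (at 0)"
    and r: "r > 0"
    and gd: "\<And>m y. y \<in> polydisc (1/2) \<Longrightarrow> (g m has_derivative (\<lambda>h. g1 m y * h $ 1 + g2 m y * h $ 2)) (at y)"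
    and g1: "\<And>m. mv_holomorphic_on (g1 m) (polydisc (1/4))"
    and g2: "\<And>m. mv_holomorphic_on (g2 m) (polydisc (1/4))"
    and gn: "\<And>m y. y \<in> polydisc (1/2) \<Longrightarrow> norm (g m y) \<le> 1"
    and g_axis: "\<And>m y. y $ 1 = 0 \<Longrightarrow> y $ 2 = 0 \<Longrightarrow> g m y = 0"
    and g1_axis: "\<And>m y. y $ 1 = 0 \<Longrightarrow> y $ 2 = 0 \<Longrightarrow> g1 m y = (if m = 1 then of_real r else 0)"
    and g2_axis: "\<And>m y. y $ 1 = 0 \<Longrightarrow> y $ 2 = 0 \<Longrightarrow> g2 m y = (if m = 2 then of_real r else 0)"
    and eq: "\<And>m y. y \<in> polydisc (1/2) \<Longrightarrow> l1 * y $ 1 * g1 m y + l2 * y $ 2 * g2 m y = X (\<chi> m. g m y) $ m"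
  shows "has_normal_form X (polydisc 3) l1 l2"
proof -
  define Q :: "complex^3 \<Rightarrow> complex^3" where "Q y = (\<chi> m. g m y + (if m = 3 then y $ 3 else 0))" for y
  define DQ :: "complex^3 \<Rightarrow> complex^3 \<Rightarrow> complex^3" where
    "DQ y h = (\<chi> m. g1 m y * h $ 1 + g2 m y * h $ 2 + (if m = 3 then h $ 3 else 0))" for y h
  \<comment> \<open>The third column of \<open>DQ\<close> is the third basis vector, so its
    determinant is the upper left minor \<open>J\<close>. The inverse \<open>E\<close> is Cramer's
    rule for that minor, followed by back substitution in the third component.\<close>
  define J where "J y = g1 1 y * g2 2 y - g2 1 y * g1 2 y" for y
  define E1 where "E1 y h = (g2 2 y * h $ 1 - g2 1 y * h $ 2) / J y" for y and h :: "complex^3"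
  define E2 where "E2 y h = (g1 1 y * h $ 2 - g1 2 y * h $ 1) / J y" for y and h :: "complex^3"
  define E3 where "E3 y h = h $ 3 - (g1 3 y * E1 y h + g2 3 y * E2 y h)" for y and h :: "complex^3"
  define E :: "complex^3 \<Rightarrow> complex^3 \<Rightarrow> complex^3" where "E y h = vector [E1 y h, E2 y h, E3 y h]" for y h
  define U where "U = {y \<in> polydisc (1/4). J y \<noteq> 0}"
  have sub: "y \<in> polydisc (1/2)" if "y \<in> polydisc (1/4)" for y
    using that polydisc_mono[of "1/4" "1/2"] by auto
  have Jhol: "mv_holomorphic_on J (polydisc (1/4))"
    unfolding J_def by (intro mv_holomorphic_on_diff mv_holomorphic_on_mult g1 g2)
  have Uopen: "open U"
  proof -
    have "open (polydisc (1/4) \<inter> J -` (- {0}))"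
      by (rule continuous_open_preimage[OF mv_holomorphic_on_imp_continuous_on[OF Jhol] open_polydisc]) auto
    also have "polydisc (1/4) \<inter> J -` (- {0}) = U" by (auto simp: U_def)
    finally show ?thesis .
  qed
  have J_axis: "J y = of_real r * of_real r" if "y $ 1 = 0" "y $ 2 = 0" for y
    by (simp add: J_def g1_axis[OF that] g2_axis[OF that])
  have U0: "0 \<in> U" using r by (simp add: U_def J_axis mem_polydisc3)
  have Q0: "Q 0 = 0" by (simp add: Q_def g_axis vec_eq_iff)
  have DQ: "(Q has_derivative DQ y) (at y)" if "y \<in> U" for y
  proof (rule has_derivative_vec_componentwise)
    fix m :: 3
    have "y \<in> polydisc (1/2)" using that by (simp add: U_def sub)
    note d = gd[OF this, of m]
    show "((\<lambda>x. Q x $ m) has_derivative (\<lambda>h. DQ y h $ m)) (at y)"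
    proof (cases "m = 3")
      case True
      have "((\<lambda>x. g m x + x $ 3) has_derivative (\<lambda>h. g1 m y * h $ 1 + g2 m y * h $ 2 + h $ 3)) (at y)"
        by (rule has_derivative_add[OF d bounded_linear_imp_has_derivative[OF bounded_linear_vec_nth]])
      then show ?thesis using True by (simp add: Q_def DQ_def)
    next
      case False
      then show ?thesis using d by (simp add: Q_def DQ_def)
    qed
  qed
  have subU: "U \<subseteq> polydisc (1/4)" by (auto simp: U_def)
  have contg: "continuous_on U (g1 m)" "continuous_on U (g2 m)" for m
    using mv_holomorphic_on_imp_continuous_on[OF g1] mv_holomorphic_on_imp_continuous_on[OF g2]
      continuous_on_subset subU by blast+
  have contDQ: "continuous_on U (\<lambda>y. DQ y h)" for h
    unfolding DQ_def by (intro continuous_on_vec_lambda continuous_intros contg)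
  have linE: "E y (c *s h) = c *s E y h" for y c h
  proof -
    have 1: "E1 y (c *s h) = c * E1 y h" and 2: "E2 y (c *s h) = c * E2 y h"
      by (simp_all add: E1_def E2_def right_diff_distrib mult.left_commute[of c])
    have 3: "E3 y (c *s h) = c * E3 y h"
      by (simp add: E3_def 1 2 algebra_simps)
    show ?thesis by (simp add: E_def 1 2 3 vec_eq_iff forall_3)
  qed
  have Jne: "g1 1 y * g2 2 y - g2 1 y * g1 2 y \<noteq> 0" if "y \<in> U" for y using that by (simp add: U_def J_def)
  have ED: "E y (DQ y h) = h" if "y \<in> U" for y h
  proof -
    note c = cramer2(1,2)[OF Jne[OF that], folded J_def]
    have 1: "E1 y (DQ y h) = h $ 1" and 2: "E2 y (DQ y h) = h $ 2"
      unfolding E1_def E2_def using c by (simp_all add: DQ_def)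
    have 3: "E3 y (DQ y h) = h $ 3" by (simp add: E3_def 1 2) (simp add: DQ_def)
    show ?thesis by (simp add: E_def 1 2 3 vec_eq_iff forall_3)
  qed
  have DE: "DQ y (E y h) = h" if "y \<in> U" for y h
  proof -
    note c = cramer2(3,4)[OF Jne[OF that], folded J_def, of "h $ 1" "h $ 2"]
    have "g1 1 y * E1 y h + g2 1 y * E2 y h = h $ 1" "g1 2 y * E1 y h + g2 2 y * E2 y h = h $ 2"
      unfolding E1_def E2_def by (rule c)+
    moreover have "g1 3 y * E1 y h + g2 3 y * E2 y h + E3 y h = h $ 3" by (simp add: E3_def)
    ultimately show ?thesis by (simp add: DQ_def E_def vec_eq_iff forall_3)
  qed
  have "\<exists>s \<Phi>. 0 < s \<and> polydisc s \<subseteq> U \<and>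
    (\<forall>t. 0 < t \<and> t \<le> s \<longrightarrow> local_biholomorphism \<Phi> (Q ` polydisc t) (polydisc t)) \<and>
    (\<forall>y\<in>polydisc s. \<Phi> (Q y) = y \<and> frechet_derivative \<Phi> (at (Q y)) = E y)"
    by (rule local_inverse_of_holomorphic_map[OF Uopen U0 Q0 DQ contDQ linE ED DE])
  then obtain s \<Phi> where s: "0 < s" "polydisc s \<subseteq> U"
    and bih: "\<forall>t. 0 < t \<and> t \<le> s \<longrightarrow> local_biholomorphism \<Phi> (Q ` polydisc t) (polydisc t)"
    and \<Phi>: "\<forall>y\<in>polydisc s. \<Phi> (Q y) = y \<and> frechet_derivative \<Phi> (at (Q y)) = E y"
    by blast
  have s4: "y \<in> polydisc (1/4)" if "y \<in> polydisc s" for y using that s(2) subU by blast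
  have Q3: "Q y \<in> polydisc 3" if "y \<in> polydisc s" for y
    unfolding polydisc_def
  proof (intro CollectI allI)
    fix m :: 3
    have "norm (y $ 3) < 1/4" using s4[OF that] by (simp add: mem_polydisc3)
    then have "norm (if m = 3 then y $ 3 else 0) < 1/4" by simp
    then show "norm (Q y $ m) < 3"
      using gn[OF sub[OF s4[OF that]], of m] norm_triangle_ineq[of "g m y" "if m = 3 then y $ 3 else 0"]
      by (simp only: Q_def vec_lambda_beta)
  qed
  have holQ: "holomorphic_map_on Q (polydisc s)"
    unfolding holomorphic_map_on_iff
  proof (intro conjI open_polydisc ballI)
    fix y assume "y \<in> polydisc s"
    then have y: "y \<in> U" using s(2) by blast
    have "DQ y (c *s h) = c *s DQ y h" for c h by (simp add: DQ_def vec_eq_iff algebra_simps)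
    with DQ[OF y] show "\<exists>D. (Q has_derivative D) (at y) \<and> (\<forall>c h. D (c *s h) = c *s D h)" by blast
  qed
  have XQ: "mv_holomorphic_on (\<lambda>y. X (Q y) $ m) (polydisc s)" for m
    by (rule mv_holomorphic_on_compose[OF holQ X]) (use Q3 in blast)
  have ps: "polydisc s \<subseteq> polydisc (1/4)" using s4 by blast
  note g1s = mv_holomorphic_on_subset[OF g1 open_polydisc ps]
  note g2s = mv_holomorphic_on_subset[OF g2 open_polydisc ps]
  note Js = mv_holomorphic_on_subset[OF Jhol open_polydisc ps]
  have Jne': "J y \<noteq> 0" if "y \<in> polydisc s" for y using that s(2) by (auto simp: U_def)
  have Y1: "mv_holomorphic_on (\<lambda>y. E1 y (X (Q y))) (polydisc s)"
    and Y2: "mv_holomorphic_on (\<lambda>y. E2 y (X (Q y))) (polydisc s)"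
    unfolding E1_def E2_def
    by (intro mv_holomorphic_on_divide mv_holomorphic_on_diff mv_holomorphic_on_mult g1s g2s XQ Js; rule Jne'; assumption)+
  have Y3: "mv_holomorphic_on (\<lambda>y. E3 y (X (Q y))) (polydisc s)"
    unfolding E3_def by (intro mv_holomorphic_on_diff mv_holomorphic_on_add mv_holomorphic_on_mult g1s g2s XQ Y1 Y2)
  have Y: "mv_holomorphic_on (\<lambda>y. E y (X (Q y)) $ m) (polydisc s)" for m
    using exhaust_3[of m] Y1 Y2 Y3 by (auto simp: E_def)
  \<comment> \<open>Extended by \<open>0\<close> outside the polydisc, because
    \<open>division_by_third_coordinate\<close> asks for vanishing on the entire plane
    \<open>y $ 3 = 0\<close>.\<close>
  define Z where "Z m y = (if y \<in> polydisc s then E y (X (Q y)) $ m - eigen3 l1 l2 m * y $ m else 0)" for m y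
  have Zhol: "mv_holomorphic_on (Z m) (polydisc s)" for m
  proof (rule mv_holomorphic_on_cong)
    show "mv_holomorphic_on (\<lambda>y. E y (X (Q y)) $ m - eigen3 l1 l2 m * y $ m) (polydisc s)"
      by (intro mv_holomorphic_on_diff mv_holomorphic_on_mult mv_holomorphic_on_const mv_holomorphic_on_nth open_polydisc Y)
  qed (simp add: Z_def)
  have Zzero: "Z m y = 0" if "y $ 3 = 0" for m y
  proof (cases "y \<in> polydisc s")
    case True
    define v :: "complex^3" where "v = (\<chi> m. eigen3 l1 l2 m * y $ m)"
    have "Q y = (\<chi> m. g m y)" using that by (simp add: Q_def vec_eq_iff)
    then have "X (Q y) $ m = DQ y v $ m" for m
      using eq[OF sub[OF s4[OF True]], of m] that by (simp add: DQ_def v_def mult_ac)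
    then have "X (Q y) = DQ y v" by (simp add: vec_eq_iff)
    then have "E y (X (Q y)) = v" using ED[of y v] True s(2) by auto
    then show ?thesis by (simp add: Z_def v_def)
  qed (simp add: Z_def)
  have dZ: "deriv (\<lambda>z. Z m (vector [0, 0, z])) 0 = 0" for m
  proof -
    \<comment> \<open>On the third axis \<open>DQ\<close> is the diagonal matrix with entries
      \<open>r\<close>, \<open>r\<close>, 1; \<open>k\<close> is the corresponding entry of its
      inverse.\<close>
    define k where "k = (if m = 3 then 1 else 1 / of_real r :: complex)"
    have ax: "vector [0, 0, z] = z *s (axis 3 1 :: complex^3)" for z
      by (simp add: vec_eq_iff forall_3 axis_def)
    have ev: "k * X (z *s axis 3 1) $ m = Z m (vector [0, 0, z])" if "z \<in> ball 0 s" for z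
    proof -
      let ?y = "vector [0, 0, z] :: complex^3"
      have y: "?y \<in> polydisc s" using that s(1) by (simp add: mem_polydisc3)
      have "Q ?y = ?y" by (simp add: Q_def g_axis vec_eq_iff forall_3)
      moreover have "eigen3 l1 l2 m * ?y $ m = 0" using exhaust_3[of m] by auto
      moreover have "E ?y h $ m = k * h $ m" for h
        using exhaust_3[of m] r by (auto simp: E_def E1_def E2_def E3_def k_def J_axis g1_axis g2_axis)
      ultimately show ?thesis using y by (simp add: Z_def ax)
    qed
    have "((\<lambda>z. X (z *s axis 3 1) $ m) has_field_derivative eigen3 l1 l2 m * axis 3 1 $ m) (at 0)"
      by (rule deriv_slice[OF DX]) simp
    moreover have "eigen3 l1 l2 m * axis 3 1 $ m = 0" using exhaust_3[of m] by (auto simp: axis_def)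
    ultimately have "((\<lambda>z. k * X (z *s axis 3 1) $ m) has_field_derivative k * 0) (at 0)"
      by (intro DERIV_cmult) simp
    then have "((\<lambda>z. Z m (vector [0, 0, z])) has_field_derivative k * 0) (at 0)"
      by (rule has_field_derivative_transform_within_open[OF _ open_ball[of 0 s]]) (use s(1) ev in auto)
    then show ?thesis by (simp add: DERIV_imp_deriv)
  qed
  have "\<forall>m. \<exists>\<psi>. mv_holomorphic_on \<psi> (polydisc (s / 8)) \<and>
     (\<forall>y\<in>polydisc (s / 8). Z m y = y $ 3 * \<psi> y) \<and> \<psi> 0 = 0"
  proof
    fix m
    show "\<exists>\<psi>. mv_holomorphic_on \<psi> (polydisc (s / 8)) \<and>
     (\<forall>y\<in>polydisc (s / 8). Z m y = y $ 3 * \<psi> y) \<and> \<psi> 0 = 0"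
    proof (rule division_by_third_coordinate[OF Zhol s(1)])
      fix \<psi> assume "mv_holomorphic_on \<psi> (polydisc (s / 8))"
        "\<And>y. y \<in> polydisc (s / 8) \<Longrightarrow> Z m y = y $ 3 * \<psi> y" "\<psi> 0 = deriv (\<lambda>z. Z m (vector [0, 0, z])) 0"
      then show ?thesis by (intro exI[of _ \<psi>]) (simp add: dZ)
    qed (rule Zzero)
  qed
  then obtain \<psi> where \<psi>: "\<forall>m. mv_holomorphic_on (\<psi> m) (polydisc (s / 8)) \<and>
     (\<forall>y\<in>polydisc (s / 8). Z m y = y $ 3 * \<psi> m y) \<and> \<psi> m 0 = 0"
    by (rule exE[OF choice])
  have s8: "y \<in> polydisc s" if "y \<in> polydisc (s / 8)" for y
    using that polydisc_mono[of "s / 8" s] s(1) by auto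
  have nf: "normal_form l1 l2 (\<psi> 1) (\<psi> 2) (\<psi> 3) y = E y (X (Q y))" if y: "y \<in> polydisc (s / 8)" for y
  proof -
    have "eigen3 l1 l2 m * y $ m + y $ 3 * \<psi> m y = E y (X (Q y)) $ m" for m
    proof -
      have "Z m y = y $ 3 * \<psi> m y" using \<psi> y by blast
      then show ?thesis using s8[OF y] by (simp add: Z_def algebra_simps)
    qed
    from this[of 1] this[of 2] this[of 3] show ?thesis
      by (simp add: normal_form_def vec_eq_iff forall_3)
  qed
  show ?thesis
    unfolding has_normal_form_def
  proof (intro exI conjI)
    show "Q ` polydisc (s / 8) \<subseteq> polydisc 3" using Q3 s8 by blast
    show "local_biholomorphism \<Phi> (Q ` polydisc (s / 8)) (polydisc (s / 8))" using bih s(1) by simp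
    show "mv_holomorphic_on (\<psi> 1) (polydisc (s / 8))" "mv_holomorphic_on (\<psi> 2) (polydisc (s / 8))"
      "mv_holomorphic_on (\<psi> 3) (polydisc (s / 8))" "\<psi> 1 0 = 0" "\<psi> 2 0 = 0" "\<psi> 3 0 = 0"
      using \<psi> by blast+
    show "expressed_in_coordinates X \<Phi> (Q ` polydisc (s / 8)) (normal_form l1 l2 (\<psi> 1) (\<psi> 2) (\<psi> 3))"
      unfolding expressed_in_coordinates_def
    proof
      fix x assume "x \<in> Q ` polydisc (s / 8)"
      then obtain y where y: "x = Q y" "y \<in> polydisc (s / 8)" by blast
      then show "normal_form l1 l2 (\<psi> 1) (\<psi> 2) (\<psi> 3) (\<Phi> x) = frechet_derivative \<Phi> (at x) (X x)"
        using \<Phi> s8[OF y(2)] by (simp add: nf)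
    qed
    show "invariant_subspace_on (normal_form l1 l2 (\<psi> 1) (\<psi> 2) (\<psi> 3)) (polydisc (s / 8)) {y. y $ 3 = 0}"
      by (rule invariant_subspace_on_normal_form)
  qed
qed

lemma normal_form_diagonal_linear_part:
  fixes X :: "complex^3 \<Rightarrow> complex^3"
  assumes X: "\<And>m. mv_holomorphic_on (\<lambda>x. X x $ m) (polydisc 3)" and X0: "X 0 = 0"
    and DX: "\<And>m. ((\<lambda>x. X x $ m) has_derivative (\<lambda>h. eigen3 l1 l2 m * h $ m)) (at 0)"
    and res: "\<not> satisfies_resonance l1 l2" and poinc: "in_poincare_domain l1 l2"
  shows "has_normal_form X (polydisc 3) l1 l2"
proof -
  have ne: "eigen3 l1 l2 m \<noteq> of_nat i * l1 + of_nat j * l2" if "i + j \<ge> 2" for m and i j :: nat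
  proof (cases "m = 3")
    \<comment> \<open>The third component has the divisor \<open>i * l1 + j * l2\<close>. It is
      nonzero by the Poincare condition; nonresonance concerns only the first two
      components.\<close>
    case True
    obtain d where "d > 0" and d: "\<And>i j :: nat. d * real (i + j) \<le> norm (of_nat i * l1 + of_nat j * l2)"
      using in_poincare_domain_lower_bound[OF poinc] by blast
    then have "0 < d * real (i + j)" using that by simp
    then have "0 < norm (of_nat i * l1 + of_nat j * l2)" using d[of i j] by linarith
    then show ?thesis using True by auto
  next
    case False
    then have "m = 1 \<or> m = 2" using exhaust_3[of m] by auto
    then show ?thesis using res that unfolding satisfies_resonance_def by auto
  qed
  have "\<exists>e>0. \<forall>i j :: nat. i + j \<ge> 2 \<longrightarrow> e \<le> norm (of_nat i * l1 + of_nat j * l2 - eigen3 l1 l2 m)" for m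
  proof (rule small_divisor_bound[OF poinc, of "eigen3 l1 l2 m"])
    show "eigen3 l1 l2 m \<noteq> of_nat i * l1 + of_nat j * l2" if "i + j \<ge> 2" for i j :: nat
      by (rule ne[OF that])
    fix e :: real
    assume "e > 0" "\<And>i j :: nat. i + j \<ge> 2 \<Longrightarrow> e \<le> norm (of_nat i * l1 + of_nat j * l2 - eigen3 l1 l2 m)"
    then show ?thesis by (intro exI[of _ e]) simp
  qed
  then have "\<forall>m. \<exists>e>0. \<forall>i j :: nat. i + j \<ge> 2 \<longrightarrow> e \<le> norm (of_nat i * l1 + of_nat j * l2 - eigen3 l1 l2 m)" ..
  then obtain e where e: "\<forall>m. 0 < e m \<and> (\<forall>i j :: nat. i + j \<ge> 2 \<longrightarrow> e m \<le> norm (of_nat i * l1 + of_nat j * l2 - eigen3 l1 l2 m))"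
    by (rule exE[OF choice])
  define e0 where "e0 = Min (range e)"
  have e0: "0 < e0" unfolding e0_def using e by (subst Min_gr_iff) auto
  have e1: "e0 \<le> norm (of_nat i * l1 + of_nat j * l2 - eigen3 l1 l2 m)" if "i + j \<ge> 2" for m and i j :: nat
  proof -
    have "e0 \<le> e m" unfolding e0_def by (rule Min_le) auto
    also have "\<dots> \<le> norm (of_nat i * l1 + of_nat j * l2 - eigen3 l1 l2 m)" using e that by blast
    finally show ?thesis .
  qed
  show ?thesis
  proof (rule invariant_manifold_chart[OF X X0 DX e0])
    show "e0 \<le> norm (of_nat i * l1 + of_nat j * l2 - eigen3 l1 l2 m)" if "i + j \<ge> 2" for m and i j :: nat
      by (rule e1[OF that])
    fix r :: real and g g1 g2 :: "3 \<Rightarrow> complex^3 \<Rightarrow> complex"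
    assume h: "r > 0"
      "\<And>m y. y \<in> polydisc (1/2) \<Longrightarrow> (g m has_derivative (\<lambda>h. g1 m y * h $ 1 + g2 m y * h $ 2)) (at y)"
      "\<And>m. mv_holomorphic_on (g1 m) (polydisc (1/4))"
      "\<And>m. mv_holomorphic_on (g2 m) (polydisc (1/4))"
      "\<And>m y. y \<in> polydisc (1/2) \<Longrightarrow> norm (g m y) \<le> 1"
      "\<And>m y. y $ 1 = 0 \<Longrightarrow> y $ 2 = 0 \<Longrightarrow> g m y = 0"
      "\<And>m y. y $ 1 = 0 \<Longrightarrow> y $ 2 = 0 \<Longrightarrow> g1 m y = (if m = 1 then of_real r else 0)"
      "\<And>m y. y $ 1 = 0 \<Longrightarrow> y $ 2 = 0 \<Longrightarrow> g2 m y = (if m = 2 then of_real r else 0)"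
      "\<And>m y. y \<in> polydisc (1/2) \<Longrightarrow> l1 * y $ 1 * g1 m y + l2 * y $ 2 * g2 m y = X (\<chi> m. g m y) $ m"
    show "has_normal_form X (polydisc 3) l1 l2"
      by (rule normal_form_from_chart[where r = r and g = g and ?g1.0 = g1 and ?g2.0 = g2, OF X DX])
        (rule h; assumption)+
  qed
qed

section \<open>Reduction to diagonal linear part\<close>

lemma bounded_linear_matrix_vector_mult: "bounded_linear (\<lambda>x. (A :: complex^'n^'m) *v x)"
proof (rule linear_conv_bounded_linear[THEN iffD1], rule linearI)
  show "A *v (r *\<^sub>R x) = r *\<^sub>R (A *v x)" for r x
    by (simp add: vec_eq_iff matrix_vector_mult_def scaleR_sum_right)
qed (simp add: matrix_vector_right_distrib)

lemma matrix_vector_mult_smult: "(A :: complex^'n^'m) *v (c *s x) = c *s (A *v x)"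
  by (simp add: vec_eq_iff matrix_vector_mult_def sum_distrib_left mult_ac)

text \<open>The new chart is \<open>\<Phi>\<close> composed with \<open>Ti\<close>, defined on the
  image of \<open>V\<close> under \<open>T\<close>. The target \<open>W\<close> and the functions of
  the normal form do not change.\<close>

lemma has_normal_form_linear_change:
  assumes T: "bounded_linear T" "\<And>c h. T (c *s h) = c *s T h"
    and Ti: "bounded_linear Ti" "\<And>c h. Ti (c *s h) = c *s Ti h"
    and TTi: "\<And>x. T (Ti x) = x" and TiT: "\<And>x. Ti (T x) = x"
    and sub: "T ` D \<subseteq> U"
    and nf: "has_normal_form (\<lambda>x. Ti (X (T x))) D l1 l2"
  shows "has_normal_form X U l1 l2"
proof -
  obtain \<Phi> V W \<psi>1 \<psi>2 H where VD: "V \<subseteq> D" and bih: "local_biholomorphism \<Phi> V W"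
    and \<psi>: "mv_holomorphic_on \<psi>1 W" "mv_holomorphic_on \<psi>2 W" "mv_holomorphic_on H W"
      "\<psi>1 0 = 0" "\<psi>2 0 = 0" "H 0 = 0"
    and ex: "expressed_in_coordinates (\<lambda>x. Ti (X (T x))) \<Phi> V (normal_form l1 l2 \<psi>1 \<psi>2 H)"
    using nf unfolding has_normal_form_def by blast
  note b = bih[unfolded local_biholomorphism_def]
  have oV: "open V" and bij: "bij_betw \<Phi> V W" and hol: "holomorphic_map_on \<Phi> V"
    and hol': "holomorphic_map_on (inv_into V \<Phi>) W" and \<Phi>0: "\<Phi> 0 = 0" and V0: "0 \<in> V"
    using b by auto
  have T0: "T 0 = 0" and Ti0: "Ti 0 = 0"
    using T(1) Ti(1) by (simp_all add: linear_0 bounded_linear.linear)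
  have img: "T ` V = Ti -` V" 
  proof (intro set_eqI iffI)
    show "x \<in> T ` V" if "x \<in> Ti -` V" for x
      using imageI[of "Ti x" V T] that by (simp add: TTi)
  qed (auto simp: TiT)
  have oTV: "open (T ` V)"
    unfolding img using linear_continuous_on[OF Ti(1), of UNIV] oV by (simp add: open_vimage)
  have der: "\<exists>E. (\<Phi> has_derivative E) (at (Ti x)) \<and> (\<forall>c h. E (c *s h) = c *s E h)" if "x \<in> T ` V" for x
    using hol that unfolding holomorphic_map_on_iff img by blast
  have der': "((\<lambda>x. \<Phi> (Ti x)) has_derivative (\<lambda>h. E (Ti h))) (at x)"
    if "(\<Phi> has_derivative E) (at (Ti x))" for E x
    by (rule has_derivative_compose[OF bounded_linear_imp_has_derivative[OF Ti(1)] that])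
  have bij': "bij_betw (\<lambda>x. \<Phi> (Ti x)) (T ` V) W"
  proof -
    have "bij_betw Ti (T ` V) V" by (rule bij_betwI[of _ _ _ T]) (use TTi TiT in auto)
    from bij_betw_trans[OF this bij] show ?thesis by (simp add: comp_def)
  qed
  have holc: "holomorphic_map_on (\<lambda>x. \<Phi> (Ti x)) (T ` V)"
    unfolding holomorphic_map_on_iff
  proof (intro conjI oTV ballI)
    fix x assume "x \<in> T ` V"
    from der[OF this] obtain E where E: "(\<Phi> has_derivative E) (at (Ti x))" "\<forall>c h. E (c *s h) = c *s E h" by blast
    show "\<exists>D. ((\<lambda>x. \<Phi> (Ti x)) has_derivative D) (at x) \<and> (\<forall>c h. D (c *s h) = c *s D h)"
      by (rule exI, rule conjI, rule der'[OF E(1)]) (simp add: Ti(2) E(2))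
  qed
  have inv: "inv_into (T ` V) (\<lambda>x. \<Phi> (Ti x)) y = T (inv_into V \<Phi> y)" if "y \<in> W" for y
  proof (rule inv_into_f_eq[OF bij_betw_imp_inj_on[OF bij']])
    have "y \<in> \<Phi> ` V" using that bij by (simp add: bij_betw_def)
    then show "T (inv_into V \<Phi> y) \<in> T ` V" "\<Phi> (Ti (T (inv_into V \<Phi> y))) = y"
      by (simp_all add: TiT inv_into_into f_inv_into_f)
  qed
  have holi: "holomorphic_map_on (inv_into (T ` V) (\<lambda>x. \<Phi> (Ti x))) W"
    unfolding holomorphic_map_on_iff
  proof (intro conjI ballI)
    show oW: "open W" using b by blast
    fix y assume y: "y \<in> W"
    then obtain E where E: "(inv_into V \<Phi> has_derivative E) (at y)" "\<forall>c h. E (c *s h) = c *s E h"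
      using hol' unfolding holomorphic_map_on_iff by blast
    have "((\<lambda>y. T (inv_into V \<Phi> y)) has_derivative (\<lambda>h. T (E h))) (at y)"
      by (rule bounded_linear.has_derivative[OF T(1) E(1)])
    then have "(inv_into (T ` V) (\<lambda>x. \<Phi> (Ti x)) has_derivative (\<lambda>h. T (E h))) (at y)"
      by (rule has_derivative_transform_within_open[OF _ oW y]) (simp add: inv)
    then show "\<exists>D. (inv_into (T ` V) (\<lambda>x. \<Phi> (Ti x)) has_derivative D) (at y) \<and> (\<forall>c h. D (c *s h) = c *s D h)"
      by - (rule exI, rule conjI, assumption, simp add: T(2) E(2))
  qed
  have bih': "local_biholomorphism (\<lambda>x. \<Phi> (Ti x)) (T ` V) W"
    unfolding local_biholomorphism_def
    using oTV bij' holc holi b imageI[OF V0, of T] T0 Ti0 \<Phi>0 by simp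
  have ex': "expressed_in_coordinates X (\<lambda>x. \<Phi> (Ti x)) (T ` V) (normal_form l1 l2 \<psi>1 \<psi>2 H)"
    unfolding expressed_in_coordinates_def
  proof
    fix x assume x: "x \<in> T ` V"
    from der[OF this] obtain E where E: "(\<Phi> has_derivative E) (at (Ti x))" by blast
    have "Ti x \<in> V" using x img by blast
    then have "normal_form l1 l2 \<psi>1 \<psi>2 H (\<Phi> (Ti x)) = frechet_derivative \<Phi> (at (Ti x)) (Ti (X (T (Ti x))))"
      using ex unfolding expressed_in_coordinates_def by blast
    also have "\<dots> = E (Ti (X x))" using frechet_derivative_at[OF E] by (simp add: TTi)
    also have "\<dots> = frechet_derivative (\<lambda>x. \<Phi> (Ti x)) (at x) (X x)"
      using frechet_derivative_at[OF der'[OF E]] by metis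
    finally show "normal_form l1 l2 \<psi>1 \<psi>2 H (\<Phi> (Ti x)) = frechet_derivative (\<lambda>x. \<Phi> (Ti x)) (at x) (X x)" .
  qed
  show ?thesis
    unfolding has_normal_form_def
  proof (intro exI conjI)
    show "T ` V \<subseteq> U" using VD sub by blast
  qed (rule bih' ex' \<psi> invariant_subspace_on_normal_form)+
qed

lemma eigenvector_exists:
  fixes A :: "complex^3^3"
  assumes "det (mat l - A) = 0"
  shows "\<exists>v. v \<noteq> 0 \<and> A *v v = l *s v"
proof -
  have "\<not> invertible (mat l - A)" using assms invertible_det_nz by blast
  then have "\<not> (\<forall>x. (mat l - A) *v x = 0 \<longrightarrow> x = 0)"
    using invertible_left_inverse matrix_left_invertible_ker by blast
  then obtain v where v: "v \<noteq> 0" "(mat l - A) *v v = 0" by blast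
  have "mat l *v v = l *s v"
    by (simp add: vec_eq_iff matrix_vector_mult_def mat_def if_distrib[of "\<lambda>x. x * _"] cong: if_cong)
  moreover have "mat l *v v = A *v v" using v(2) by (simp add: matrix_vector_mult_diff_rdistrib)
  ultimately show ?thesis using v(1) by metis
qed

lemma roots_with_double:
  fixes a b c l :: complex
  assumes "\<And>t. (t - a) * (t - b) * (t - c) = (t - l) * (t - l) * t" and l: "l \<noteq> 0"
  shows "a = l \<and> b = l \<and> c = 0 \<or> a = l \<and> c = l \<and> b = 0 \<or> b = l \<and> c = l \<and> a = 0"
proof -
  have 0: "a = 0 \<or> b = 0 \<or> c = 0" using assms(1)[of 0] by simp
  have a: "a = l \<or> a = 0" and b: "b = l \<or> b = 0" and c: "c = l \<or> c = 0"
    using assms(1)[of a] assms(1)[of b] assms(1)[of c] by auto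
  \<comment> \<open>Evaluation at \<open>2 * l\<close> excludes a single \<open>l\<close>
    accompanied by two zeros: that choice would give \<open>4 * l^3\<close> on the left.\<close>
  have 2: "(2 * l - a) * (2 * l - b) * (2 * l - c) = 2 * l * l * l"
    using assms(1)[of "2 * l"] by (simp add: mult_ac)
  have 1: "a = l \<or> b = l \<or> c = l" using assms(1)[of l] by auto
  show ?thesis using 0 1 2 a b c l by auto
qed

text \<open>If \<open>l1 \<noteq> l2\<close>, the numbers \<open>l1\<close>, \<open>l2\<close>,
  \<open>0\<close> are pairwise distinct, and applying \<open>A\<close> twice to a linear relation
  isolates the coefficient of \<open>v1\<close>. If \<open>l1 = l2\<close>, a diagonalizing matrix
  is given, but it may list the eigenvalues in any order, hence the permutations of its
  columns.\<close>

lemma eigenbasis3: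
  fixes A :: "complex^3^3"
  assumes ev: "eigenvalues3 A l1 l2 0" and l: "l1 \<noteq> 0" "l2 \<noteq> 0"
    and diag: "l1 = l2 \<Longrightarrow> diagonalizable A"
  shows "\<exists>v1 v2 v3. A *v v1 = l1 *s v1 \<and> A *v v2 = l2 *s v2 \<and> A *v v3 = 0 \<and>
    (\<forall>a b c. a *s v1 + b *s v2 + c *s v3 = 0 \<longrightarrow> a = 0 \<and> b = 0 \<and> c = 0)"
proof (cases "l1 = l2")
  case False
  have "det (mat t - A) = (t - l1) * (t - l2) * t" for t
    using ev by (simp add: eigenvalues3_def)
  then have d: "det (mat l1 - A) = 0" "det (mat l2 - A) = 0" "det (mat 0 - A) = 0"
    by (simp_all only: mult_zero_left mult_zero_right diff_self)
  obtain v1 where v1: "v1 \<noteq> 0" "A *v v1 = l1 *s v1" using eigenvector_exists[OF d(1)] by blast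
  obtain v2 where v2: "v2 \<noteq> 0" "A *v v2 = l2 *s v2" using eigenvector_exists[OF d(2)] by blast
  obtain v3 where v3: "v3 \<noteq> 0" "A *v v3 = 0 *s v3" using eigenvector_exists[OF d(3)] by blast
  note v = v1 v2 v3
  have A3: "A *v v3 = 0" using v(6) by simp
  have "a = 0 \<and> b = 0 \<and> c = 0" if s: "a *s v1 + b *s v2 + c *s v3 = 0" for a b c
  proof -
    have A1: "A *v (x *s v1 + y *s v2 + z *s v3) = (l1 * x) *s v1 + (l2 * y) *s v2 + 0 *s v3" for x y z
      by (simp add: matrix_vector_right_distrib matrix_vector_mult_smult v A3 vector_smult_assoc mult.commute)
    have s1: "(l1 * a) *s v1 + (l2 * b) *s v2 + 0 *s v3 = 0"
      using arg_cong[OF s, of "(*v) A"] unfolding A1 by simp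
    then have s2: "(l1 * (l1 * a)) *s v1 + (l2 * (l2 * b)) *s v2 + 0 *s v3 = 0"
      using arg_cong[OF s1, of "(*v) A"] unfolding A1 by simp
    have "(l1 * (l1 - l2) * a) *s v1 = ((l1 * (l1 * a)) *s v1 + (l2 * (l2 * b)) *s v2 + 0 *s v3)
        - l2 *s ((l1 * a) *s v1 + (l2 * b) *s v2 + 0 *s v3)"
      by (simp add: vec_eq_iff algebra_simps)
    then have "(l1 * (l1 - l2) * a) *s v1 = 0" by (simp only: s1 s2) simp
    then have a: "a = 0" using v(1) l False by simp
    moreover have b: "b = 0" using s1 a v(3) l by simp
    ultimately show ?thesis using s v(5) by simp
  qed
  then show ?thesis using v(2,4) A3 by blast
next
  case True
  then obtain P D :: "complex^3^3" where P: "invertible P" and D: "\<forall>i j. i \<noteq> j \<longrightarrow> D $ i $ j = 0"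
    and AP: "A ** P = P ** D" using diag unfolding diagonalizable_def by blast
  have Pk: "x = 0" if "P *v x = 0" for x
    using P that invertible_left_inverse matrix_left_invertible_ker by blast
  have detP: "det P \<noteq> 0" using P invertible_det_nz by blast
  \<comment> \<open>Similar matrices have the same characteristic polynomial, which determines the
    diagonal of \<open>D\<close> up to order.\<close>
  have dets: "det (mat t - A) = det (mat t - D)" for t
  proof -
    have "(mat t - A) ** P = P ** (mat t - D)"
    proof -
      have "(mat t ** P) $ i $ j = t * P $ i $ j" "(P ** mat t) $ i $ j = P $ i $ j * t" for i j
        by (simp_all add: matrix_matrix_mult_def mat_def mult_delta_left mult_delta_right)
      then have "mat t ** P = P ** mat t" by (simp add: vec_eq_iff mult.commute)
      moreover have "(mat t - A) ** P = mat t ** P - A ** P" "P ** (mat t - D) = P ** mat t - P ** D"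
        by (simp_all add: vec_eq_iff matrix_matrix_mult_def left_diff_distrib right_diff_distrib sum_subtractf)
      ultimately show ?thesis using AP by simp
    qed
    then have "det (mat t - A) * det P = det P * det (mat t - D)" by (simp only: det_mul[symmetric])
    then show ?thesis using detP by simp
  qed
  define d where "d i = D $ i $ i" for i
  have "(t - d 1) * (t - d 2) * (t - d 3) = (t - l1) * (t - l1) * t" for t
  proof -
    have "det (mat t - D) = (t - d 1) * (t - d 2) * (t - d 3)"
      using D by (simp add: det_3 mat_def d_def)
    then show ?thesis using dets[of t] ev True by (simp add: eigenvalues3_def)
  qed
  from roots_with_double[OF this l(1)]
  have cases: "d 1 = l1 \<and> d 2 = l1 \<and> d 3 = 0 \<or> d 1 = l1 \<and> d 3 = l1 \<and> d 2 = 0 \<or> d 2 = l1 \<and> d 3 = l1 \<and> d 1 = 0" .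
  define p where "p j = column j P" for j
  have Pp: "P *v x = x $ 1 *s p 1 + x $ 2 *s p 2 + x $ 3 *s p 3" for x
    by (simp add: vec_eq_iff matrix_vector_mult_def p_def column_def sum_3 mult.commute)
  have Ap: "A *v p j = d j *s p j" for j
  proof -
    have "A *v p j = column j (A ** P)"
      by (simp add: vec_eq_iff matrix_vector_mult_def p_def column_def matrix_matrix_mult_def)
    also have "\<dots> = column j (P ** D)" by (simp add: AP)
    also have "\<dots> = d j *s p j"
      using D exhaust_3[of j] by (auto simp: vec_eq_iff p_def column_def matrix_matrix_mult_def d_def sum_3 mult.commute)
    finally show ?thesis .
  qed
  have ind: "a = 0 \<and> b = 0 \<and> c = 0" if "a *s p 1 + b *s p 2 + c *s p 3 = 0" for a b c
    using Pk[of "vector [a, b, c]"] that unfolding Pp by (simp add: vec_eq_iff forall_3)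
  from cases show ?thesis
  proof (elim disjE)
    assume "d 1 = l1 \<and> d 2 = l1 \<and> d 3 = 0"
    then show ?thesis
      using ind Ap True by (intro exI[of _ "p 1"] exI[of _ "p 2"] exI[of _ "p 3"]) auto
  next
    assume h: "d 1 = l1 \<and> d 3 = l1 \<and> d 2 = 0"
    have "a = 0 \<and> b = 0 \<and> c = 0" if "a *s p 1 + b *s p 3 + c *s p 2 = 0" for a b c
      using ind[of a c b] that by (simp add: add_ac)
    with h show ?thesis
      using Ap True by (intro exI[of _ "p 1"] exI[of _ "p 3"] exI[of _ "p 2"]) auto
  next
    assume h: "d 2 = l1 \<and> d 3 = l1 \<and> d 1 = 0"
    have "a = 0 \<and> b = 0 \<and> c = 0" if "a *s p 2 + b *s p 3 + c *s p 1 = 0" for a b c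
      using ind[of c a b] that by (simp add: add_ac)
    with h show ?thesis
      using Ap True by (intro exI[of _ "p 2"] exI[of _ "p 3"] exI[of _ "p 1"]) auto
  qed
qed

lemma diagonalizing_matrix3:
  fixes A :: "complex^3^3"
  assumes "eigenvalues3 A l1 l2 0" "l1 \<noteq> 0" "l2 \<noteq> 0" "l1 = l2 \<Longrightarrow> diagonalizable A"
  shows "\<exists>P Pi :: complex^3^3. (\<forall>x. P *v (Pi *v x) = x \<and> Pi *v (P *v x) = x) \<and>
    (\<forall>h. A *v (P *v h) = P *v (\<chi> m. eigen3 l1 l2 m * h $ m))"
proof -
  obtain v1 v2 v3 where v: "A *v v1 = l1 *s v1" "A *v v2 = l2 *s v2" "A *v v3 = 0"
    and ind: "\<forall>a b c. a *s v1 + b *s v2 + c *s v3 = 0 \<longrightarrow> a = 0 \<and> b = 0 \<and> c = 0"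
    using eigenbasis3[OF assms(1-3)] assms(4) by blast
  define P :: "complex^3^3" where "P = transpose (vector [v1, v2, v3])"
  have P: "P *v x = x $ 1 *s v1 + x $ 2 *s v2 + x $ 3 *s v3" for x
    by (simp add: vec_eq_iff matrix_vector_mult_def P_def transpose_def sum_3 mult.commute)
  have "x = 0" if "P *v x = 0" for x
    using ind[rule_format, OF that[unfolded P]] by (simp add: vec_eq_iff forall_3)
  then have "\<forall>x. P *v x = 0 \<longrightarrow> x = 0" by blast
  then obtain Pi where Pi: "Pi ** P = mat 1" using matrix_left_invertible_ker by blast
  then have Pi': "P ** Pi = mat 1" using matrix_left_right_inverse by blast
  show ?thesis
  proof (rule exI[of _ P], rule exI[of _ Pi], intro conjI allI)
    show "P *v (Pi *v x) = x" "Pi *v (P *v x) = x" for x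
      by (simp_all add: matrix_vector_mul_assoc Pi Pi')
    show "A *v (P *v h) = P *v (\<chi> m. eigen3 l1 l2 m * h $ m)" for h
      unfolding P by (simp add: matrix_vector_right_distrib matrix_vector_mult_smult v vector_smult_assoc mult.commute)
  qed
qed

text \<open>\<open>jacobian\<close> records the derivative on the vectors \<open>axis i 1\<close>
  only, which do not span over the reals; complex homogeneity recovers the derivative from these
  values.\<close>

lemma jacobian_mult_vec:
  fixes X :: "complex^'n \<Rightarrow> complex^'m"
  assumes D: "(X has_derivative D) (at x)" and lin: "\<And>c h. D (c *s h) = c *s D h"
  shows "D h = jacobian X (at x) *v h"
proof -
  have "D h = D (\<Sum>i\<in>UNIV. (h $ i) *s axis i 1)" by (simp only: basis_expansion)
  also have "\<dots> = (\<Sum>i\<in>UNIV. (h $ i) *s D (axis i 1))"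
    by (simp add: linear_sum[OF has_derivative_linear[OF D]] lin)
  also have "\<dots> = matrix D *v h"
    by (simp add: vec_eq_iff matrix_vector_mult_def matrix_def mult.commute)
  finally show ?thesis by (simp add: jacobian_def frechet_derivative_at[OF D, symmetric])
qed

theorem theorem2p8:
  fixes X :: "complex^3 \<Rightarrow> complex^3" and U :: "(complex^3) set"
    and l1 l2 l3 :: complex
  assumes "open U" and "0 \<in> U"
    and "holomorphic_map_on X U"
    and "X 0 = 0"
    and "eigenvalues3 (jacobian X (at 0)) l1 l2 l3"
    and "l3 = 0"
    and "l1 \<noteq> 0" and "l2 \<noteq> 0"
    and "\<not> satisfies_resonance l1 l2"
    and "in_poincare_domain l1 l2"
    and "l1 = l2 \<Longrightarrow> diagonalizable (jacobian X (at 0))"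
  shows "\<exists>\<Phi> V W \<psi>1 \<psi>2 H.
           V \<subseteq> U \<and> local_biholomorphism \<Phi> V W \<and>
           mv_holomorphic_on \<psi>1 W \<and> mv_holomorphic_on \<psi>2 W \<and> mv_holomorphic_on H W \<and>
           \<psi>1 0 = 0 \<and> \<psi>2 0 = 0 \<and> H 0 = 0 \<and>
           expressed_in_coordinates X \<Phi> V (normal_form l1 l2 \<psi>1 \<psi>2 H) \<and>
           invariant_subspace_on (normal_form l1 l2 \<psi>1 \<psi>2 H) W {y. y $ 3 = 0}"
proof -
  define A where "A = jacobian X (at 0)"
  have hol: "open U \<and> (\<forall>z\<in>U. \<exists>D. (X has_derivative D) (at z) \<and> (\<forall>c h. D (c *s h) = c *s D h))"
    using assms(3) unfolding holomorphic_map_on_iff .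
  obtain D0 where D0: "(X has_derivative D0) (at 0)" "\<forall>c h. D0 (c *s h) = c *s D0 h"
    using hol assms(2) by blast
  have DA: "D0 h = A *v h" for h
    unfolding A_def by (rule jacobian_mult_vec[OF D0(1)]) (simp add: D0(2))
  have "\<exists>P Pi :: complex^3^3. (\<forall>x. P *v (Pi *v x) = x \<and> Pi *v (P *v x) = x) \<and>
    (\<forall>h. A *v (P *v h) = P *v (\<chi> m. eigen3 l1 l2 m * h $ m))"
    by (rule diagonalizing_matrix3) (use assms(5-8,11) in \<open>simp_all add: A_def\<close>)
  then obtain P Pi :: "complex^3^3" where PPi: "P *v (Pi *v x) = x" and PiP: "Pi *v (P *v x) = x"
    and AP: "A *v (P *v h) = P *v (\<chi> m. eigen3 l1 l2 m * h $ m)" for x h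
    by blast
  have "continuous_on UNIV ((*v) P)"
    by (rule linear_continuous_on[OF bounded_linear_matrix_vector_mult])
  then have "open ((*v) P -` U)" using assms(1) by (rule open_vimage[rotated])
  then obtain s where s: "0 < s" "polydisc s \<subseteq> (*v) P -` U"
    using polydisc_subset_open[of "(*v) P -` U"] assms(2) by auto
  \<comment> \<open>A dilation by \<open>s / 3\<close> carries \<open>polydisc 3\<close> into
    \<open>polydisc s\<close>. Being scalar, it commutes with linear maps, so the conjugated field
    keeps the diagonal linear part obtained from \<open>P\<close>.\<close>
  define k :: complex where "k = of_real (s / 3)"
  have k: "k \<noteq> 0" "norm k = s / 3" using s(1) by (auto simp: k_def simp del: of_real_divide)
  define T where "T x = P *v (k *s x)" for x
  define Ti where "Ti x = (1 / k) *s (Pi *v x)" for x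
  have Tmat: "T x = k *s (P *v x)" for x by (simp add: T_def matrix_vector_mult_smult)
  have smult: "bounded_linear (\<lambda>x :: complex^3. c *s x)" for c
  proof (rule linear_conv_bounded_linear[THEN iffD1], rule linearI)
    show "c *s (r *\<^sub>R x) = r *\<^sub>R (c *s x)" for r and x :: "complex^3" by (simp add: vec_eq_iff)
  qed (simp add: vec_eq_iff algebra_simps)
  have T: "bounded_linear T" "\<And>c h. T (c *s h) = c *s T h"
    unfolding T_def
    by (rule bounded_linear_compose[OF bounded_linear_matrix_vector_mult smult])
      (simp add: matrix_vector_mult_smult vector_smult_assoc mult.commute)
  have Ti: "bounded_linear Ti" "\<And>c h. Ti (c *s h) = c *s Ti h"
    unfolding Ti_def
    by (rule bounded_linear_compose[OF smult bounded_linear_matrix_vector_mult])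
      (simp add: matrix_vector_mult_smult vector_smult_assoc mult.commute)
  have TTi: "T (Ti x) = x" for x
    using k(1) by (simp add: T_def Ti_def vector_smult_assoc PPi)
  have TiT: "Ti (T x) = x" for x
    using k(1) by (simp add: Tmat Ti_def matrix_vector_mult_smult vector_smult_assoc PiP)
  have sub: "T x \<in> U" if "x \<in> polydisc 3" for x
  proof -
    have "norm k * norm (x $ m) < s" for m
      using that s(1) by (simp add: k(2) polydisc_def)
    then have "k *s x \<in> polydisc s" by (simp add: polydisc_def norm_mult)
    then show ?thesis using s(2) by (auto simp: T_def)
  qed
  have T0: "T 0 = 0" by (simp add: T_def)
  have der: "((\<lambda>x. Ti (X (T x))) has_derivative (\<lambda>h. Ti (D (T h)))) (at x)"
    if "(X has_derivative D) (at (T x))" for D x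
    by (rule bounded_linear.has_derivative[OF Ti(1)
          has_derivative_compose[OF bounded_linear_imp_has_derivative[OF T(1)] that]])
  have "holomorphic_map_on (\<lambda>x. Ti (X (T x))) (polydisc 3)"
    unfolding holomorphic_map_on_iff
  proof (intro conjI open_polydisc ballI)
    fix x assume "x \<in> polydisc 3"
    then obtain D where D: "(X has_derivative D) (at (T x))" "\<forall>c h. D (c *s h) = c *s D h"
      using hol sub by blast
    show "\<exists>D. ((\<lambda>x. Ti (X (T x))) has_derivative D) (at x) \<and> (\<forall>c h. D (c *s h) = c *s D h)"
      by (rule exI, rule conjI, rule der[OF D(1)]) (simp add: T(2) Ti(2) D(2))
  qed
  then have X': "mv_holomorphic_on (\<lambda>x. Ti (X (T x)) $ m) (polydisc 3)" for m
    unfolding holomorphic_map_on_def by blast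
  have DX': "((\<lambda>x. Ti (X (T x)) $ m) has_derivative (\<lambda>h. eigen3 l1 l2 m * h $ m)) (at 0)" for m
  proof -
    have "Ti (D0 (T h)) = (\<chi> m. eigen3 l1 l2 m * h $ m)" for h
    proof -
      have "D0 (T h) = T (\<chi> m. eigen3 l1 l2 m * h $ m)"
        by (simp add: DA Tmat matrix_vector_mult_smult AP)
      then show ?thesis by (simp add: TiT)
    qed
    then have "((\<lambda>x. Ti (X (T x))) has_derivative (\<lambda>h. \<chi> m. eigen3 l1 l2 m * h $ m)) (at 0)"
      using der[of D0 0] D0(1) by (simp add: T0)
    from has_derivative_vec_nth[OF this, of m] show ?thesis by simp
  qed
  have X0': "Ti (X (T 0)) = 0"
    using T0 assms(4) by (simp add: Ti_def)
  have nf: "has_normal_form (\<lambda>x. Ti (X (T x))) (polydisc 3) l1 l2"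
    by (rule normal_form_diagonal_linear_part[OF X' X0' DX' assms(9,10)])
  have "T ` polydisc 3 \<subseteq> U" using sub by blast
  from has_normal_form_linear_change[OF T Ti TTi TiT this nf]
  show ?thesis unfolding has_normal_form_def .
qed

end
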